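(* Consider the conditions: (A1) (a) $\lim_{n\to\infty} p_n^2/n = 0$; (b) $\lim_{n\to\infty} p_n^2 M_n^2/n^2 = 0$; (c) $\lim_{n\to\infty} p_n/M_n^{s_\theta} = 0$. (A2) The smallest eigenvalue $\lambda_{\min}(\Xi^{(n)})$ of $\Xi^{(n)}$ satisfies $\liminf_{n\to\infty}\lambda_{\min}(\Xi^{(n)}) = c_\lambda > 0$. (A3) $\lambda_n = o(k_n^{-1/2})$. Then, under (A1) and (A2), $$\|\widehat{\boldsymbol\beta}^{(n)} - \boldsymbol\beta^{(n)}\| = O_P\big(\sqrt{p_n/n} + M_n^{-s_g} + \sqrt{k_n}\,\lambda_n\big).$$ Consequently, under (A1), (A2) and (A3), $\|\widehat{\boldsymbol\beta}^{(n)} - \boldsymbol\beta^{(n)}\| \to 0$ in probability.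
   Context: Model. For each sample size $n$, the data $(\mathbf X_i^{(n)},T_i,Y_i)$, $i=1,\dots,n$, are i.i.d. copies of $(\mathbf X^{(n)},T,Y)$ with $\mathbf X^{(n)}\in\mathbb R^{p_n}$, $T\in[0,1]$, and $$Y_i=\mathbf X_i^{(n)\prime}\boldsymbol\beta^{(n)}+g(T_i)+\varepsilon_i,$$ where $\varepsilon_i$ is independent of $(\mathbf X_i^{(n)},T_i)$ with mean $0$ and variance $\sigma^2$, and $g:[0,1]\to\mathbb R$ is an unknown function. The dimension $p_n$ may diverge with $n$. A prime denotes transpose and $\|\cdot\|$ the Euclidean norm of a vector. The coefficient vector is $\boldsymbol\beta^{(n)}=(\boldsymbol\beta_1^{(n)\prime},\boldsymbol\beta_2^{(n)\prime})'$, where $\boldsymbol\beta_1^{(n)}=(\beta_1^{(n)},\dots,\beta_{k_n}^{(n)})'$ has nonzero entries and $\boldsymbol\beta_2^{(n)}=\mathbf 0\in\mathbb R^{m_n}$, $m_n=p_n-k_n$. Write $\mathbf Y=(Y_1,\dots,Y_n)'$ and let $\mathbb X^{(n)}$ be the $n\times p_n$ matrix with rows $\mathbf X_i^{(n)\prime}$. Splines. $\Delta_n=\{\xi_{n\nu}\}_{\nu=1}^{M_n}$ is a partition of $[0,1]$ (with $\xi_{n0}=0$, $\xi_{n,M_n+1}=1$) into $M_n+1$ subintervals $[\xi_{n\nu},\xi_{n,\nu+1})$, $\nu=0,\dots,M_n-1$, and $[\xi_{nM_n},1]$, with largest mesh size $O(M_n^{-1})$. For a fixed order $m$, $\mathcal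 S_m(\Delta_n)$ is the space of functions on $[0,1]$ that are polynomials of order $m$ (degree at most $m-1$) on each subinterval and, if $m\ge2$, are $m-2$ times continuously differentiable on $[0,1]$. Let $B_{n1},\dots,B_{nq_n}$, $q_n=M_n+m$, be a local (B-spline) basis of it, $\mathbf Z(t;\Delta_n)=(B_{n1}(t),\dots,B_{nq_n}(t))'$, and $\mathbb Z^{(n)}$ the $n\times q_n$ matrix with rows $\mathbf Z(T_i;\Delta_n)'$. Estimator. For fixed $a>2$ and $\lambda>0$ the SCAD penalty is $p_\lambda(\theta;a)=\lambda|\theta|$ if $|\theta|\le\lambda$; $-(\theta^2-2a\lambda|\theta|+\lambda^2)/[2(a-1)]$ if $\lambda<|\theta|\le a\lambda$; $(a+1)\lambda^2/2$ if $|\theta|>a\lambda$. The pair $(\widehat{\boldsymbol\beta}^{(n)},\widehat{\boldsymbol\alpha}^{(n)})$ is a (global) minimizer over $(\mathbf b,\mathbf a)\in\mathbb R^{p_n}\times\mathbb R^{q_n}$ of $$\|\mathbf Y-\mathbb X^{(n)}\mathbf b-\mathbb Z^{(n)}\mathbf a\|^2+n\sum_{j=1}^{p_n}p_{\lambda_n}(b_j;a).$$ Notation. $\theta_j^{(n)}(t)=E[X_j^{(n)}\mid T=t]$, $\mathbf e^{(n)}=\mathbf X^{(n)}-E[\mathbf X^{(n)}\mid T]$, $\Sigma^{(n)}(t)=\mathrm{Var}(\mathbf e^{(n)}\mid T=t)$, $\Xi^{(n)}=E[\Sigma^{(n)}(T)]$ (the unconditional covariance matrix of $\mathbf e^{(n)}$).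 Standing assumptions. $M_n$ is allowed to tend to infinity with $M_n=o(n)$; $\lambda_n\to0$; and: Condition 1: there are constants $\gamma_\theta,M_\theta>0$ and an integer $r_\theta$ with $0\le r_\theta\le m-1$ such that the $r_\theta$-th derivatives satisfy $\sup_{n\ge1}\sup_{1\le j\le p_n}|(\theta_j^{(n)})^{(r_\theta)}(t_2)-(\theta_j^{(n)})^{(r_\theta)}(t_1)|\le M_\theta|t_2-t_1|^{\gamma_\theta}$ for all $t_1,t_2\in[0,1]$; $s_\theta=r_\theta+\gamma_\theta$. Condition 2: there is a constant $\sigma_{4e}$ such that $E[(e_j^{(n)})^4\mid T]\le\sigma_{4e}$ almost surely for all $n$ and $1\le j\le p_n$. Condition 3: there are constants $\gamma_g,M_g>0$ and an integer $r_g$ with $0\le r_g\le m-1$ such that $|g^{(r_g)}(t_2)-g^{(r_g)}(t_1)|\le M_g|t_2-t_1|^{\gamma_g}$ for all $t_1,t_2\in[0,1]$; $s_g=r_g+\gamma_g$. *)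

theory Defs
  imports
    "HOL-Probability.Probability"
    "Jordan_Normal_Form.Spectral_Radius"
begin

definition scad_penalty :: "real \<Rightarrow> real \<Rightarrow> real \<Rightarrow> real" where
  "scad_penalty l a x =
    (if \<bar>x\<bar> \<le> l then l * \<bar>x\<bar>
     else if \<bar>x\<bar> \<le> a * l then - (x\<^sup>2 - 2 * a * l * \<bar>x\<bar> + l\<^sup>2) / (2 * (a - 1))
     else (a + 1) * l\<^sup>2 / 2)"

text \<open>\<^term>\<open>h\<close> is an \<open>r\<close>-th derivative of \<^term>\<open>f\<close> on \<^term>\<open>S\<close>; derivatives are taken within \<^term>\<open>S\<close>,
  hence one-sided at the endpoints of an interval.\<close>

definition has_nth_derivative_on ::
    "nat \<Rightarrow> (real \<Rightarrow> real) \<Rightarrow> (real \<Rightarrow> real) \<Rightarrow> real set \<Rightarrow> bool" where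
  "has_nth_derivative_on r f h S \<longleftrightarrow>
    (\<exists>D :: nat \<Rightarrow> real \<Rightarrow> real.
       (\<forall>t\<in>S. D 0 t = f t \<and> D r t = h t) \<and>
       (\<forall>i<r. \<forall>t\<in>S. (D i has_real_derivative D (Suc i) t) (at t within S)))"

definition holder_smooth :: "nat \<Rightarrow> real \<Rightarrow> real \<Rightarrow> (real \<Rightarrow> real) \<Rightarrow> bool" where
  "holder_smooth r \<gamma> L f \<longleftrightarrow>
    (\<exists>h. has_nth_derivative_on r f h {0..1} \<and>
       (\<forall>t1\<in>{0..1}. \<forall>t2\<in>{0..1}. \<bar>h t2 - h t1\<bar> \<le> L * \<bar>t2 - t1\<bar> powr \<gamma>))"

text \<open>\<open>K\<close> interior knots \<open>\<xi> 1, \<dots>, \<xi> K\<close>, together with the endpoints \<open>\<xi> 0 = 0\<close> and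
  \<open>\<xi> (K + 1) = 1\<close>.\<close>

definition knot_partition :: "nat \<Rightarrow> (nat \<Rightarrow> real) \<Rightarrow> bool" where
  "knot_partition K \<xi> \<longleftrightarrow> \<xi> 0 = 0 \<and> \<xi> (Suc K) = 1 \<and> (\<forall>\<nu>\<le>K. \<xi> \<nu> < \<xi> (Suc \<nu>))"

definition knot_cell :: "nat \<Rightarrow> (nat \<Rightarrow> real) \<Rightarrow> nat \<Rightarrow> real set" where
  "knot_cell K \<xi> \<nu> = (if \<nu> < K then {\<xi> \<nu>..<\<xi> (Suc \<nu>)} else {\<xi> \<nu>..1})"

text \<open>Splines are represented by functions on all of \<^typ>\<open>real\<close> whose values outside \<open>[0, 1]\<close> are
  irrelevant.\<close>

definition spline_space :: "nat \<Rightarrow> nat \<Rightarrow> (nat \<Rightarrow> real) \<Rightarrow> (real \<Rightarrow> real) set" where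
  "spline_space m K \<xi> =
    {s. (\<forall>\<nu>\<le>K. \<exists>q :: real poly. degree q \<le> m - 1 \<and> (\<forall>t\<in>knot_cell K \<xi> \<nu>. s t = poly q t)) \<and>
        (2 \<le> m \<longrightarrow> (\<exists>h. has_nth_derivative_on (m - 2) s h {0..1} \<and> continuous_on {0..1} h))}"

text \<open>A basis of the spline space (as a space of functions on \<open>[0, 1]\<close>) that is local: like a B-spline,
  every element vanishes off the closure of at most \<open>m\<close> consecutive cells.\<close>

definition local_spline_basis ::
    "nat \<Rightarrow> nat \<Rightarrow> (nat \<Rightarrow> real) \<Rightarrow> (nat \<Rightarrow> real \<Rightarrow> real) \<Rightarrow> bool" where
  "local_spline_basis m K \<xi> B \<longleftrightarrow>
    (\<forall>w<K + m. B w \<in> spline_space m K \<xi>) \<and>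
    (\<forall>s\<in>spline_space m K \<xi>. \<exists>c. \<forall>t\<in>{0..1}. s t = (\<Sum>w<K + m. c w * B w t)) \<and>
    (\<forall>c. (\<forall>t\<in>{0..1}. (\<Sum>w<K + m. c w * B w t) = 0) \<longrightarrow> (\<forall>w<K + m. c w = 0)) \<and>
    (\<forall>w<K + m. \<exists>\<nu>\<le>K. \<forall>t\<in>{0..1}.
        t \<notin> {\<xi> \<nu>..\<xi> (min (\<nu> + m) (Suc K))} \<longrightarrow> B w t = 0)"

text \<open>Vectors in $\mathbb{R}^p$ are functions \<^typ>\<open>nat \<Rightarrow> real\<close> of which only the values at indices
  \<open>< p\<close> matter; \<^const>\<open>L2_set\<close> is the Euclidean norm.\<close>

definition scad_objective ::
    "nat \<Rightarrow> nat \<Rightarrow> nat \<Rightarrow> real \<Rightarrow> real \<Rightarrow> (nat \<Rightarrow> nat \<Rightarrow> real) \<Rightarrow> (nat \<Rightarrow> nat \<Rightarrow> real) \<Rightarrow>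
     (nat \<Rightarrow> real) \<Rightarrow> (nat \<Rightarrow> real) \<Rightarrow> (nat \<Rightarrow> real) \<Rightarrow> real" where
  "scad_objective n p q l a x z y b c =
    (L2_set (\<lambda>i. y i - (\<Sum>j<p. x i j * b j) - (\<Sum>w<q. z i w * c w)) {..<n})\<^sup>2
      + real n * (\<Sum>j<p. scad_penalty l a (b j))"

definition scad_minimizer ::
    "nat \<Rightarrow> nat \<Rightarrow> nat \<Rightarrow> real \<Rightarrow> real \<Rightarrow> (nat \<Rightarrow> nat \<Rightarrow> real) \<Rightarrow> (nat \<Rightarrow> nat \<Rightarrow> real) \<Rightarrow>
     (nat \<Rightarrow> real) \<Rightarrow> (nat \<Rightarrow> real) \<Rightarrow> (nat \<Rightarrow> real) \<Rightarrow> bool" where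
  "scad_minimizer n p q l a x z y bh ch \<longleftrightarrow>
    (\<forall>b c. scad_objective n p q l a x z y bh ch \<le> scad_objective n p q l a x z y b c)"

definition iid_vars :: "'a measure \<Rightarrow> 'b measure \<Rightarrow> (nat \<Rightarrow> 'a \<Rightarrow> 'b) \<Rightarrow> nat \<Rightarrow> bool" where
  "iid_vars P N D n \<longleftrightarrow>
    prob_space.indep_vars P (\<lambda>_. N) D {..<n} \<and>
    (\<forall>i<n. \<forall>i'<n. distr P N (D i) = distr P N (D i'))"

text \<open>Like \<^const>\<open>prob_space.indep_var\<close>, which requires both variables to have the same type of
  values.\<close>

definition independent_vars ::
    "'a measure \<Rightarrow> 'b measure \<Rightarrow> ('a \<Rightarrow> 'b) \<Rightarrow> 'c measure \<Rightarrow> ('a \<Rightarrow> 'c) \<Rightarrow> bool" where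
  "independent_vars P N U N' V \<longleftrightarrow>
    U \<in> measurable P N \<and> V \<in> measurable P N' \<and>
    prob_space.indep_set P
      {U -` A \<inter> space P | A. A \<in> sets N} {V -` A \<inter> space P | A. A \<in> sets N'}"

abbreviation rvec_space :: "nat \<Rightarrow> (nat \<Rightarrow> real) measure" where
  "rvec_space p \<equiv> \<Pi>\<^sub>M j\<in>{..<p}. borel"

definition rvec :: "nat \<Rightarrow> (nat \<Rightarrow> 'a \<Rightarrow> real) \<Rightarrow> 'a \<Rightarrow> nat \<Rightarrow> real" where
  "rvec p X \<omega> = (\<lambda>j\<in>{..<p}. X j \<omega>)"

definition partially_linear_sample ::
    "'a measure \<Rightarrow> nat \<Rightarrow> nat \<Rightarrow> (nat \<Rightarrow> nat \<Rightarrow> 'a \<Rightarrow> real) \<Rightarrow> (nat \<Rightarrow> 'a \<Rightarrow> real) \<Rightarrow>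
     (nat \<Rightarrow> 'a \<Rightarrow> real) \<Rightarrow> (nat \<Rightarrow> 'a \<Rightarrow> real) \<Rightarrow> (nat \<Rightarrow> real) \<Rightarrow> (real \<Rightarrow> real) \<Rightarrow> real \<Rightarrow> bool" where
  "partially_linear_sample P n p X T Y \<epsilon> \<beta> g \<sigma> \<longleftrightarrow>
    prob_space P \<and>
    iid_vars P (rvec_space p \<Otimes>\<^sub>M borel \<Otimes>\<^sub>M borel) (\<lambda>i \<omega>. (rvec p (X i) \<omega>, T i \<omega>, Y i \<omega>)) n \<and>
    (\<forall>i<n.
       (\<forall>\<omega>\<in>space P. T i \<omega> \<in> {0..1}) \<and>
       (\<forall>\<omega>\<in>space P. Y i \<omega> = (\<Sum>j<p. X i j \<omega> * \<beta> j) + g (T i \<omega>) + \<epsilon> i \<omega>) \<and>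
       independent_vars P borel (\<epsilon> i) (rvec_space p \<Otimes>\<^sub>M borel) (\<lambda>\<omega>. (rvec p (X i) \<omega>, T i \<omega>)) \<and>
       integrable P (\<epsilon> i) \<and> (LINT \<omega>|P. \<epsilon> i \<omega>) = 0 \<and>
       integrable P (\<lambda>\<omega>. (\<epsilon> i \<omega>)\<^sup>2) \<and> prob_space.variance P (\<epsilon> i) = \<sigma>\<^sup>2)"

abbreviation sigma_of :: "'a measure \<Rightarrow> ('a \<Rightarrow> real) \<Rightarrow> 'a measure" where
  "sigma_of P T \<equiv> vimage_algebra (space P) T borel"

text \<open>\<open>X - E[X | T]\<close>, as a function on the sample space.\<close>

definition cond_residual :: "'a measure \<Rightarrow> ('a \<Rightarrow> real) \<Rightarrow> ('a \<Rightarrow> real) \<Rightarrow> 'a \<Rightarrow> real" where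
  "cond_residual P T U \<omega> = U \<omega> - real_cond_exp P (sigma_of P T) U \<omega>"

definition cond_cov :: "'a measure \<Rightarrow> ('a \<Rightarrow> real) \<Rightarrow> ('a \<Rightarrow> real) \<Rightarrow> ('a \<Rightarrow> real) \<Rightarrow> 'a \<Rightarrow> real" where
  "cond_cov P T U V =
    real_cond_exp P (sigma_of P T) (\<lambda>\<omega>. cond_residual P T U \<omega> * cond_residual P T V \<omega>)"

text \<open>\<open>E[Var(e | T)]\<close> for the vector \<open>e = X - E[X | T]\<close> of length \<open>p\<close>.\<close>

definition Xi_matrix :: "'a measure \<Rightarrow> nat \<Rightarrow> (nat \<Rightarrow> 'a \<Rightarrow> real) \<Rightarrow> ('a \<Rightarrow> real) \<Rightarrow> real mat" where
  "Xi_matrix P p X T =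
    mat p p (\<lambda>(j, l). LINT \<omega>|P. cond_cov P T (cond_residual P T (X j)) (cond_residual P T (X l)) \<omega>)"

definition lambda_min :: "real mat \<Rightarrow> real" where
  "lambda_min A = Min (spectrum A)"

text \<open>Stochastic order and convergence in probability for triangular arrays: the \<open>n\<close>-th variable lives
  on its own probability space \<open>P n\<close>.\<close>

definition bigO_prob :: "(nat \<Rightarrow> 'a measure) \<Rightarrow> (nat \<Rightarrow> 'a \<Rightarrow> real) \<Rightarrow> (nat \<Rightarrow> real) \<Rightarrow> bool" where
  "bigO_prob P W r \<longleftrightarrow>
    (\<forall>\<delta>>0. \<exists>C>0. \<forall>\<^sub>F n in sequentially.
       measure (P n) {\<omega> \<in> space (P n). C * \<bar>r n\<bar> < \<bar>W n \<omega>\<bar>} \<le> \<delta>)"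

definition tendsto_zero_prob :: "(nat \<Rightarrow> 'a measure) \<Rightarrow> (nat \<Rightarrow> 'a \<Rightarrow> real) \<Rightarrow> bool" where
  "tendsto_zero_prob P W \<longleftrightarrow>
    (\<forall>\<delta>>0. (\<lambda>n. measure (P n) {\<omega> \<in> space (P n). \<delta> < \<bar>W n \<omega>\<bar>}) \<longlonglongrightarrow> 0)"

end

theory Submission
  imports Defs
begin

text \<open>Let \<open>Q\<close> be the residual map of the projection onto the spline columns and \<open>d\<close> the estimation error
  of the coefficients. Comparing the minimizer with the true coefficients gives
  \<open>|Q X d|\<^sup>2 \<le> 2 \<langle>Q (g + \<epsilon>), Q X d\<rangle> + n k (a + 1) \<lambda>\<^sup>2 / 2\<close>. Here \<open>|Q g|\<^sup>2\<close> is at most \<open>n\<close> times the squared spline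
  approximation error of \<open>g\<close>, and the sum of the \<open>\<langle>Q X\<^sub>j, \<epsilon>\<rangle>\<^sup>2\<close> has expectation \<open>O(n p)\<close>.

  It remains to see that \<open>|Q X d|\<^sup>2 \<ge> c n |d|\<^sup>2\<close> with high probability, uniformly in \<open>d\<close>. Write \<open>X = \<theta>(T) + e\<close>.
  The part \<open>Q \<theta>(T)\<close> is negligible by spline approximation. The \<open>q\<close> orthonormal spline directions depend on
  the \<open>T\<^sub>i\<close> only, so \<open>e\<close> has conditional mean zero against them and the squared projections of its columns
  have total expectation \<open>O(p q) = o(n)\<close>. Finally \<open>e' e / n\<close> differs from \<open>\<Xi>\<close> by \<open>O(p / \<surd>n)\<close> in Frobenius
  norm, and \<open>\<Xi>\<close> is bounded below by its smallest eigenvalue.\<close>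

section \<open>Spline approximation of smooth functions\<close>

text \<open>Only the largest mesh is controlled, so neighbouring knots may be arbitrarily close. The
  approximants are therefore built from monotone-looking steps with values in [0, 1] for any knot
  gaps, and higher smoothness is gained by integration.

  The least squares projection depends on the whole sample, while the i.i.d. hypothesis concerns the
  triples (X, T, Y). Every error statistic is hence written as a function of these triples, the
  noise being recovered from them, and its moment is computed on a product measure. Conditioning on
  the other observations becomes integration over one coordinate. The inequalities for the minimizer
  hold sample by sample and for all coefficient vectors, so the dependence of the estimate on the
  data causes no trouble.

  Each part of (A1) has its place: (a) makes the Gram error of order \<open>p^2 / n\<close> vanish,
  (b) is the square of the projection error \<open>p * M / n\<close>, and (c) makes the spline bias
  of the regression functions small and forces the number of knots to infinity.\<close>

definition trunc_pow :: "nat \<Rightarrow> real \<Rightarrow> real \<Rightarrow> real" where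
  "trunc_pow k y t = (if t < y then (y - t) ^ k else 0)"

fun divided_difference :: "(real \<Rightarrow> real) \<Rightarrow> (nat \<Rightarrow> real) \<Rightarrow> nat \<Rightarrow> nat \<Rightarrow> real" where
  "divided_difference f x i 0 = f (x i)"
| "divided_difference f x i (Suc k) =
     (divided_difference f x (Suc i) k - divided_difference f x i k) / (x (i + Suc k) - x i)"

text \<open>Leibniz' rule: only the divided differences of order 0 and 1 of the linear factor
  \<open>y - t\<close> are nonzero. Together with
  \<open>trunc_pow (Suc k) y t = (y - t) * trunc_pow k y t\<close> it yields the recursion for the
  ramps.\<close>

lemma divided_difference_times_linear:
  assumes "\<And>i' j'. i \<le> i' \<Longrightarrow> i' < j' \<Longrightarrow> j' \<le> i + Suc k \<Longrightarrow> x i' < x j'"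
  shows "divided_difference (\<lambda>y. (y - t) * f y) x i (Suc k) =
    (x i - t) * divided_difference f x i (Suc k) + divided_difference f x (Suc i) k"
  using assms
proof (induction k arbitrary: i)
  case 0
  have "x i < x (Suc i)" using 0 by simp
  then show ?case by (simp add: field_simps)
next
  case (Suc k)
  have IH1: "divided_difference (\<lambda>y. (y - t) * f y) x i (Suc k) =
    (x i - t) * divided_difference f x i (Suc k) + divided_difference f x (Suc i) k"
    by (rule Suc.IH) (use Suc.prems in simp)
  have IH2: "divided_difference (\<lambda>y. (y - t) * f y) x (Suc i) (Suc k) =
    (x (Suc i) - t) * divided_difference f x (Suc i) (Suc k) + divided_difference f x (Suc (Suc i)) k"
    by (rule Suc.IH) (use Suc.prems in simp)
  define D where "D = divided_difference f x (Suc i) (Suc k)"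
  define E where "E = divided_difference f x i (Suc k)"
  have less: "x i < x (i + Suc (Suc k))" "x (Suc i) < x (Suc i + Suc k)"
    using Suc.prems[of i "i + Suc (Suc k)"] Suc.prems[of "Suc i" "Suc i + Suc k"] by simp_all
  \<comment> \<open>Clearing the denominator of \<open>D\<close> expresses the difference of the two
    trailing terms of the induction hypotheses through \<open>D\<close> itself.\<close>
  have D: "divided_difference f x (Suc (Suc i)) k - divided_difference f x (Suc i) k =
      (x (Suc i + Suc k) - x (Suc i)) * D"
    using less by (simp add: D_def)
  have "divided_difference (\<lambda>y. (y - t) * f y) x i (Suc (Suc k)) =
     ((x (Suc i) - t) * D + divided_difference f x (Suc (Suc i)) k
      - ((x i - t) * E + divided_difference f x (Suc i) k)) / (x (i + Suc (Suc k)) - x i)"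
    by (subst divided_difference.simps(2)) (simp only: IH1 IH2 D_def E_def)
  also have "\<dots> = ((x (Suc i) - t) * D - (x i - t) * E + (x (Suc i + Suc k) - x (Suc i)) * D)
     / (x (i + Suc (Suc k)) - x i)"
    by (rule arg_cong[of _ _ "\<lambda>z. z / _"]) (use D in linarith)
  also have "\<dots> = ((x i - t) * (D - E) + (x (i + Suc (Suc k)) - x i) * D) / (x (i + Suc (Suc k)) - x i)"
    by (simp add: algebra_simps)
  also have "\<dots> = (x i - t) * ((D - E) / (x (i + Suc (Suc k)) - x i)) + D"
    using less by (simp add: field_simps)
  also have "(D - E) / (x (i + Suc (Suc k)) - x i) = divided_difference f x i (Suc (Suc k))"
    unfolding D_def E_def by (rule divided_difference.simps(2)[symmetric])
  finally show ?case unfolding D_def .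
qed

text \<open>The ramp at \<open>Suc i\<close> minus the ramp at \<open>i\<close> is the normalized
  B-spline of degree \<open>k\<close> on the knots \<open>x i, ..., x (i + k + 1)\<close>. A ramp is
  thus a partial sum of a partition of unity: a step from 1 to 0 that takes place between
  \<open>x i\<close> and \<open>x (i + k)\<close>.\<close>

definition spline_ramp :: "nat \<Rightarrow> (nat \<Rightarrow> real) \<Rightarrow> nat \<Rightarrow> real \<Rightarrow> real" where
  "spline_ramp k x i t = divided_difference (\<lambda>y. trunc_pow k y t) x i k"

text \<open>The counterpart of the Cox-de Boor recursion. Between the outer knots it is a convex
  combination of two lower ramps, which keeps the values in [0, 1] by induction.\<close>

lemma spline_ramp_Suc:
  assumes "\<And>i' j'. i \<le> i' \<Longrightarrow> i' < j' \<Longrightarrow> j' \<le> i + Suc k \<Longrightarrow> x i' < x j'"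
  shows "spline_ramp (Suc k) x i t =
    ((x (i + Suc k) - t) * spline_ramp k x (Suc i) t + (t - x i) * spline_ramp k x i t)
      / (x (i + Suc k) - x i)"
proof -
  have less: "x i < x (i + Suc k)" using assms[of i "i + Suc k"] by simp
  have "(\<lambda>y. trunc_pow (Suc k) y t) = (\<lambda>y. (y - t) * trunc_pow k y t)"
    by (auto simp: trunc_pow_def)
  then have "spline_ramp (Suc k) x i t =
      (x i - t) * divided_difference (\<lambda>y. trunc_pow k y t) x i (Suc k)
      + divided_difference (\<lambda>y. trunc_pow k y t) x (Suc i) k"
    unfolding spline_ramp_def
    using divided_difference_times_linear[OF assms, where f="\<lambda>y. trunc_pow k y t" and t=t] by simp
  also have "\<dots> = (x i - t) * ((spline_ramp k x (Suc i) t - spline_ramp k x i t) / (x (i + Suc k) - x i))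
      + spline_ramp k x (Suc i) t"
    by (simp add: spline_ramp_def)
  also have "\<dots> = ((x (i + Suc k) - t) * spline_ramp k x (Suc i) t + (t - x i) * spline_ramp k x i t)
      / (x (i + Suc k) - x i)"
    using less by (simp add: field_simps)
  finally show ?thesis .
qed

lemma spline_ramp_values:
  assumes "\<And>i' j'. i \<le> i' \<Longrightarrow> i' < j' \<Longrightarrow> j' \<le> i + k \<Longrightarrow> x i' < x j'"
  shows "0 \<le> spline_ramp k x i t \<and> spline_ramp k x i t \<le> 1 \<and>
    (t < x i \<longrightarrow> spline_ramp k x i t = 1) \<and> (x (i + k) \<le> t \<longrightarrow> spline_ramp k x i t = 0)"
  using assms
proof (induction k arbitrary: i)
  case 0
  then show ?case by (auto simp: spline_ramp_def trunc_pow_def)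
next
  case (Suc k)
  have less: "x i < x (i + Suc k)" "x i < x (Suc i)" "x (i + k) < x (i + Suc k)"
    using Suc.prems by simp_all
  define U V where "U = spline_ramp k x (Suc i) t" and "V = spline_ramp k x i t"
  have U: "0 \<le> U \<and> U \<le> 1 \<and> (t < x (Suc i) \<longrightarrow> U = 1) \<and> (x (i + Suc k) \<le> t \<longrightarrow> U = 0)"
    using Suc.IH[of "Suc i"] Suc.prems by (simp add: U_def)
  have V: "0 \<le> V \<and> V \<le> 1 \<and> (t < x i \<longrightarrow> V = 1) \<and> (x (i + k) \<le> t \<longrightarrow> V = 0)"
    using Suc.IH[of i] Suc.prems by (simp add: V_def)
  have eq: "spline_ramp (Suc k) x i t = ((x (i + Suc k) - t) * U + (t - x i) * V) / (x (i + Suc k) - x i)"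
    unfolding U_def V_def by (rule spline_ramp_Suc) (use Suc.prems in simp)
  consider "t < x i" | "x i \<le> t" "t \<le> x (i + Suc k)" | "x (i + Suc k) < t" by linarith
  then show ?case
  proof cases
    case 1
    then have "U = 1" "V = 1" using U V less by auto
    then show ?thesis using eq less 1 by (simp add: field_simps)
  next
    case 2
    have "0 \<le> (x (i + Suc k) - t) * U" "0 \<le> (t - x i) * V"
         "(x (i + Suc k) - t) * U \<le> (x (i + Suc k) - t) * 1" "(t - x i) * V \<le> (t - x i) * 1"
      using 2 U V by (intro mult_nonneg_nonneg mult_left_mono; simp)+
    then have "0 \<le> spline_ramp (Suc k) x i t" "spline_ramp (Suc k) x i t \<le> 1"
      unfolding eq using less(1) by (simp_all add: divide_le_eq)
    moreover have "x (i + Suc k) \<le> t \<longrightarrow> U = 0 \<and> V = 0" using U V less by auto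
    ultimately show ?thesis using eq 2 by auto
  next
    case 3
    then have "U = 0" "V = 0" using U V less by auto
    then show ?thesis using eq less 3 by simp
  qed
qed

text \<open>The powers are truncated on the right of a knot and vanish at it, so for
  \<open>k = 0\<close> they jump exactly as the half-open cells do. The knot \<open>\<xi> 0\<close>
  is included so that the ramp that starts there lies in the span.\<close>

definition trunc_pow_span :: "nat \<Rightarrow> nat \<Rightarrow> (nat \<Rightarrow> real) \<Rightarrow> (real \<Rightarrow> real) set" where
  "trunc_pow_span k K \<xi> =
    {s. \<exists>a c. s = (\<lambda>t. (\<Sum>j\<le>k. a j * t ^ j) + (\<Sum>\<nu>\<le>K. c \<nu> * trunc_pow k (\<xi> \<nu>) t))}"

lemma trunc_pow_spanI:
  "(\<And>t. s t = (\<Sum>j\<le>k. a j * t ^ j) + (\<Sum>\<nu>\<le>K. c \<nu> * trunc_pow k (\<xi> \<nu>) t)) \<Longrightarrow> s \<in> trunc_pow_span k K \<xi>"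
  unfolding trunc_pow_span_def by blast

lemma trunc_pow_span_lincomb:
  assumes "f \<in> trunc_pow_span k K \<xi>" "h \<in> trunc_pow_span k K \<xi>"
  shows "(\<lambda>t. u * f t + v * h t) \<in> trunc_pow_span k K \<xi>"
proof -
  obtain a c where f: "f = (\<lambda>t. (\<Sum>j\<le>k. a j * t ^ j) + (\<Sum>\<nu>\<le>K. c \<nu> * trunc_pow k (\<xi> \<nu>) t))"
    using assms(1) by (auto simp: trunc_pow_span_def)
  obtain a' c' where h: "h = (\<lambda>t. (\<Sum>j\<le>k. a' j * t ^ j) + (\<Sum>\<nu>\<le>K. c' \<nu> * trunc_pow k (\<xi> \<nu>) t))"
    using assms(2) by (auto simp: trunc_pow_span_def)
  have "(\<lambda>t. u * f t + v * h t) = (\<lambda>t. (\<Sum>j\<le>k. (u * a j + v * a' j) * t ^ j)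
      + (\<Sum>\<nu>\<le>K. (u * c \<nu> + v * c' \<nu>) * trunc_pow k (\<xi> \<nu>) t))"
    by (rule ext) (simp add: f h algebra_simps sum.distrib sum_distrib_left)
  then show ?thesis by (intro trunc_pow_spanI) (rule fun_cong)
qed

lemma const_in_trunc_pow_span: "(\<lambda>_. u) \<in> trunc_pow_span k K \<xi>"
  by (rule trunc_pow_spanI[where a="\<lambda>j. if j = 0 then u else 0" and c="\<lambda>_. 0"])
    (simp add: if_distrib[of "\<lambda>z. z * _"] sum.delta cong: if_cong)

lemma trunc_pow_in_span: "\<nu> \<le> K \<Longrightarrow> trunc_pow k (\<xi> \<nu>) \<in> trunc_pow_span k K \<xi>"
  by (rule trunc_pow_spanI[where a="\<lambda>_. 0" and c="\<lambda>\<mu>. if \<mu> = \<nu> then 1 else 0"])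
    (simp add: if_distrib[of "\<lambda>z. z * _"] sum.delta cong: if_cong)

lemma trunc_pow_span_sum:
  assumes "finite I" "\<And>i. i \<in> I \<Longrightarrow> f i \<in> trunc_pow_span k K \<xi>"
  shows "(\<lambda>t. u + (\<Sum>i\<in>I. c i * f i t)) \<in> trunc_pow_span k K \<xi>"
  using assms
proof (induction I rule: finite_induct)
  case empty
  then show ?case using const_in_trunc_pow_span by simp
next
  case (insert i I)
  have "(\<lambda>t. 1 * (u + (\<Sum>i\<in>I. c i * f i t)) + c i * f i t) \<in> trunc_pow_span k K \<xi>"
    by (rule trunc_pow_span_lincomb) (use insert in auto)
  then show ?case using insert by (simp add: algebra_simps)
qed

lemma spline_ramp_in_span:
  assumes "i + k \<le> K"
  shows "spline_ramp k \<xi> i \<in> trunc_pow_span k K \<xi>"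
proof -
  \<comment> \<open>The power \<open>k\<close> stays fixed while the order \<open>l\<close> of the
    difference grows; a difference of order \<open>l\<close> combines the truncated powers at the
    knots \<open>i, ..., i + l\<close>.\<close>
  have "i + l \<le> K \<Longrightarrow> (\<lambda>t. divided_difference (\<lambda>y. trunc_pow k y t) \<xi> i l) \<in> trunc_pow_span k K \<xi>" for l
  proof (induction l arbitrary: i)
    case 0
    then show ?case using trunc_pow_in_span[of i K k \<xi>] by simp
  next
    case (Suc l)
    let ?h = "\<xi> (i + Suc l) - \<xi> i"
    have "(\<lambda>t. (1 / ?h) * divided_difference (\<lambda>y. trunc_pow k y t) \<xi> (Suc i) l
        + (- 1 / ?h) * divided_difference (\<lambda>y. trunc_pow k y t) \<xi> i l) \<in> trunc_pow_span k K \<xi>"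
      by (rule trunc_pow_span_lincomb) (use Suc in auto)
    then show ?case by (simp add: diff_divide_distrib)
  qed
  then show ?thesis using assms unfolding spline_ramp_def[abs_def] by blast
qed

section \<open>Knots of a partition and smoothness of truncated powers\<close>

lemma knot_partition_less:
  assumes "knot_partition K \<xi>" "i < j" "j \<le> Suc K"
  shows "\<xi> i < \<xi> j"
  using assms(2,3)
proof (induction j)
  case (Suc j)
  then have "\<xi> j < \<xi> (Suc j)" using assms(1) by (simp add: knot_partition_def)
  then show ?case using Suc by (cases "i = j") auto
qed simp

lemma knot_partition_mono:
  assumes "knot_partition K \<xi>" "i \<le> j" "j \<le> Suc K"
  shows "\<xi> i \<le> \<xi> j"
  using knot_partition_less[OF assms(1), of i j] assms by (cases "i = j") auto

lemma knot_mem_unit: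
  assumes "knot_partition K \<xi>" "i \<le> Suc K"
  shows "\<xi> i \<in> {0..1}"
  using knot_partition_mono[OF assms(1), of 0 i] knot_partition_mono[OF assms(1), of i "Suc K"] assms
  by (auto simp: knot_partition_def)

lemma knot_gap:
  assumes "\<And>\<nu>. \<nu> \<le> K \<Longrightarrow> \<xi> (Suc \<nu>) - \<xi> \<nu> \<le> H" "i + d \<le> Suc K"
  shows "\<xi> (i + d) - \<xi> i \<le> real d * H"
  using assms(2)
proof (induction d)
  case (Suc d)
  then have "\<xi> (Suc (i + d)) - \<xi> (i + d) \<le> H" using assms(1) by simp
  then show ?case using Suc by (simp add: algebra_simps)
qed simp

text \<open>Exponent two is the first one with a derivative at the knot itself; there the difference
  quotient is computed directly, elsewhere the function is locally a polynomial.\<close>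

lemma trunc_pow_DERIV:
  "(trunc_pow (Suc (Suc e)) y has_real_derivative (- real (Suc (Suc e)) * trunc_pow (Suc e) y t)) (at t within S)"
proof -
  consider "t < y" | "t = y" | "y < t" by linarith
  then have "(trunc_pow (Suc (Suc e)) y has_real_derivative (- real (Suc (Suc e)) * trunc_pow (Suc e) y t)) (at t)"
  proof cases
    case 1
    have "((\<lambda>u. (y - u) ^ Suc (Suc e)) has_real_derivative (- real (Suc (Suc e)) * trunc_pow (Suc e) y t)) (at t)"
      by (rule derivative_eq_intros refl)+ (use 1 in \<open>simp add: trunc_pow_def algebra_simps\<close>)
    then show ?thesis
      by (rule has_field_derivative_transform_within_open[of _ _ _ "{..<y}"])
         (use 1 in \<open>auto simp: trunc_pow_def\<close>)
  next
    case 3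
    have "((\<lambda>u. 0) has_real_derivative (- real (Suc (Suc e)) * trunc_pow (Suc e) y t)) (at t)"
      using 3 by (simp add: trunc_pow_def)
    then show ?thesis
      by (rule has_field_derivative_transform_within_open[of _ _ _ "{y<..}"])
         (use 3 in \<open>auto simp: trunc_pow_def\<close>)
  next
    case 2
    have "((\<lambda>h. trunc_pow (Suc e) y (t + h)) \<longlongrightarrow> 0) (at 0)"
    proof (rule Lim_null_comparison)
      show "\<forall>\<^sub>F h in at 0. norm (trunc_pow (Suc e) y (t + h)) \<le> \<bar>h\<bar> ^ Suc e"
        using 2 by (intro always_eventually allI) (auto simp: trunc_pow_def power_abs abs_mult)
      show "((\<lambda>h::real. \<bar>h\<bar> ^ Suc e) \<longlongrightarrow> 0) (at 0)"
        by (auto intro!: tendsto_eq_intros)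
    qed
    then have "((\<lambda>h. - trunc_pow (Suc e) y (t + h)) \<longlongrightarrow> 0) (at 0)"
      using tendsto_minus by fastforce
    \<comment> \<open>For \<open>h < 0\<close> the quotient is
      \<open>(- h) ^ (e + 2) / h = - ((- h) ^ (e + 1))\<close>; for \<open>h > 0\<close> both sides
      are 0.\<close>
    moreover have "\<forall>\<^sub>F h in at 0. - trunc_pow (Suc e) y (t + h)
        = (trunc_pow (Suc (Suc e)) y (t + h) - trunc_pow (Suc (Suc e)) y t) / h"
      using 2 by (auto simp: eventually_at_filter trunc_pow_def field_simps)
    ultimately have "((\<lambda>h. (trunc_pow (Suc (Suc e)) y (t + h) - trunc_pow (Suc (Suc e)) y t) / h) \<longlongrightarrow> 0) (at 0)"
      by (rule Lim_transform_eventually)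
    then show ?thesis using 2 by (simp add: DERIV_def trunc_pow_def)
  qed
  then show ?thesis by (rule has_field_derivative_at_within)
qed

lemma continuous_on_trunc_pow: "continuous_on S (trunc_pow (Suc e) y)"
proof -
  have "trunc_pow (Suc e) y = (\<lambda>t. (max (y - t) 0) ^ Suc e)"
    by (rule ext) (simp add: trunc_pow_def max_def)
  then show ?thesis by (auto intro!: continuous_intros)
qed

lemma has_nth_derivative_on_lincomb:
  assumes "has_nth_derivative_on r f f' S" "has_nth_derivative_on r h h' S"
  shows "has_nth_derivative_on r (\<lambda>t. u * f t + v * h t) (\<lambda>t. u * f' t + v * h' t) S"
proof -
  obtain D E where "\<forall>t\<in>S. D 0 t = f t \<and> D r t = f' t" "\<forall>t\<in>S. E 0 t = h t \<and> E r t = h' t"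
    and d: "\<forall>i<r. \<forall>t\<in>S. (D i has_real_derivative D (Suc i) t) (at t within S)"
     "\<forall>i<r. \<forall>t\<in>S. (E i has_real_derivative E (Suc i) t) (at t within S)"
    using assms unfolding has_nth_derivative_on_def by metis
  moreover have "((\<lambda>t. u * D i t + v * E i t) has_real_derivative (u * D (Suc i) t + v * E (Suc i) t)) (at t within S)"
    if "i < r" "t \<in> S" for i t
    using d that by (auto intro!: derivative_eq_intros)
  ultimately show ?thesis
    unfolding has_nth_derivative_on_def
    by (intro exI[of _ "\<lambda>i t. u * D i t + v * E i t"]) auto
qed

text \<open>The exponent exceeds \<open>r\<close>, so \<open>r\<close> differentiations leave a
  multiple of a truncated power with positive exponent, which is continuous.\<close>

lemma trunc_pow_smooth:
  "\<exists>h. has_nth_derivative_on r (trunc_pow (Suc (r + e)) y) h S \<and> continuous_on S h"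
proof -
  define D where "D = (\<lambda>i t. (- 1) ^ i * (\<Prod>j<i. real (Suc (r + e) - j)) * trunc_pow (Suc (r + e) - i) y t)"
  have "(D i has_real_derivative D (Suc i) t) (at t within S)" if "i < r" for i t
  proof -
    define l where "l = r + e - Suc i"
    have l: "Suc (r + e) - i = Suc (Suc l)" using that by (simp add: l_def)
    define c where "c = (\<Prod>j<i. real (Suc (r + e) - j))"
    have l': "Suc (r + e) - Suc i = Suc l" using l by simp
    have "D i = (\<lambda>t. (- 1) ^ i * c * trunc_pow (Suc (Suc l)) y t)"
      unfolding D_def c_def l by (rule refl)
    moreover have "D (Suc i) t = (- 1) ^ i * c * (- real (Suc (Suc l)) * trunc_pow (Suc l) y t)"
      unfolding D_def prod.lessThan_Suc l l' c_def[symmetric] by (simp del: of_nat_Suc)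
    ultimately show ?thesis using DERIV_cmult[OF trunc_pow_DERIV] by metis
  qed
  moreover have "continuous_on S (D r)"
    unfolding D_def by (intro continuous_intros) (simp add: continuous_on_trunc_pow Suc_diff_le)
  ultimately show ?thesis
    unfolding has_nth_derivative_on_def
    by (intro exI[of _ "D r"] conjI exI[of _ D]) (auto simp: D_def)
qed

lemma monomial_smooth:
  "\<exists>h. has_nth_derivative_on r (\<lambda>t. t ^ j) h S \<and> continuous_on S h"
proof -
  define D where "D = (\<lambda>i t. (if i \<le> j then (\<Prod>l<i. real (j - l)) else 0) * t ^ (j - i) :: real)"
  have "(D i has_real_derivative D (Suc i) t) (at t within S)" for i t
  proof (cases "i < j")
    case True
    then have "D i = (\<lambda>t. (\<Prod>l<i. real (j - l)) * t ^ (j - i))"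
         "D (Suc i) t = (\<Prod>l<i. real (j - l)) * (real (j - i) * t ^ (j - i - Suc 0))"
      by (auto simp: D_def)
    then show ?thesis by (auto intro!: derivative_eq_intros)
  next
    case False
    then have "D i = (\<lambda>_. D i 0)" "D (Suc i) t = 0" by (auto simp: D_def)
    then show ?thesis by (metis DERIV_const)
  qed
  moreover have "continuous_on S (D r)" unfolding D_def by (intro continuous_intros)
  ultimately show ?thesis
    unfolding has_nth_derivative_on_def
    by (intro exI[of _ "D r"] conjI exI[of _ D]) (auto simp: D_def)
qed

lemma smooth_sum:
  fixes f :: "'i \<Rightarrow> real \<Rightarrow> real"
  assumes "finite I" "\<And>i. i \<in> I \<Longrightarrow> \<exists>h. has_nth_derivative_on r (f i) h S \<and> continuous_on S h"
  shows "\<exists>h. has_nth_derivative_on r (\<lambda>t. \<Sum>i\<in>I. c i * f i t) h S \<and> continuous_on S h"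
  using assms
proof (induction I rule: finite_induct)
  case empty
  have "has_nth_derivative_on r (\<lambda>t. 0) (\<lambda>t. 0) S"
    unfolding has_nth_derivative_on_def by (intro exI[of _ "\<lambda>_ _. 0"]) auto
  then show ?case by (auto intro!: exI[of _ "\<lambda>t. 0"])
next
  case (insert i I)
  obtain h1 h2 where h: "has_nth_derivative_on r (f i) h1 S" "continuous_on S h1"
    "has_nth_derivative_on r (\<lambda>t. \<Sum>i\<in>I. c i * f i t) h2 S" "continuous_on S h2"
    using insert by force
  have "has_nth_derivative_on r (\<lambda>t. c i * f i t + 1 * (\<Sum>i\<in>I. c i * f i t)) (\<lambda>t. c i * h1 t + 1 * h2 t) S"
    by (rule has_nth_derivative_on_lincomb[OF h(1,3)])
  moreover have "continuous_on S (\<lambda>t. c i * h1 t + 1 * h2 t)"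
    by (intro continuous_intros h)
  ultimately show ?case using insert(1,2) by (intro exI[of _ "\<lambda>t. c i * h1 t + 1 * h2 t"]) simp
qed

lemma trunc_pow_span_subset_spline_space:
  assumes \<xi>: "knot_partition K \<xi>"
  shows "trunc_pow_span k K \<xi> \<subseteq> spline_space (Suc k) K \<xi>"
proof
  fix s assume "s \<in> trunc_pow_span k K \<xi>"
  then obtain a c where s: "s = (\<lambda>t. (\<Sum>j\<le>k. a j * t ^ j) + (\<Sum>\<nu>\<le>K. c \<nu> * trunc_pow k (\<xi> \<nu>) t))"
    by (auto simp: trunc_pow_span_def)
  have "\<exists>q :: real poly. degree q \<le> k \<and> (\<forall>t\<in>knot_cell K \<xi> \<nu>. s t = poly q t)" if \<nu>: "\<nu> \<le> K" for \<nu>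
  proof (intro exI conjI ballI)
    \<comment> \<open>A knot of index above \<open>\<nu>\<close> lies to the right of the whole
      cell, where its truncated power is a full power; the remaining truncated powers vanish on the
      cell.\<close>
    let ?q = "(\<Sum>j\<le>k. monom (a j) j) + (\<Sum>\<mu>\<le>K. Polynomial.smult (if \<nu> < \<mu> then c \<mu> else 0) ([:\<xi> \<mu>, - 1:] ^ k))"
    have "degree (Polynomial.smult d ([:y, - 1:] ^ k)) \<le> k" for d y :: real
      by (rule order_trans[OF degree_smult_le]) (use degree_power_le[of "[:y, -1:]" k] in simp)
    then show "degree ?q \<le> k"
      by (intro degree_add_le degree_sum_le) (auto intro: order_trans[OF degree_monom_le])
    fix t assume t: "t \<in> knot_cell K \<xi> \<nu>"
    have "trunc_pow k (\<xi> \<mu>) t = (if \<nu> < \<mu> then (\<xi> \<mu> - t) ^ k else 0)" if \<mu>: "\<mu> \<le> K" for \<mu>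
    proof (cases "\<nu> < \<mu>")
      case True
      then have "t < \<xi> (Suc \<nu>)" using t \<mu> by (auto simp: knot_cell_def split: if_splits)
      also have "\<dots> \<le> \<xi> \<mu>" by (rule knot_partition_mono[OF \<xi>]) (use True \<mu> in auto)
      finally show ?thesis using True by (simp add: trunc_pow_def)
    next
      case False
      then have "\<xi> \<mu> \<le> \<xi> \<nu>" by (intro knot_partition_mono[OF \<xi>]) (use \<nu> in auto)
      also have "\<dots> \<le> t" using t by (auto simp: knot_cell_def split: if_splits)
      finally show ?thesis using False by (simp add: trunc_pow_def)
    qed
    then show "s t = poly ?q t"
      by (auto simp: s poly_sum poly_monom intro!: sum.cong)
  qed
  moreover have "\<exists>h. has_nth_derivative_on (Suc k - 2) s h {0..1} \<and> continuous_on {0..1} h" if "2 \<le> Suc k"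
  proof -
    define r where "r = Suc k - 2"
    have k: "k = Suc (r + 0)" using that by (simp add: r_def)
    obtain h1 where h1: "has_nth_derivative_on r (\<lambda>t. \<Sum>j\<le>k. a j * t ^ j) h1 {0..1}" "continuous_on {0..1} h1"
      using smooth_sum[of "{..k}" r "\<lambda>j t. t ^ j" "{0..1}" a] monomial_smooth by blast
    obtain h2 where h2: "has_nth_derivative_on r (\<lambda>t. \<Sum>\<nu>\<le>K. c \<nu> * trunc_pow k (\<xi> \<nu>) t) h2 {0..1}"
        "continuous_on {0..1} h2"
      using smooth_sum[of "{..K}" r "\<lambda>\<nu>. trunc_pow k (\<xi> \<nu>)" "{0..1}" c] trunc_pow_smooth[of r 0]
      unfolding k by blast
    show ?thesis
      using has_nth_derivative_on_lincomb[OF h1(1) h2(1), of 1 1] h1(2) h2(2)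
      unfolding s r_def[symmetric] mult_1 by (blast intro: continuous_on_add)
  qed
  ultimately show "s \<in> spline_space (Suc k) K \<xi>"
    unfolding spline_space_def by auto
qed

text \<open>One ramp per block of \<open>k + 1\<close> cells, so at every point at most one ramp is strictly between
  \<open>0\<close> and \<open>1\<close> and the spline is a convex combination of two nearby values of \<^term>\<open>f\<close>.\<close>

lemma hoelder_trunc_pow_span_approx:
  assumes \<xi>: "knot_partition K \<xi>" and H: "\<And>\<nu>. \<nu> \<le> K \<Longrightarrow> \<xi> (Suc \<nu>) - \<xi> \<nu> \<le> H"
    and f: "\<And>t u. t \<in> {0..1} \<Longrightarrow> u \<in> {0..1} \<Longrightarrow> \<bar>f t - f u\<bar> \<le> L * \<bar>t - u\<bar> powr \<gamma>"
    and L: "0 \<le> L" and \<gamma>: "0 < \<gamma>"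
  shows "\<exists>s\<in>trunc_pow_span k K \<xi>. \<forall>t\<in>{0..1}. \<bar>f t - s t\<bar> \<le> L * (real (Suc k) * H) powr \<gamma>"
proof -
  \<comment> \<open>The number of full blocks. At most \<open>k\<close> cells remain at the right
    end, and they carry no ramp.\<close>
  define N where "N = Suc K div Suc k"
  define \<tau> where "\<tau> b = \<xi> (b * Suc k)" for b
  define F where "F b = spline_ramp k \<xi> (b * Suc k)" for b
  have N: "N * Suc k \<le> Suc K" "Suc K < N * Suc k + Suc k"
    unfolding N_def using div_mult_mod_eq[of "Suc K" "Suc k"] mod_less_divisor[of "Suc k" "Suc K"]
    by linarith+
  have bN: "b * Suc k + k \<le> K" if "b < N" for b
  proof -
    have "Suc b * Suc k \<le> N * Suc k" using that by (intro mult_right_mono) auto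
    then show ?thesis using N by simp
  qed
  \<comment> \<open>The spline is written through its jumps: to the right of all ramps it equals
    \<open>f (\<tau> N)\<close>, and each ramp that is still 1 at \<open>t\<close> adds one
    increment of \<open>f\<close> back.\<close>
  define s where "s t = f (\<tau> N) + (\<Sum>b<N. (f (\<tau> b) - f (\<tau> (Suc b))) * F b t)" for t
  have "s \<in> trunc_pow_span k K \<xi>"
    unfolding s_def[abs_def] F_def
    by (rule trunc_pow_span_sum) (use bN in \<open>auto intro!: spline_ramp_in_span\<close>)
  moreover have "\<bar>f t - s t\<bar> \<le> L * (real (Suc k) * H) powr \<gamma>" if t: "t \<in> {0..1}" for t
  proof -
    have near: "\<bar>f t - f u\<bar> \<le> L * (real (Suc k) * H) powr \<gamma>"
      if "u \<in> {0..1}" "\<bar>t - u\<bar> \<le> real (Suc k) * H" for u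
      using f[OF t that(1)] mult_left_mono[OF powr_mono2[OF _ _ that(2), of \<gamma>] L] \<gamma> by auto
    have \<tau>unit: "\<tau> b \<in> {0..1}" if "b \<le> N" for b
    proof -
      have "b * Suc k \<le> N * Suc k" using that by (intro mult_right_mono) auto
      then show ?thesis unfolding \<tau>_def using N by (intro knot_mem_unit[OF \<xi>]) simp
    qed
    have ramp: "0 \<le> F b t \<and> F b t \<le> 1 \<and> (t < \<tau> b \<longrightarrow> F b t = 1) \<and> (\<tau> (Suc b) \<le> t \<longrightarrow> F b t = 0)"
      if "b < N" for b
    proof -
      \<comment> \<open>A ramp uses only the first \<open>k\<close> cells of its block, so it has
        reached 0 before the next ramp starts to descend.\<close>
      have "\<xi> (b * Suc k + k) \<le> \<tau> (Suc b)"
        unfolding \<tau>_def by (rule knot_partition_mono[OF \<xi>]) (use bN[OF that] in auto)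
      moreover have "0 \<le> F b t \<and> F b t \<le> 1 \<and> (t < \<tau> b \<longrightarrow> F b t = 1)
          \<and> (\<xi> (b * Suc k + k) \<le> t \<longrightarrow> F b t = 0)"
        unfolding F_def \<tau>_def
        by (rule spline_ramp_values) (use bN[OF that] in \<open>auto intro!: knot_partition_less[OF \<xi>]\<close>)
      ultimately show ?thesis by auto
    qed
    show ?thesis
    proof (cases "t < \<tau> N")
      case False
      have "\<tau> (Suc b) \<le> t" if "b < N" for b
      proof -
        have "Suc b * Suc k \<le> N * Suc k" using that by (intro mult_right_mono) auto
        then have "\<tau> (Suc b) \<le> \<tau> N" unfolding \<tau>_def by (intro knot_partition_mono[OF \<xi>]) (use N in auto)
        then show ?thesis using False by simp
      qed
      then have "s t = f (\<tau> N)" using ramp by (simp add: s_def)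
      \<comment> \<open>Past the last full block there are fewer than \<open>Suc k\<close> cells, so
        \<open>\<tau> N\<close> is still within one block length of \<open>t\<close>.\<close>
      moreover have "1 - \<tau> N \<le> real (Suc k) * H"
      proof -
        obtain d where d: "Suc K = N * Suc k + d" "d \<le> Suc k" using N by (metis le_Suc_ex nat_add_left_cancel_le less_imp_le)
        have "0 < H" using H[of 0] \<xi> by (auto simp: knot_partition_def dest!: spec[of _ 0])
        then have "real d * H \<le> real (Suc k) * H" using d by (intro mult_right_mono) auto
        then show ?thesis
          using knot_gap[of K \<xi> H "N * Suc k" d] H d \<xi> by (auto simp: \<tau>_def knot_partition_def)
      qed
      ultimately show ?thesis using near[OF \<tau>unit[of N]] False t by auto
    next
      case True
      define b where "b = (LEAST b. t < \<tau> (Suc b))"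
      have "N \<noteq> 0"
      proof
        assume "N = 0"
        then show False using True t \<xi> by (simp add: \<tau>_def knot_partition_def)
      qed
      then have ex: "t < \<tau> (Suc (N - 1))" using True by simp
      have b1: "t < \<tau> (Suc b)" unfolding b_def by (rule LeastI[of _ "N - 1"]) (rule ex)
      have b2: "b < N" using Least_le[of "\<lambda>b. t < \<tau> (Suc b)" "N - 1"] ex \<open>N \<noteq> 0\<close> unfolding b_def by simp
      have lo: "\<tau> (Suc b') \<le> t" if "b' < b" for b' using not_less_Least[of b' "\<lambda>b. t < \<tau> (Suc b)"] that
        unfolding b_def by simp
      have b3: "\<tau> b \<le> t"
      proof (cases b)
        case 0 then show ?thesis using t \<xi> by (simp add: \<tau>_def knot_partition_def)
      next
        case (Suc b') then show ?thesis using lo[of b'] by simp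
      qed
      have hi: "t < \<tau> b'" if "b < b'" "b' \<le> N" for b'
      proof -
        have "Suc b * Suc k \<le> b' * Suc k" "b' * Suc k \<le> N * Suc k" using that by (intro mult_right_mono; simp)+
        then have "\<tau> (Suc b) \<le> \<tau> b'" unfolding \<tau>_def by (intro knot_partition_mono[OF \<xi>]) (use N in auto)
        then show ?thesis using b1 by simp
      qed
      let ?d = "\<lambda>b. f (\<tau> b) - f (\<tau> (Suc b))"
      \<comment> \<open>Let \<open>b\<close> be the block of \<open>t\<close>. Ramps of earlier
        blocks are 0 at \<open>t\<close>, those of later blocks are 1, and the later increments
        telescope to \<open>f (\<tau> (Suc b)) - f (\<tau> N)\<close>.\<close>
      have "(\<Sum>b<N. ?d b * F b t) = (\<Sum>b\<in>{..<b} \<union> insert b {Suc b..<N}. ?d b * F b t)"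
        by (rule sum.cong) (use b2 in auto)
      also have "\<dots> = (\<Sum>b<b. ?d b * F b t) + (?d b * F b t + (\<Sum>b=Suc b..<N. ?d b * F b t))"
        by (subst sum.union_disjoint) auto
      finally have "(\<Sum>b<N. ?d b * F b t) = (\<Sum>b<b. ?d b * F b t) + (?d b * F b t + (\<Sum>b=Suc b..<N. ?d b * F b t))" .
      moreover have "(\<Sum>b<b. ?d b * F b t) = 0" using ramp lo b2 by (intro sum.neutral) auto
      moreover have "(\<Sum>b=Suc b..<N. ?d b * F b t) = (\<Sum>b=Suc b..<N. ?d b)"
        using ramp hi by (intro sum.cong) auto
      moreover have "(\<Sum>b=Suc b..<N. ?d b) = f (\<tau> (Suc b)) - f (\<tau> N)"
        using sum_Suc_diff'[of "Suc b" N "\<lambda>b. - f (\<tau> b)"] b2 by simp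
      ultimately have "s t = f (\<tau> (Suc b)) + ?d b * F b t" unfolding s_def by simp
      then have eq: "f t - s t = F b t * (f t - f (\<tau> b)) + (1 - F b t) * (f t - f (\<tau> (Suc b)))"
        by (simp add: algebra_simps)
      have gap: "\<tau> (Suc b) - \<tau> b \<le> real (Suc k) * H"
        using knot_gap[of K \<xi> H "b * Suc k" "Suc k"] H bN[OF b2] by (simp add: \<tau>_def add_ac)
      have "\<bar>f t - f (\<tau> b)\<bar> \<le> L * (real (Suc k) * H) powr \<gamma>" "\<bar>f t - f (\<tau> (Suc b))\<bar> \<le> L * (real (Suc k) * H) powr \<gamma>"
        using b1 b2 b3 gap by (intro near \<tau>unit; linarith)+
      then have "\<bar>F b t * (f t - f (\<tau> b))\<bar> \<le> F b t * (L * (real (Suc k) * H) powr \<gamma>)"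
         "\<bar>(1 - F b t) * (f t - f (\<tau> (Suc b)))\<bar> \<le> (1 - F b t) * (L * (real (Suc k) * H) powr \<gamma>)"
        using ramp[OF b2] by (auto simp: abs_mult intro!: mult_left_mono)
      then have "\<bar>f t - s t\<bar> \<le> F b t * (L * (real (Suc k) * H) powr \<gamma>) + (1 - F b t) * (L * (real (Suc k) * H) powr \<gamma>)"
        unfolding eq by (meson abs_triangle_ineq add_mono order_trans)
      then show ?thesis by (simp add: algebra_simps)
    qed
  qed
  ultimately show ?thesis by blast
qed

section \<open>Integration of splines and higher orders of smoothness\<close>

lemma trunc_pow_antiderivative:
  assumes "t \<noteq> y"
  shows "((\<lambda>t. - trunc_pow (Suc e) y t / real (Suc e)) has_real_derivative trunc_pow e y t) (at t)"
proof (cases "t < y")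
  case True
  have "((\<lambda>u. (- 1 / real (Suc e)) * (y - u) ^ Suc e) has_real_derivative
      (- 1 / real (Suc e)) * (real (Suc e) * ((0 - 1) * (y - t) ^ (Suc e - Suc 0)))) (at t)"
    by (intro DERIV_cmult DERIV_power DERIV_diff DERIV_const DERIV_ident)
  moreover have "(- 1 / real (Suc e)) * (real (Suc e) * ((0 - 1) * (y - t) ^ (Suc e - Suc 0))) = trunc_pow e y t"
    using True by (simp add: trunc_pow_def del: of_nat_Suc)
  ultimately have "((\<lambda>u. (- 1 / real (Suc e)) * (y - u) ^ Suc e) has_real_derivative trunc_pow e y t) (at t)"
    by simp
  then show ?thesis
    by (rule has_field_derivative_transform_within_open[of _ _ _ "{..<y}"])
       (use True in \<open>auto simp: trunc_pow_def\<close>)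
next
  case False
  have "((\<lambda>u. 0) has_real_derivative trunc_pow e y t) (at t)"
    using False by (simp add: trunc_pow_def)
  then show ?thesis
    by (rule has_field_derivative_transform_within_open[of _ _ _ "{y<..}"])
       (use False assms in \<open>auto simp: trunc_pow_def\<close>)
qed

text \<open>For \<open>k = 0\<close> the antiderivative has kinks at the knots. Hence the derivative
  is claimed off the knots only, and continuity is recorded separately.\<close>

lemma trunc_pow_span_antiderivative:
  assumes "s \<in> trunc_pow_span k K \<xi>"
  shows "\<exists>S\<in>trunc_pow_span (Suc k) K \<xi>. (\<forall>A. continuous_on A S) \<and>
    (\<forall>t. t \<notin> \<xi> ` {..K} \<longrightarrow> (S has_real_derivative s t) (at t))"
proof -
  obtain a c where s: "s = (\<lambda>t. (\<Sum>j\<le>k. a j * t ^ j) + (\<Sum>\<nu>\<le>K. c \<nu> * trunc_pow k (\<xi> \<nu>) t))"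
    using assms by (auto simp: trunc_pow_span_def)
  define S where "S t = (\<Sum>j\<le>k. a j * (t ^ Suc j / real (Suc j)))
    + (\<Sum>\<nu>\<le>K. c \<nu> * (- trunc_pow (Suc k) (\<xi> \<nu>) t / real (Suc k)))" for t
  have "S \<in> trunc_pow_span (Suc k) K \<xi>"
  proof (rule trunc_pow_spanI)
    fix t
    show "S t = (\<Sum>j\<le>Suc k. (case j of 0 \<Rightarrow> 0 | Suc l \<Rightarrow> a l / real j) * t ^ j)
      + (\<Sum>\<nu>\<le>K. (- c \<nu> / real (Suc k)) * trunc_pow (Suc k) (\<xi> \<nu>) t)"
      unfolding S_def sum.atMost_Suc_shift by simp
  qed
  moreover have "continuous_on A S" for A
    unfolding S_def[abs_def]
    by (intro continuous_intros continuous_on_trunc_pow) (simp_all del: of_nat_Suc)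
  moreover have "(S has_real_derivative s t) (at t)" if "t \<notin> \<xi> ` {..K}" for t
  proof -
    have 1: "((\<lambda>t. t ^ Suc j / real (Suc j)) has_real_derivative t ^ j) (at t)" for j
        using DERIV_cdivide[OF DERIV_pow[of "Suc j" t UNIV], of "real (Suc j)"] by (simp del: of_nat_Suc)
    show ?thesis
      unfolding S_def[abs_def] s
      by (intro DERIV_add DERIV_sum DERIV_cmult 1 trunc_pow_antiderivative) (use that in auto)
  qed
  ultimately show ?thesis by blast
qed

text \<open>The fundamental theorem of calculus tolerates finitely many exceptional points; here
  these are the kinks at the knots.\<close>

lemma lipschitz_if_derivative_bounded_off_finite:
  fixes f :: "real \<Rightarrow> real"
  assumes "finite A" "continuous_on {u..v} f" "u \<le> v"
    and "\<And>t. t \<in> {u<..<v} - A \<Longrightarrow> (f has_real_derivative f' t) (at t)"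
    and "\<And>t. t \<in> {u..v} \<Longrightarrow> \<bar>f' t\<bar> \<le> C"
  shows "\<bar>f v - f u\<bar> \<le> C * (v - u)"
proof -
  have "(f' has_integral (f v - f u)) {u..v}"
    by (rule fundamental_theorem_of_calculus_interior_strong[OF assms(1,3) _ assms(2)])
       (use assms(4) in \<open>auto simp: has_real_derivative_iff_has_vector_derivative\<close>)
  moreover have "0 \<le> C" using assms(3) assms(5)[of u] by force
  ultimately have "norm (f v - f u) \<le> C * measure lborel {u..v}"
    using has_integral_bound_real[of C "{}" f' "f v - f u" u v] assms(5) by auto
  then show ?thesis using assms(3) by simp
qed

lemma holder_smooth_0:
  assumes "holder_smooth 0 \<gamma> L f" "t \<in> {0..1}" "u \<in> {0..1}"
  shows "\<bar>f t - f u\<bar> \<le> L * \<bar>t - u\<bar> powr \<gamma>"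
proof -
  obtain h D where "\<forall>t\<in>{0..1}. D (0::nat) t = f t \<and> D 0 t = h t"
     "\<forall>t1\<in>{0..1}. \<forall>t2\<in>{0..1}. \<bar>h t2 - h t1\<bar> \<le> L * \<bar>t2 - t1\<bar> powr \<gamma>"
    using assms(1) unfolding holder_smooth_def has_nth_derivative_on_def by blast
  moreover from this(1) have "f t = h t" "f u = h u" using assms(2,3) by metis+
  ultimately show ?thesis using assms(2,3) by simp
qed

lemma holder_smooth_Suc:
  assumes "holder_smooth (Suc r) \<gamma> L f"
  shows "\<exists>f'. holder_smooth r \<gamma> L f' \<and> (\<forall>t\<in>{0..1}. (f has_real_derivative f' t) (at t within {0..1}))"
proof -
  obtain h D where D: "\<forall>t\<in>{0..1}. D 0 t = f t \<and> D (Suc r) t = h t"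
     "\<forall>i<Suc r. \<forall>t\<in>{0..1}. (D i has_real_derivative D (Suc i) t) (at t within {0..1})"
     "\<forall>t1\<in>{0..1}. \<forall>t2\<in>{0..1}. \<bar>h t2 - h t1\<bar> \<le> L * \<bar>t2 - t1\<bar> powr \<gamma>"
    using assms unfolding holder_smooth_def has_nth_derivative_on_def by blast
  have "holder_smooth r \<gamma> L (D 1)"
    unfolding holder_smooth_def has_nth_derivative_on_def
    using D by (intro exI[of _ h] conjI exI[of _ "\<lambda>i. D (Suc i)"]) auto
  moreover have "(f has_real_derivative D 1 t) (at t within {0..1})" if "t \<in> {0..1}" for t
    using D(2) D(1) that has_field_derivative_transform_within[of "D 0" "D 1 t" t "{0..1}" 1 f]
    by auto
  ultimately show ?thesis by blast
qed

text \<open>Induction on the order of smoothness: an approximant of the derivative is integrated to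
  \<open>S\<close>. Then \<open>f - S\<close> is Lipschitz with the error of the derivative as
  constant, and the case of order 0 with exponent 1 gains one more factor \<open>H\<close>. The
  constant is fixed before the function and the partition, because it has to serve all sample sizes
  and all covariates.\<close>

lemma trunc_pow_span_approx:
  assumes \<gamma>: "0 < \<gamma>" and r: "r \<le> k"
  shows "\<exists>C\<ge>0. \<forall>L\<ge>0. \<forall>f K \<xi> H. knot_partition K \<xi> \<longrightarrow> (\<forall>\<nu>\<le>K. \<xi> (Suc \<nu>) - \<xi> \<nu> \<le> H) \<longrightarrow>
    holder_smooth r \<gamma> L f \<longrightarrow>
    (\<exists>s\<in>trunc_pow_span k K \<xi>. \<forall>t\<in>{0..1}. \<bar>f t - s t\<bar> \<le> C * L * H powr (real r + \<gamma>))"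
  using r
proof (induction r arbitrary: k)
  case 0
  show ?case
  proof (intro exI[of _ "real (Suc k) powr \<gamma>"] conjI allI impI)
    fix L f K \<xi> H
    assume a: "0 \<le> L" "knot_partition K \<xi>" "\<forall>\<nu>\<le>K. \<xi> (Suc \<nu>) - \<xi> \<nu> \<le> H" "holder_smooth 0 \<gamma> L f"
    have "0 < H" using a(3)[rule_format, of 0] a(2) by (auto simp: knot_partition_def dest!: spec[of _ 0])
    moreover obtain s where s: "s\<in>trunc_pow_span k K \<xi>" "\<forall>t\<in>{0..1}. \<bar>f t - s t\<bar> \<le> L * (real (Suc k) * H) powr \<gamma>"
      using hoelder_trunc_pow_span_approx[of K \<xi> H f L \<gamma> k] a \<gamma> holder_smooth_0[OF a(4)] by blast
    ultimately show "\<exists>s\<in>trunc_pow_span k K \<xi>. \<forall>t\<in>{0..1}. \<bar>f t - s t\<bar> \<le> real (Suc k) powr \<gamma> * L * H powr (real 0 + \<gamma>)"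
      by (intro bexI[of _ s]) (simp_all add: powr_mult mult_ac del: of_nat_Suc)
  qed simp
next
  case (Suc r k')
  obtain k where k': "k' = Suc k" and "r \<le> k" using Suc.prems by (cases k') auto
  obtain C where C: "0 \<le> C" and approx: "\<forall>L\<ge>0. \<forall>f K \<xi> H. knot_partition K \<xi> \<longrightarrow>
      (\<forall>\<nu>\<le>K. \<xi> (Suc \<nu>) - \<xi> \<nu> \<le> H) \<longrightarrow> holder_smooth r \<gamma> L f \<longrightarrow>
      (\<exists>s\<in>trunc_pow_span k K \<xi>. \<forall>t\<in>{0..1}. \<bar>f t - s t\<bar> \<le> C * L * H powr (real r + \<gamma>))"
    using Suc.IH[OF \<open>r \<le> k\<close>] by blast
  show ?case unfolding k'
  proof (intro exI[of _ "real (Suc (Suc k)) * C"] conjI allI impI)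
    show "0 \<le> real (Suc (Suc k)) * C" using C by simp
    fix L f K \<xi> H
    assume a: "0 \<le> L" "knot_partition K \<xi>" "\<forall>\<nu>\<le>K. \<xi> (Suc \<nu>) - \<xi> \<nu> \<le> H" "holder_smooth (Suc r) \<gamma> L f"
    have H: "0 < H" using a(3)[rule_format, of 0] a(2) by (auto simp: knot_partition_def dest!: spec[of _ 0])
    obtain f' where f': "holder_smooth r \<gamma> L f'" "\<And>t. t \<in> {0..1} \<Longrightarrow> (f has_real_derivative f' t) (at t within {0..1})"
      using holder_smooth_Suc[OF a(4)] by blast
    have "\<exists>s\<in>trunc_pow_span k K \<xi>. \<forall>t\<in>{0..1}. \<bar>f' t - s t\<bar> \<le> C * L * H powr (real r + \<gamma>)"
      by (rule approx[rule_format]) (use a(1-3) f'(1) in simp_all)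
    then obtain s where s: "s \<in> trunc_pow_span k K \<xi>" "\<And>t. t\<in>{0..1} \<Longrightarrow> \<bar>f' t - s t\<bar> \<le> C * L * H powr (real r + \<gamma>)"
      by blast
    obtain S where S: "S \<in> trunc_pow_span (Suc k) K \<xi>" "\<And>A. continuous_on A S"
      "\<And>t. t \<notin> \<xi> ` {..K} \<Longrightarrow> (S has_real_derivative s t) (at t)"
      using trunc_pow_span_antiderivative[OF s(1)] by blast
    define E where "E = C * L * H powr (real r + \<gamma>)"
    have f_cont: "continuous_on {0..1} f"
      unfolding continuous_on_eq_continuous_within using f'(2) DERIV_continuous by blast
    have lip: "\<bar>(f v - S v) - (f u - S u)\<bar> \<le> E * (v - u)" if "u \<in> {0..1}" "v \<in> {0..1}" "u \<le> v" for u v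
    proof (rule lipschitz_if_derivative_bounded_off_finite)
      show "finite (\<xi> ` {..K})" by simp
      show "continuous_on {u..v} (\<lambda>t. f t - S t)"
        using that by (intro continuous_intros S(2) continuous_on_subset[OF f_cont]) auto
      fix t
      { assume t: "t \<in> {u<..<v} - \<xi> ` {..K}"
        then have "t \<in> interior {0..1}" using that by auto
        then have "(f has_real_derivative f' t) (at t)"
          using f'(2)[of t] at_within_interior[of t "{0..1}"] interior_subset by fastforce
        then show "((\<lambda>t. f t - S t) has_real_derivative f' t - s t) (at t)"
          using S(3)[of t] t by (intro DERIV_diff) auto }
      assume "t \<in> {u..v}"
      then show "\<bar>f' t - s t\<bar> \<le> E" using s(2)[of t] that by (auto simp: E_def)
    qed fact
    \<comment> \<open>The Lipschitz bound in the shape of a Hoelder bound with exponent 1, which is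
      the input of the case of order 0.\<close>
    have lip': "\<bar>(f t - S t) - (f u - S u)\<bar> \<le> E * \<bar>t - u\<bar> powr 1" if "t \<in> {0..1}" "u \<in> {0..1}" for t u
      using lip[of t u] lip[of u t] that by (cases "t \<le> u") auto
    have "0 \<le> E" using C a(1) by (simp add: E_def)
    then obtain s2 where s2: "s2 \<in> trunc_pow_span (Suc k) K \<xi>"
        "\<forall>t\<in>{0..1}. \<bar>(f t - S t) - s2 t\<bar> \<le> E * (real (Suc (Suc k)) * H) powr 1"
      using hoelder_trunc_pow_span_approx[of K \<xi> H "\<lambda>t. f t - S t" E 1 "Suc k"] a(2,3) lip' by auto
    have "(\<lambda>t. 1 * S t + 1 * s2 t) \<in> trunc_pow_span (Suc k) K \<xi>"
      by (rule trunc_pow_span_lincomb[OF S(1) s2(1)])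
    moreover have "H powr (real (Suc r) + \<gamma>) = H powr (real r + \<gamma>) * H"
      using H powr_add[of H "real r + \<gamma>" 1] by (simp add: algebra_simps)
    ultimately show "\<exists>s\<in>trunc_pow_span (Suc k) K \<xi>. \<forall>t\<in>{0..1}.
        \<bar>f t - s t\<bar> \<le> real (Suc (Suc k)) * C * L * H powr (real (Suc r) + \<gamma>)"
      using s2(2) H by (intro bexI[of _ "\<lambda>t. 1 * S t + 1 * s2 t"])
        (simp_all add: E_def mult_ac diff_diff_eq del: of_nat_Suc)
  qed
qed

lemma spline_approx:
  assumes "1 \<le> m" "r \<le> m - 1" "0 < \<gamma>"
  shows "\<exists>C\<ge>0. \<forall>L\<ge>0. \<forall>f K \<xi> H. knot_partition K \<xi> \<longrightarrow> (\<forall>\<nu>\<le>K. \<xi> (Suc \<nu>) - \<xi> \<nu> \<le> H) \<longrightarrow>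
    holder_smooth r \<gamma> L f \<longrightarrow>
    (\<exists>s\<in>spline_space m K \<xi>. \<forall>t\<in>{0..1}. \<bar>f t - s t\<bar> \<le> C * L * H powr (real r + \<gamma>))"
proof -
  have "trunc_pow_span (m - 1) K \<xi> \<subseteq> spline_space m K \<xi>" if "knot_partition K \<xi>" for K \<xi>
    using trunc_pow_span_subset_spline_space[OF that, of "m - 1"] assms(1) by simp
  moreover obtain C where "0 \<le> C" "\<forall>L\<ge>0. \<forall>f K \<xi> H. knot_partition K \<xi> \<longrightarrow> (\<forall>\<nu>\<le>K. \<xi> (Suc \<nu>) - \<xi> \<nu> \<le> H) \<longrightarrow>
    holder_smooth r \<gamma> L f \<longrightarrow>
    (\<exists>s\<in>trunc_pow_span (m - 1) K \<xi>. \<forall>t\<in>{0..1}. \<bar>f t - s t\<bar> \<le> C * L * H powr (real r + \<gamma>))"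
    using trunc_pow_span_approx[OF assms(3,2)] by blast
  ultimately show ?thesis by (intro exI[of _ C] conjI) (assumption, blast)
qed

lemma holder_smooth_continuous:
  assumes "holder_smooth r \<gamma> L f" "0 < \<gamma>"
  shows "continuous_on {0..1} f"
proof (cases r)
  case (Suc r')
  then show ?thesis
    unfolding continuous_on_eq_continuous_within
    using holder_smooth_Suc[of r' \<gamma> L f] assms(1) DERIV_continuous by blast
next
  case 0
  show ?thesis
  proof (rule continuous_onI)
    fix t e :: real assume t: "t \<in> {0..1}" and e: "0 < e"
    have "((\<lambda>u. \<bar>u - t\<bar>) \<longlongrightarrow> 0) (at t within {0..1})"
      by (auto intro!: tendsto_eq_intros)
    then have "((\<lambda>u. \<bar>u - t\<bar> powr \<gamma>) \<longlongrightarrow> 0) (at t within {0..1})"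
      by (rule tendsto_zero_powrI[OF _ tendsto_const]) (use assms(2) in auto)
    then have "((\<lambda>u. L * \<bar>u - t\<bar> powr \<gamma>) \<longlongrightarrow> L * 0) (at t within {0..1})"
      by (rule tendsto_mult_left)
    then have "\<forall>\<^sub>F u in at t within {0..1}. L * \<bar>u - t\<bar> powr \<gamma> < e"
      using e by (intro order_tendstoD) auto
    then obtain d where d: "d > 0" "\<And>u. u \<in> {0..1} \<Longrightarrow> u \<noteq> t \<Longrightarrow> dist u t < d \<Longrightarrow> L * \<bar>u - t\<bar> powr \<gamma> < e"
      unfolding eventually_at by blast
    have "dist (f u) (f t) \<le> e" if "u \<in> {0..1}" "dist u t < d" for u
    proof (cases "u = t")
      case False
      then show ?thesis
        using holder_smooth_0[of \<gamma> L f u t] assms(1) 0 that t d(2)[of u] by (simp add: dist_real_def)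
    qed (use e in simp)
    then show "\<exists>d>0. \<forall>u\<in>{0..1}. dist u t < d \<longrightarrow> dist (f u) (f t) \<le> e"
      using d(1) by blast
  qed
qed

section \<open>Residuals of least squares and the SCAD objective\<close>

definition dot :: "nat \<Rightarrow> (nat \<Rightarrow> real) \<Rightarrow> (nat \<Rightarrow> real) \<Rightarrow> real" where
  "dot n x y = (\<Sum>i<n. x i * y i)"

lemma dot_commute: "dot n x y = dot n y x"
  by (simp add: dot_def mult.commute)

lemma dot_diff_left: "dot n (\<lambda>i. x i - y i) u = dot n x u - dot n y u"
  and dot_add_left: "dot n (\<lambda>i. x i + y i) u = dot n x u + dot n y u"
  and dot_scale_left: "dot n (\<lambda>i. c * x i) u = c * dot n x u"
  and dot_sum_left: "dot n (\<lambda>i. \<Sum>j\<in>J. X j i) u = (\<Sum>j\<in>J. dot n (X j) u)"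
  by (simp_all add: dot_def algebra_simps sum_subtractf sum.distrib sum_distrib_left sum_distrib_right
      sum.swap[of _ J])

lemmas dot_left = dot_diff_left dot_add_left dot_scale_left dot_sum_left

lemma dot_diff_right: "dot n u (\<lambda>i. x i - y i) = dot n u x - dot n u y"
  and dot_add_right: "dot n u (\<lambda>i. x i + y i) = dot n u x + dot n u y"
  and dot_scale_right: "dot n u (\<lambda>i. c * x i) = c * dot n u x"
  and dot_sum_right: "dot n u (\<lambda>i. \<Sum>j\<in>J. X j i) = (\<Sum>j\<in>J. dot n u (X j))"
  by (simp_all add: dot_commute[of n u] dot_left)

lemmas dot_right = dot_diff_right dot_add_right dot_scale_right dot_sum_right

lemma dot_self_nonneg [simp]: "0 \<le> dot n x x"
  by (simp add: dot_def sum_nonneg)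

lemma dot_self_eq_0_iff: "dot n x x = 0 \<longleftrightarrow> (\<forall>i<n. x i = 0)"
  unfolding dot_def by (subst sum_nonneg_eq_0_iff) auto

lemma dot_cong: "(\<And>i. i < n \<Longrightarrow> x i = x' i) \<Longrightarrow> (\<And>i. i < n \<Longrightarrow> y i = y' i) \<Longrightarrow> dot n x y = dot n x' y'"
  by (simp add: dot_def)

lemma dot_Cauchy_Schwarz: "(dot n x y)\<^sup>2 \<le> dot n x x * dot n y y"
  using Cauchy_Schwarz_ineq_sum[of x y "{..<n}"] by (simp add: dot_def power2_eq_square)

lemma two_dot_le: "0 < c \<Longrightarrow> 2 * dot n x y \<le> c * dot n x x + dot n y y / c"
proof -
  assume c: "0 < c"
  have "0 \<le> dot n (\<lambda>i. c * x i - y i) (\<lambda>i. c * x i - y i)" by simp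
  also have "\<dots> = c * (c * dot n x x) - 2 * c * dot n x y + dot n y y"
    by (simp add: dot_left dot_right dot_commute[of n y x] algebra_simps)
  finally have "c * (2 * dot n x y) \<le> c * (c * dot n x x + dot n y y / c)"
    using c by (simp add: distrib_left)
  then show ?thesis using c by (simp add: mult_le_cancel_left_pos)
qed

section \<open>Gram-Schmidt projection\<close>

definition normalized :: "nat \<Rightarrow> (nat \<Rightarrow> real) \<Rightarrow> nat \<Rightarrow> real" where
  "normalized n u = (\<lambda>i. u i / sqrt (dot n u u))"

text \<open>Gram--Schmidt residual of \<^term>\<open>x\<close> after projecting out the first \<open>w\<close> columns of \<^term>\<open>z\<close>.
  A linearly dependent column has residual zero and, since \<open>0 / 0 = 0\<close>, contributes nothing.\<close>

fun residual :: "nat \<Rightarrow> (nat \<Rightarrow> nat \<Rightarrow> real) \<Rightarrow> nat \<Rightarrow> (nat \<Rightarrow> real) \<Rightarrow> nat \<Rightarrow> real" where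
  "residual n z 0 x = x"
| "residual n z (Suc w) x = (\<lambda>i. residual n z w x i
     - dot n x (normalized n (residual n z w (z w))) * normalized n (residual n z w (z w)) i)"

definition gs_dir :: "nat \<Rightarrow> (nat \<Rightarrow> nat \<Rightarrow> real) \<Rightarrow> nat \<Rightarrow> nat \<Rightarrow> real" where
  "gs_dir n z w = normalized n (residual n z w (z w))"

lemma residual_eq: "residual n z w x i = x i - (\<Sum>v<w. dot n x (gs_dir n z v) * gs_dir n z v i)"
  by (induction w) (simp_all add: gs_dir_def)

lemma residual_eq': "residual n z w x = (\<lambda>i. x i - (\<Sum>v<w. dot n x (gs_dir n z v) * gs_dir n z v i))"
  by (rule ext) (rule residual_eq)

lemma dot_gs_dir_right: "dot n x (gs_dir n z w) =
    dot n x (residual n z w (z w)) / sqrt (dot n (residual n z w (z w)) (residual n z w (z w)))"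
  unfolding gs_dir_def normalized_def by (simp add: dot_def sum_divide_distrib)

text \<open>The second alternative is the direction of a dependent column. Projecting on it changes
  nothing, so both alternatives lead to the same identities below.\<close>

lemma gs_dir_self: "dot n (gs_dir n z w) (gs_dir n z w) = 1 \<or> (\<forall>x. dot n x (gs_dir n z w) = 0)"
proof (cases "dot n (residual n z w (z w)) (residual n z w (z w)) = 0")
  case False
  then have "0 < dot n (residual n z w (z w)) (residual n z w (z w))"
    by (simp add: less_le)
  then have "dot n (gs_dir n z w) (gs_dir n z w) = 1"
    unfolding dot_gs_dir_right by (subst dot_commute, unfold dot_gs_dir_right) simp
  then show ?thesis ..
qed (simp add: dot_gs_dir_right)

lemma gs_dir_self_le_1: "dot n (gs_dir n z w) (gs_dir n z w) \<le> 1"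
  using gs_dir_self[of n z w] by auto

lemma residual_orthogonal: "v < w \<Longrightarrow> dot n (residual n z w x) (gs_dir n z v) = 0"
proof (induction w arbitrary: v x)
  case (Suc w)
  \<comment> \<open>Orthogonality of two directions is the induction hypothesis applied to the
    column \<open>z w\<close>; this is why \<open>x\<close> is generalized.\<close>
  have orth: "dot n (gs_dir n z b) (gs_dir n z w) = 0" if "b < w" for b
    using Suc.IH[OF that, of "z w"] unfolding dot_gs_dir_right[of n _ z w] by (simp add: dot_commute)
  have step: "dot n (residual n z (Suc w) x) u = dot n (residual n z w x) u - dot n x (gs_dir n z w) * dot n (gs_dir n z w) u" for u
    by (simp add: dot_left gs_dir_def[symmetric])
  show ?case
  proof (cases "v < w")
    case True
    then show ?thesis using Suc.IH[OF True] orth[OF True] step by (simp add: dot_commute[of n "gs_dir n z w"])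
  next
    case False
    then have "v = w" using Suc.prems by simp
    \<comment> \<open>The recursion subtracts the coefficient of \<open>x\<close>, not that of its
      residual; they agree since the earlier directions are orthogonal to the new one.\<close>
    have "dot n (residual n z w x) (gs_dir n z w) = dot n x (gs_dir n z w)"
      unfolding residual_eq' by (simp add: dot_left orth)
    then show ?thesis using gs_dir_self[of n z w] unfolding step \<open>v = w\<close> by auto
  qed
qed simp

text \<open>The residual map is a symmetric idempotent: what it removes from \<open>x\<close> is
  spanned by directions orthogonal to every residual.\<close>

lemma dot_residual_residual: "dot n (residual n z w x) (residual n z w y) = dot n x (residual n z w y)"
proof -
  have "dot n (residual n z w x) (residual n z w y) = dot n x (residual n z w y)
      - (\<Sum>v<w. dot n x (gs_dir n z v) * dot n (gs_dir n z v) (residual n z w y))"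
    unfolding residual_eq'[of n z w x] by (simp add: dot_left)
  then show ?thesis by (simp add: residual_orthogonal dot_commute[of n "gs_dir n z _"])
qed

lemma dot_residual_self: "dot n (residual n z w x) (residual n z w x) = dot n x x - (\<Sum>v<w. (dot n x (gs_dir n z v))\<^sup>2)"
  unfolding dot_residual_residual by (simp add: residual_eq' dot_right power2_eq_square)

lemma dot_residual_self_le: "dot n (residual n z w x) (residual n z w x) \<le> dot n x x"
  unfolding dot_residual_self by (simp add: sum_nonneg)

lemma residual_linear:
  "residual n z w (\<lambda>i. x i + y i) i = residual n z w x i + residual n z w y i"
  "residual n z w (\<lambda>i. x i - y i) i = residual n z w x i - residual n z w y i"
  "residual n z w (\<lambda>i. \<Sum>j\<in>J. c j * X j i) i = (\<Sum>j\<in>J. c j * residual n z w (X j) i)"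
  unfolding residual_eq
  by (simp_all add: dot_left algebra_simps sum.distrib sum_subtractf sum_distrib_left sum_distrib_right
      sum.swap[of _ J])

lemma residual_column: "v < w \<Longrightarrow> i < n \<Longrightarrow> residual n z w (z v) i = 0"
proof (induction w arbitrary: i)
  case (Suc w)
  have zero: "\<forall>i<n. residual n z (Suc w) (z v) i = 0" if "v < w"
  proof -
    have "dot n (z v) (gs_dir n z w) = dot n (residual n z w (z v)) (residual n z w (z w))
        / sqrt (dot n (residual n z w (z w)) (residual n z w (z w)))"
      by (simp add: dot_gs_dir_right dot_residual_residual)
    also have "dot n (residual n z w (z v)) (residual n z w (z w)) = 0"
      using Suc.IH[OF that] by (simp add: dot_def)
    finally show ?thesis using Suc.IH[OF that] by (simp add: gs_dir_def[symmetric])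
  qed
  show ?case
  proof (cases "v < w")
    case True
    then show ?thesis using zero Suc.prems by blast
  next
    case False
    then have "v = w" using Suc.prems by simp
    define u where "u = residual n z w (z w)"
    have "dot n (z w) (gs_dir n z w) = dot n u u / sqrt (dot n u u)"
      by (simp add: dot_gs_dir_right dot_residual_residual u_def)
    then have "residual n z (Suc w) (z w) i = u i - dot n u u / sqrt (dot n u u) * (u i / sqrt (dot n u u))"
      by (simp add: gs_dir_def normalized_def u_def)
    also have "\<dots> = u i - dot n u u / dot n u u * u i"
      by (simp add: times_divide_times_eq)
    \<comment> \<open>If the squared norm is 0, the quotient is 0 rather than 1; but then
      \<open>u\<close> itself vanishes at all indices below \<open>n\<close>.\<close>
    also have "\<dots> = 0"
      using dot_self_eq_0_iff[of n u] Suc.prems by (cases "dot n u u = 0") auto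
    finally show ?thesis using \<open>v = w\<close> by simp
  qed
qed simp

text \<open>Subtracting a combination of the columns leaves the residual unchanged, and passing to
  the residual never lengthens a vector. Applied to an approximating spline, this turns a uniform
  approximation error into a bound for the projected vector.\<close>

lemma residual_least_squares:
  "dot n (residual n z w x) (residual n z w x)
    \<le> dot n (\<lambda>i. x i - (\<Sum>v<w. c v * z v i)) (\<lambda>i. x i - (\<Sum>v<w. c v * z v i))"
proof -
  let ?y = "\<lambda>i. x i - (\<Sum>v<w. c v * z v i)"
  have "residual n z w ?y i = residual n z w x i" if "i < n" for i
    using residual_column[OF _ that, of _ w z] by (simp add: residual_linear)
  then have "dot n (residual n z w x) (residual n z w x) = dot n (residual n z w ?y) (residual n z w ?y)"
    by (intro dot_cong) simp_all
  then show ?thesis using dot_residual_self_le by simp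
qed

text \<open>Realizes the residual by actual spline coefficients, so that it can serve as a
  competitor in the minimization.\<close>

lemma residual_attained: "\<exists>c. \<forall>i. residual n z w x i = x i - (\<Sum>v<w. c v * z v i)"
proof (induction w arbitrary: x)
  case (Suc w)
  obtain c where c: "\<forall>i. residual n z w x i = x i - (\<Sum>v<w. c v * z v i)" using Suc by blast
  obtain c' where c': "\<forall>i. residual n z w (z w) i = z w i - (\<Sum>v<w. c' v * z v i)" using Suc by blast
  define s where "s = dot n x (gs_dir n z w) / sqrt (dot n (residual n z w (z w)) (residual n z w (z w)))"
  have "residual n z (Suc w) x i = residual n z w x i - s * residual n z w (z w) i" for i
    by (simp add: s_def gs_dir_def normalized_def)
  then have "residual n z (Suc w) x i = x i - (\<Sum>v<Suc w. (if v = w then s else c v - s * c' v) * z v i)" for i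
    using c c' by (simp add: algebra_simps sum_subtractf sum_distrib_left)
  then show ?case by (intro exI allI)
qed simp

lemma residual_measurable [measurable]:
  assumes "\<And>w i. w < q \<Longrightarrow> i < n \<Longrightarrow> (\<lambda>\<omega>. z \<omega> w i) \<in> borel_measurable N"
    and "\<And>i. i < n \<Longrightarrow> (\<lambda>\<omega>. x \<omega> i) \<in> borel_measurable N"
  shows "w \<le> q \<Longrightarrow> i < n \<Longrightarrow> (\<lambda>\<omega>. residual n (z \<omega>) w (x \<omega>) i) \<in> borel_measurable N"
  using assms(2)
proof (induction w arbitrary: x i)
  case (Suc w)
  have *: "(\<lambda>\<omega>. residual n (z \<omega>) w (z \<omega> w) i) \<in> borel_measurable N" if "i < n" for i
    by (rule Suc.IH) (use Suc.prems that assms(1) in auto)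
  have **: "(\<lambda>\<omega>. normalized n (residual n (z \<omega>) w (z \<omega> w)) i) \<in> borel_measurable N" if "i < n" for i
    unfolding normalized_def dot_def using * that
    by (intro borel_measurable_divide borel_measurable_sqrt borel_measurable_sum borel_measurable_times) auto
  show ?case
    using Suc.prems ** Suc.IH[of i x]
    by (auto simp: dot_def intro!: borel_measurable_diff borel_measurable_times borel_measurable_sum)
qed simp

lemma gs_dir_measurable:
  assumes "\<And>w i. w < q \<Longrightarrow> i < n \<Longrightarrow> (\<lambda>\<omega>. z \<omega> w i) \<in> borel_measurable N"
  shows "w < q \<Longrightarrow> i < n \<Longrightarrow> (\<lambda>\<omega>. gs_dir n (z \<omega>) w i) \<in> borel_measurable N"
  using assms unfolding gs_dir_def normalized_def dot_def
  by (intro borel_measurable_divide borel_measurable_sqrt borel_measurable_sum borel_measurable_times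
      residual_measurable[where q=q]) auto

lemma residual_cong:
  assumes "\<And>w i. w < q \<Longrightarrow> i < n \<Longrightarrow> z w i = z' w i"
  shows "w \<le> q \<Longrightarrow> i < n \<Longrightarrow> (\<And>i. i < n \<Longrightarrow> x i = x' i) \<Longrightarrow> residual n z w x i = residual n z' w x' i"
proof (induction w arbitrary: x x' i)
  case (Suc w)
  have *: "residual n z w (z w) i = residual n z' w (z' w) i" if "i < n" for i
    by (rule Suc.IH) (use Suc.prems that assms in auto)
  have "normalized n (residual n z w (z w)) i = normalized n (residual n z' w (z' w)) i" if "i < n" for i
    unfolding normalized_def using * that by (simp cong: dot_cong)
  then show ?case
    using Suc.prems Suc.IH[of i x x'] by (simp cong: dot_cong)
qed simp

section \<open>The SCAD penalty and deterministic inequalities for its minimizer\<close>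

text \<open>The penalty enters only through \<open>0 \<le> p\<^sub>\<lambda> \<le> (a + 1) \<lambda>\<^sup>2 / 2\<close> and \<open>p\<^sub>\<lambda>(0) = 0\<close>.\<close>

lemma scad_penalty_bounds:
  assumes "2 < a" "0 < l"
  shows "0 \<le> scad_penalty l a x" "scad_penalty l a x \<le> (a + 1) * l\<^sup>2 / 2" "scad_penalty l a 0 = 0"
proof -
  have l2: "l * l \<ge> 0" by simp
  define y where "y = \<bar>x\<bar>"
  have y: "x\<^sup>2 = y\<^sup>2" "0 \<le> y" by (auto simp: y_def)
  have "0 \<le> scad_penalty l a x \<and> scad_penalty l a x \<le> (a + 1) * l\<^sup>2 / 2"
  proof -
    consider "y \<le> l" | "l < y" "y \<le> a * l" | "l < y" "a * l < y" by linarith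
    then show ?thesis
    proof cases
      case 1
      have "l * y \<le> l * l" using 1 assms by (intro mult_left_mono) auto
      moreover have "2 * (l * l) \<le> (a + 1) * (l * l)" using assms by (intro mult_right_mono) auto
      ultimately have "l * y \<le> (a + 1) * l\<^sup>2 / 2" unfolding power2_eq_square by linarith
      then show ?thesis
        using 1 y assms by (simp add: scad_penalty_def y_def[symmetric])
    next
      case 2
      \<comment> \<open>After multiplication by \<open>2 * (a - 1)\<close> the gap to the upper
        bound is exactly this square.\<close>
      have "(y - a * l)\<^sup>2 \<ge> 0" by simp
      then have up: "- (y\<^sup>2 - 2 * a * l * y + l\<^sup>2) \<le> (a + 1) * l\<^sup>2 / 2 * (2 * (a - 1))"
        by (simp add: power2_eq_square algebra_simps)
      \<comment> \<open>The negated quadratic is the sum of the three nonnegative terms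
        \<open>(y - l) * (a * l - y)\<close>, \<open>(a - 1) * l * (y - l)\<close> and
        \<open>2 * (a - 1) * l^2\<close>.\<close>
      have "0 \<le> (y - l) * (a * l - y)" using 2 by simp
      moreover have "0 \<le> (a - 1) * l * (y - l)" "0 \<le> 2 * (a-1) * (l * l)" using 2 assms by simp_all
      ultimately have "0 \<le> - (y\<^sup>2 - 2 * a * l * y + l\<^sup>2)"
        by (simp add: power2_eq_square algebra_simps)
      then show ?thesis
        using 2 y assms up by (simp add: scad_penalty_def y_def[symmetric] divide_le_eq del: minus_diff_eq)
    next
      case 3
      then show ?thesis using y assms by (simp add: scad_penalty_def y_def[symmetric])
    qed
  qed
  then show "0 \<le> scad_penalty l a x" "scad_penalty l a x \<le> (a + 1) * l\<^sup>2 / 2" by auto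
  show "scad_penalty l a 0 = 0" using assms by (simp add: scad_penalty_def)
qed

text \<open>The basic inequality: compare the minimizer with the true coefficients, whose spline part is
  chosen to be the projection of the noise.\<close>

lemma scad_basic_inequality:
  assumes min: "scad_minimizer n p q l a x z y bh ch"
    and y: "\<And>i. i < n \<Longrightarrow> y i = (\<Sum>j<p. x i j * \<beta> j) + h i"
    and \<beta>: "\<And>j. k \<le> j \<Longrightarrow> j < p \<Longrightarrow> \<beta> j = 0" and k: "k \<le> p" and al: "2 < a" "0 < l"
  defines "Q \<equiv> residual n (\<lambda>w i. z i w) q" and "f \<equiv> \<lambda>i. \<Sum>j<p. (bh j - \<beta> j) * x i j"
  shows "dot n (Q f) (Q f) \<le> 2 * dot n (Q h) (Q f) + real n * (real k * ((a + 1) * l\<^sup>2 / 2))"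
proof -
  have L2: "(L2_set u {..<n})\<^sup>2 = dot n u u" for u
    by (simp add: L2_set_def dot_def sum_nonneg power2_eq_square)
  obtain c where c: "\<And>i. Q h i = h i - (\<Sum>w<q. c w * z i w)"
    using residual_attained[of n "\<lambda>w i. z i w" q h] unfolding Q_def by blast
  \<comment> \<open>Whatever the fitted spline coefficients are, the loss at \<open>bh\<close> is at
    least the squared residual of \<open>h - f\<close>.\<close>
  have "dot n (\<lambda>i. Q h i - Q f i) (\<lambda>i. Q h i - Q f i) = dot n (Q (\<lambda>i. h i - f i)) (Q (\<lambda>i. h i - f i))"
    unfolding Q_def by (intro dot_cong) (simp_all add: residual_linear)
  also have "\<dots> \<le> dot n (\<lambda>i. (h i - f i) - (\<Sum>w<q. ch w * z i w)) (\<lambda>i. (h i - f i) - (\<Sum>w<q. ch w * z i w))"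
    unfolding Q_def by (rule residual_least_squares)
  also have "\<dots> = dot n (\<lambda>i. y i - (\<Sum>j<p. x i j * bh j) - (\<Sum>w<q. z i w * ch w))
      (\<lambda>i. y i - (\<Sum>j<p. x i j * bh j) - (\<Sum>w<q. z i w * ch w))"
    by (intro dot_cong) (simp_all add: y f_def algebra_simps sum_subtractf)
  finally have 1: "dot n (\<lambda>i. Q h i - Q f i) (\<lambda>i. Q h i - Q f i) + real n * (\<Sum>j<p. scad_penalty l a (bh j))
      \<le> scad_objective n p q l a x z y bh ch"
    by (simp add: scad_objective_def L2)
  also have "\<dots> \<le> scad_objective n p q l a x z y \<beta> c"
    using min by (simp add: scad_minimizer_def)
  also have "\<dots> = dot n (Q h) (Q h) + real n * (\<Sum>j<p. scad_penalty l a (\<beta> j))"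
    unfolding scad_objective_def L2
    by (intro arg_cong2[of _ _ _ _ "(+)"] dot_cong refl) (simp_all add: y c mult.commute)
  also have "(\<Sum>j<p. scad_penalty l a (\<beta> j)) = (\<Sum>j<k. scad_penalty l a (\<beta> j))"
    using k \<beta> scad_penalty_bounds(3)[OF al] by (intro sum.mono_neutral_right) auto
  also have "dot n (Q h) (Q h) + real n * (\<Sum>j<k. scad_penalty l a (\<beta> j))
      \<le> dot n (Q h) (Q h) + real n * (\<Sum>j<k. (a + 1) * l\<^sup>2 / 2)"
    by (intro add_left_mono mult_left_mono sum_mono scad_penalty_bounds(2)[OF al]) auto
  finally have "dot n (\<lambda>i. Q h i - Q f i) (\<lambda>i. Q h i - Q f i) + real n * (\<Sum>j<p. scad_penalty l a (bh j))
      \<le> dot n (Q h) (Q h) + real n * (real k * ((a + 1) * l\<^sup>2 / 2))" by simp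
  moreover have "0 \<le> real n * (\<Sum>j<p. scad_penalty l a (bh j))"
    by (intro mult_nonneg_nonneg sum_nonneg scad_penalty_bounds(1)[OF al]) auto
  moreover have "dot n (\<lambda>i. Q h i - Q f i) (\<lambda>i. Q h i - Q f i)
      = dot n (Q h) (Q h) - 2 * dot n (Q h) (Q f) + dot n (Q f) (Q f)"
    by (simp add: dot_left dot_right dot_commute[of n "Q f" "Q h"])
  ultimately show ?thesis by linarith
qed

text \<open>Both cross terms are absorbed on the left. The one with \<open>g\<close> costs half of
  \<open>|Q f|^2\<close>; of the other half, which is at least \<open>c * n / 2\<close> times the
  squared error, the noise term uses up one half. The remaining quarter gives the factor
  \<open>4 / c\<close>.\<close>

lemma scad_error_bound:
  fixes g \<epsilon> :: "nat \<Rightarrow> real"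
  assumes min: "scad_minimizer n p q l a x z y bh ch"
    and y: "\<And>i. i < n \<Longrightarrow> y i = (\<Sum>j<p. x i j * \<beta> j) + g i + \<epsilon> i"
    and \<beta>: "\<And>j. k \<le> j \<Longrightarrow> j < p \<Longrightarrow> \<beta> j = 0" and k: "k \<le> p" and al: "2 < a" "0 < l"
    and n: "0 < n"
  defines "Q \<equiv> residual n (\<lambda>w i. z i w) q" and "d \<equiv> \<lambda>j. bh j - \<beta> j"
    and "f \<equiv> \<lambda>i. \<Sum>j<p. (bh j - \<beta> j) * x i j"
  assumes low: "c * real n * dot p d d \<le> dot n (Q f) (Q f)" and c: "0 < c"
    and g: "\<And>i. i < n \<Longrightarrow> \<bar>g i - (\<Sum>w<q. cg w * z i w)\<bar> \<le> \<eta>"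
    and R: "(\<Sum>j<p. (dot n (Q (\<lambda>i. x i j)) \<epsilon>)\<^sup>2) \<le> \<rho> * real n"
  shows "dot p d d \<le> (4 / c) * (2 * \<eta>\<^sup>2 + 4 * \<rho> / (c * real n) + real k * ((a + 1) * l\<^sup>2 / 2))"
proof -
  define A where "A = dot n (Q f) (Q f)"
  define D where "D = dot p d d"
  have "A \<le> 2 * dot n (Q (\<lambda>i. g i + \<epsilon> i)) (Q f) + real n * (real k * ((a + 1) * l\<^sup>2 / 2))"
    unfolding A_def Q_def f_def
    by (rule scad_basic_inequality[OF min _ \<beta> k al]) (simp_all add: y)
  also have "dot n (Q (\<lambda>i. g i + \<epsilon> i)) (Q f) = dot n (Q g) (Q f) + dot n \<epsilon> (Q f)"
  proof -
    have "dot n (Q (\<lambda>i. g i + \<epsilon> i)) (Q f) = dot n (\<lambda>i. Q g i + Q \<epsilon> i) (Q f)"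
      unfolding Q_def by (intro dot_cong) (simp_all add: residual_linear)
    then show ?thesis unfolding dot_left by (simp add: Q_def dot_residual_residual[of n _ _ \<epsilon>])
  qed
  finally have 1: "A \<le> 2 * dot n (Q g) (Q f) + 2 * dot n \<epsilon> (Q f) + real n * (real k * ((a + 1) * l\<^sup>2 / 2))"
    by simp
  have Qg: "dot n (Q g) (Q g) \<le> real n * \<eta>\<^sup>2"
  proof -
    have "dot n (Q g) (Q g) \<le> dot n (\<lambda>i. g i - (\<Sum>w<q. cg w * z i w)) (\<lambda>i. g i - (\<Sum>w<q. cg w * z i w))"
      unfolding Q_def by (rule residual_least_squares)
    also have "\<dots> = (\<Sum>i<n. \<bar>g i - (\<Sum>w<q. cg w * z i w)\<bar>\<^sup>2)" by (simp add: dot_def power2_eq_square)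
    also have "\<dots> \<le> (\<Sum>i<n. \<eta>\<^sup>2)" by (intro sum_mono power_mono) (use g in auto)
    finally show ?thesis by simp
  qed
  have 2: "2 * dot n (Q g) (Q f) \<le> 2 * (real n * \<eta>\<^sup>2) + A / 2"
    using two_dot_le[of 2 n "Q g" "Q f"] Qg by (simp add: A_def)
  \<comment> \<open>Linearity turns the noise term into an inner product over the \<open>p\<close>
    coefficients, so Cauchy-Schwarz separates the random estimation error from a statistic that does
    not involve the estimator.\<close>
  have eq: "dot n \<epsilon> (Q f) = dot p d (\<lambda>j. dot n (Q (\<lambda>i. x i j)) \<epsilon>)"
  proof -
    have "dot n \<epsilon> (Q f) = dot n \<epsilon> (\<lambda>i. \<Sum>j<p. d j * Q (\<lambda>i. x i j) i)"
      unfolding Q_def f_def d_def by (intro dot_cong) (simp_all add: residual_linear)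
    then show ?thesis by (simp add: dot_right dot_def[of p] dot_commute[of n \<epsilon>])
  qed
  have R': "dot p (\<lambda>j. dot n (Q (\<lambda>i. x i j)) \<epsilon>) (\<lambda>j. dot n (Q (\<lambda>i. x i j)) \<epsilon>) \<le> \<rho> * real n"
    using R by (simp add: dot_def[of p] power2_eq_square)
  have cn: "0 < c * real n / 4" using c n by simp
  have "2 * dot n \<epsilon> (Q f) \<le> c * real n / 4 * D + (\<rho> * real n) / (c * real n / 4)"
    unfolding eq D_def
    by (rule order_trans[OF two_dot_le[OF cn] add_left_mono[OF divide_right_mono[OF R' less_imp_le[OF cn]]]])
  also have "(\<rho> * real n) / (c * real n / 4) = 4 * \<rho> / c" using n c by simp
  finally have 3: "2 * dot n \<epsilon> (Q f) \<le> c * real n / 4 * D + 4 * \<rho> / c" .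
  have "c * real n / 4 * D \<le> 2 * (real n * \<eta>\<^sup>2) + 4 * \<rho> / c + real n * (real k * ((a + 1) * l\<^sup>2 / 2))"
  proof -
    have arith: "A \<le> 2 * u + 2 * v + w \<Longrightarrow> 2 * u \<le> 2 * h + A / 2 \<Longrightarrow> 2 * v \<le> W / 4 + r \<Longrightarrow> W \<le> A
      \<Longrightarrow> W / 4 \<le> 2 * h + r + w" for u v w h W r :: real by linarith
    have noise: "2 * dot n \<epsilon> (Q f) \<le> c * real n * D / 4 + 4 * \<rho> / c" using 3 by simp
    show ?thesis
      using arith[OF 1 2 noise low[folded A_def D_def]] by (simp only: times_divide_eq_left)
  qed
  also have "\<dots> = real n * (2 * \<eta>\<^sup>2 + 4 * \<rho> / (c * real n) + real k * ((a + 1) * l\<^sup>2 / 2))"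
    using n by (simp add: algebra_simps)
  finally have "real n * (c / 4 * D) \<le> real n * (2 * \<eta>\<^sup>2 + 4 * \<rho> / (c * real n) + real k * ((a + 1) * l\<^sup>2 / 2))"
    by (simp add: algebra_simps)
  then have "c / 4 * D \<le> 2 * \<eta>\<^sup>2 + 4 * \<rho> / (c * real n) + real k * ((a + 1) * l\<^sup>2 / 2)"
    using n by (simp only: mult_le_cancel_left_pos of_nat_0_less_iff)
  then have "(4 / c) * (c / 4 * D) \<le> (4 / c) * (2 * \<eta>\<^sup>2 + 4 * \<rho> / (c * real n) + real k * ((a + 1) * l\<^sup>2 / 2))"
    by (rule mult_left_mono) (use c in simp)
  then show ?thesis using c unfolding D_def by simp
qed

text \<open>\<open>F\<close> is the squared Frobenius distance of the Gram matrix of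
  \<open>e\<close> from \<open>n * \<Xi>\<close>, and \<open>S\<close> is the part of the columns of
  \<open>e\<close> that the spline directions capture. Neither involves \<open>d\<close>, so small
  values of both serve every \<open>d\<close> at once. The factor 1/2 is the price of separating
  \<open>e\<close> from the bias of \<open>th\<close>.\<close>

lemma residual_design_lower_bound:
  fixes d :: "nat \<Rightarrow> real"
  assumes x: "\<And>i j. i < n \<Longrightarrow> j < p \<Longrightarrow> x i j = th i j + e i j"
    and th: "\<And>i j. i < n \<Longrightarrow> j < p \<Longrightarrow> \<bar>th i j - (\<Sum>w<q. cs j w * z i w)\<bar> \<le> \<eta>"
    and \<Xi>: "\<mu> * dot p d d \<le> (\<Sum>j<p. \<Sum>l<p. d j * d l * \<Xi> j l)"
  defines "Q \<equiv> residual n (\<lambda>w i. z i w) q" and "V \<equiv> gs_dir n (\<lambda>w i. z i w)"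
    and "f \<equiv> \<lambda>i. \<Sum>j<p. d j * x i j"
    and "F \<equiv> (\<Sum>j<p. \<Sum>l<p. ((\<Sum>i<n. e i j * e i l) - real n * \<Xi> j l)\<^sup>2)"
    and "S \<equiv> (\<Sum>j<p. \<Sum>w<q. (dot n (\<lambda>i. e i j) (gs_dir n (\<lambda>w i. z i w) w))\<^sup>2)"
  shows "dot n (Q f) (Q f) \<ge> ((real n * \<mu> - sqrt F - S) / 2 - real n * real p * \<eta>\<^sup>2) * dot p d d"
proof -
  define D where "D = dot p d d"
  have D0: "0 \<le> D" by (simp add: D_def)
  define fe ft where "fe i = (\<Sum>j<p. d j * e i j)" and "ft i = (\<Sum>j<p. d j * th i j)" for i
  have Qf: "Q f i = Q fe i + Q ft i" if "i < n" for i
  proof -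
    have "Q f i = Q (\<lambda>i. fe i + ft i) i"
      unfolding Q_def using that
      by (intro residual_cong[where q=q]) (simp_all add: f_def fe_def ft_def x algebra_simps sum.distrib)
    then show ?thesis by (simp add: Q_def residual_linear)
  qed
  have "dot n (Q fe) (Q fe) = dot n (\<lambda>i. Q f i - Q ft i) (\<lambda>i. Q f i - Q ft i)"
    by (intro dot_cong) (simp_all add: Qf)
  also have "\<dots> = dot n (Q f) (Q f) - 2 * dot n (Q f) (Q ft) + dot n (Q ft) (Q ft)"
    by (simp add: dot_left dot_right dot_commute[of n "Q ft" "Q f"])
  \<comment> \<open>Young's inequality with weight 1, applied to the negative of \<open>Q f\<close>
    because the cross term enters with a minus sign.\<close>
  also have "\<dots> \<le> 2 * dot n (Q f) (Q f) + 2 * dot n (Q ft) (Q ft)"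
    using two_dot_le[of 1 n "\<lambda>i. - 1 * Q f i" "Q ft"] unfolding dot_scale_left dot_scale_right by simp
  finally have 1: "dot n (Q fe) (Q fe) / 2 - dot n (Q ft) (Q ft) \<le> dot n (Q f) (Q f)" by simp
  have 2: "dot n (Q ft) (Q ft) \<le> real n * real p * \<eta>\<^sup>2 * D"
  proof -
    let ?s = "\<lambda>i. \<Sum>w<q. (\<Sum>j<p. d j * cs j w) * z i w"
    have eq: "ft i - ?s i = dot p d (\<lambda>j. th i j - (\<Sum>w<q. cs j w * z i w))" for i
      unfolding ft_def dot_def
      by (simp add: algebra_simps sum_subtractf sum_distrib_left sum_distrib_right sum.swap[of _ "{..<q}"])
    have "dot n (Q ft) (Q ft) \<le> dot n (\<lambda>i. ft i - ?s i) (\<lambda>i. ft i - ?s i)"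
      unfolding Q_def by (rule residual_least_squares)
    also have "\<dots> = (\<Sum>i<n. (dot p d (\<lambda>j. th i j - (\<Sum>w<q. cs j w * z i w)))\<^sup>2)"
      unfolding eq by (simp add: dot_def[of n] power2_eq_square)
    also have "\<dots> \<le> (\<Sum>i<n. D * (real p * \<eta>\<^sup>2))"
    proof (rule sum_mono)
      fix i assume i: "i \<in> {..<n}"
      let ?u = "\<lambda>j. th i j - (\<Sum>w<q. cs j w * z i w)"
      have "dot p ?u ?u = (\<Sum>j<p. \<bar>?u j\<bar>\<^sup>2)" by (simp add: dot_def power2_eq_square)
      also have "\<dots> \<le> (\<Sum>j<p. \<eta>\<^sup>2)" by (intro sum_mono power_mono) (use th i in auto)
      finally show "(dot p d ?u)\<^sup>2 \<le> D * (real p * \<eta>\<^sup>2)"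
        using dot_Cauchy_Schwarz[of p d ?u] mult_left_mono[OF _ D0, of "dot p ?u ?u" "real p * \<eta>\<^sup>2"]
        by (simp add: D_def)
    qed
    finally show ?thesis by (simp add: mult_ac)
  qed
  have 3: "dot n fe fe \<ge> real n * \<mu> * D - sqrt F * D"
  proof -
    let ?G = "\<lambda>j l. (\<Sum>i<n. e i j * e i l) - real n * \<Xi> j l"
    have "dot n fe fe = (\<Sum>j<p. \<Sum>l<p. d j * d l * (\<Sum>i<n. e i j * e i l))"
    proof -
      have "dot n fe fe = (\<Sum>i<n. \<Sum>j<p. \<Sum>l<p. d j * d l * (e i j * e i l))"
        by (simp add: dot_def fe_def sum_product mult_ac)
      also have "\<dots> = (\<Sum>j<p. \<Sum>i<n. \<Sum>l<p. d j * d l * (e i j * e i l))" by (rule sum.swap)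
      also have "\<dots> = (\<Sum>j<p. \<Sum>l<p. \<Sum>i<n. d j * d l * (e i j * e i l))"
        by (rule sum.cong[OF refl], rule sum.swap)
      finally show ?thesis by (simp add: sum_distrib_left)
    qed
    also have "\<dots> = real n * (\<Sum>j<p. \<Sum>l<p. d j * d l * \<Xi> j l) + (\<Sum>j<p. \<Sum>l<p. (d j * d l) * ?G j l)"
      by (simp add: algebra_simps sum_subtractf sum_distrib_left)
    finally have fe: "dot n fe fe = real n * (\<Sum>j<p. \<Sum>l<p. d j * d l * \<Xi> j l) + (\<Sum>j<p. \<Sum>l<p. (d j * d l) * ?G j l)" .
    \<comment> \<open>Cauchy-Schwarz over pairs of indices: the squares of the weights
      \<open>d j * d l\<close> add up to \<open>D^2\<close>, which bounds the quadratic form by the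
      Frobenius norm.\<close>
    have "(\<Sum>j<p. \<Sum>l<p. (d j * d l) * ?G j l)\<^sup>2 = (\<Sum>(j, l)\<in>{..<p} \<times> {..<p}. (d j * d l) * ?G j l)\<^sup>2"
      by (simp add: sum.cartesian_product)
    also have "\<dots> \<le> (\<Sum>(j, l)\<in>{..<p} \<times> {..<p}. (d j * d l)\<^sup>2) * (\<Sum>(j, l)\<in>{..<p} \<times> {..<p}. (?G j l)\<^sup>2)"
      using Cauchy_Schwarz_ineq_sum[of "\<lambda>(j, l). d j * d l" "\<lambda>(j, l). ?G j l" "{..<p} \<times> {..<p}"]
      by (simp add: case_prod_beta)
    also have "(\<Sum>(j, l)\<in>{..<p} \<times> {..<p}. (d j * d l)\<^sup>2) = D\<^sup>2"
      by (simp add: sum.cartesian_product[symmetric] D_def dot_def power2_eq_square sum_product mult_ac)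
    also have "(\<Sum>(j, l)\<in>{..<p} \<times> {..<p}. (?G j l)\<^sup>2) = F"
      by (simp add: sum.cartesian_product[symmetric] F_def)
    finally have "\<bar>\<Sum>j<p. \<Sum>l<p. (d j * d l) * ?G j l\<bar> \<le> sqrt (D\<^sup>2 * F)"
      using real_sqrt_le_mono by fastforce
    then have "\<bar>\<Sum>j<p. \<Sum>l<p. (d j * d l) * ?G j l\<bar> \<le> D * sqrt F"
      using D0 by (simp add: real_sqrt_mult)
    moreover have "real n * (\<mu> * D) \<le> real n * (\<Sum>j<p. \<Sum>l<p. d j * d l * \<Xi> j l)"
      using \<Xi> by (intro mult_left_mono) (auto simp: D_def)
    ultimately show ?thesis using fe by (simp add: mult_ac)
  qed
  have 4: "(\<Sum>w<q. (dot n fe (V w))\<^sup>2) \<le> D * S"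
  proof -
    have "dot n fe (V w) = dot p d (\<lambda>j. dot n (\<lambda>i. e i j) (V w))" for w
      unfolding fe_def[abs_def] by (simp add: dot_left dot_def[of p])
    then have "(\<Sum>w<q. (dot n fe (V w))\<^sup>2) \<le> (\<Sum>w<q. D * (\<Sum>j<p. (dot n (\<lambda>i. e i j) (V w))\<^sup>2))"
      using dot_Cauchy_Schwarz[of p d] by (auto intro!: sum_mono simp: D_def dot_def[of p] power2_eq_square)
    also have "\<dots> = D * S"
      unfolding S_def V_def by (simp add: sum_distrib_left sum.swap[of _ "{..<q}"])
    finally show ?thesis .
  qed
  have "dot n (Q fe) (Q fe) = dot n fe fe - (\<Sum>w<q. (dot n fe (V w))\<^sup>2)"
    unfolding Q_def V_def by (rule dot_residual_self)
  then have "dot n (Q f) (Q f) \<ge> (real n * \<mu> * D - sqrt F * D - D * S) / 2 - real n * real p * \<eta>\<^sup>2 * D"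
  proof -
    have arith: "a = b - v \<Longrightarrow> a / 2 - h \<le> r \<Longrightarrow> h \<le> h' \<Longrightarrow> u \<le> b \<Longrightarrow> v \<le> v' \<Longrightarrow> (u - v') / 2 - h' \<le> r"
      for a b v h r h' u v' :: real by argo
    show ?thesis by (rule arith[OF _ 1 2 3 4]) fact
  qed
  then show ?thesis by (simp add: D_def algebra_simps diff_divide_distrib)
qed

section \<open>The smallest eigenvalue of a symmetric matrix\<close>

definition quad_form :: "real mat \<Rightarrow> nat \<Rightarrow> (nat \<Rightarrow> real) \<Rightarrow> (nat \<Rightarrow> real) \<Rightarrow> real" where
  "quad_form A p d d' = (\<Sum>j<p. \<Sum>l<p. d j * d' l * A $$ (j, l))"

lemma quad_form_attains_min_on_sphere:
  assumes "1 \<le> p"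
  shows "\<exists>u. dot p u u = 1 \<and> (\<forall>d. quad_form A p u u * dot p d d \<le> quad_form A p d d)"
proof -
  \<comment> \<open>Vectors are functions on all of \<open>nat\<close>; fixing the coordinates from
    \<open>p\<close> on at 0 makes the sphere a closed subset of a product of compact sets.\<close>
  define K where "K = {d. (\<forall>j. d j \<in> (if j < p then {-1..1} else {0})) \<and> dot p d d = 1}"
  have coord: "continuous_on S (\<lambda>d::nat \<Rightarrow> real. d j)" for S j
    by (rule continuous_on_product_then_coordinatewise[OF continuous_on_id])
  have "compactin (product_topology (\<lambda>_. euclidean) UNIV)
      (\<Pi>\<^sub>E j\<in>UNIV. if j < p then {-1..1::real} else {0})"
    by (subst compactin_PiE) auto
  then have "compact (\<Pi>\<^sub>E j\<in>UNIV. if j < p then {-1..1::real} else {0})"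
    by (simp add: euclidean_product_topology)
  moreover have "closed {d. dot p d d = 1}"
    unfolding dot_def by (intro closed_Collect_eq continuous_intros coord)
  ultimately have "compact ((\<Pi>\<^sub>E j\<in>UNIV. if j < p then {-1..1::real} else {0}) \<inter> {d. dot p d d = 1})"
    by (rule compact_Int_closed)
  moreover have "(\<Pi>\<^sub>E j\<in>UNIV. if j < p then {-1..1::real} else {0}) \<inter> {d. dot p d d = 1} = K"
    unfolding K_def PiE_UNIV_domain Pi_def Collect_conj_eq by simp
  ultimately have "compact K" by simp
  moreover have "(\<lambda>j. if j = 0 then 1 else 0) \<in> K"
    using assms by (auto simp: K_def dot_def if_distrib[of "\<lambda>x. _ * x"] sum.delta cong: if_cong)
  moreover have "continuous_on K (\<lambda>d. quad_form A p d d)"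
    unfolding quad_form_def by (intro continuous_intros coord)
  ultimately obtain u where u: "u \<in> K" "\<And>d. d \<in> K \<Longrightarrow> quad_form A p u u \<le> quad_form A p d d"
    using continuous_attains_inf[of K "\<lambda>d. quad_form A p d d"] by blast
  have "quad_form A p u u * dot p d d \<le> quad_form A p d d" for d
  proof (cases "dot p d d = 0")
    case True
    then show ?thesis using dot_self_eq_0_iff[of p d] by (simp add: quad_form_def)
  next
    case False
    define s where "s = sqrt (dot p d d)"
    have s: "0 < s" "s * s = dot p d d" using False dot_self_nonneg[of p d] by (simp_all add: s_def less_le)
    define e where "e = (\<lambda>j. if j < p then d j / s else 0)"
    have "dot p e e = dot p d d / (s * s)"
      by (simp add: dot_def e_def sum_divide_distrib)
    then have e1: "dot p e e = 1" using s False by simp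
    have "e j \<in> {-1..1}" if "j < p" for j
    proof -
      have "(e j)\<^sup>2 \<le> dot p e e"
        unfolding dot_def power2_eq_square using that by (intro member_le_sum) auto
      then show ?thesis using e1 abs_square_le_1[of "e j"] by auto
    qed
    then have "e \<in> K" using e1 by (auto simp: K_def) (auto simp: e_def)
    then have "quad_form A p u u \<le> quad_form A p e e" by (rule u(2))
    also have "\<dots> = quad_form A p d d / (s * s)"
      by (simp add: quad_form_def e_def sum_divide_distrib)
    finally have "quad_form A p u u * (s * s) \<le> quad_form A p d d" using s(1) by (simp add: pos_le_divide_eq)
    then show ?thesis unfolding s(2) .
  qed
  then show ?thesis using u(1) by (auto simp: K_def)
qed

text \<open>The first-order condition at a minimum, without derivatives.\<close>

lemma nonneg_quadratic_linear_term_zero: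
  fixes b c :: real
  assumes "\<And>t. 0 \<le> 2 * t * b + t\<^sup>2 * c"
  shows "b = 0"
proof (rule ccontr)
  assume b: "b \<noteq> 0"
  \<comment> \<open>At \<open>t = - b / K\<close> with \<open>K\<close> positive and at least
    \<open>c\<close> the expression is at most \<open>- b^2 / K\<close>.\<close>
  define K where "K = \<bar>c\<bar> + 1"
  have K: "0 < K" "c \<le> K" by (auto simp: K_def)
  have "0 \<le> 2 * (- b / K) * b + (- b / K)\<^sup>2 * c" by (rule assms)
  also have "\<dots> \<le> 2 * (- b / K) * b + (- b / K)\<^sup>2 * K"
    using K by (intro add_left_mono mult_left_mono) auto
  also have "\<dots> = - (b\<^sup>2 / K)" using K by (simp add: power2_eq_square field_simps)
  finally show False using b K by (simp add: divide_le_0_iff zero_le_divide_iff not_le)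
qed

text \<open>The minimizer of the quadratic form on the unit sphere is an eigenvector, so the minimum is an
  element of the spectrum.\<close>

lemma lambda_min_le_quad_form:
  assumes A: "A \<in> carrier_mat p p" and p: "1 \<le> p"
    and sym: "\<And>j l. j < p \<Longrightarrow> l < p \<Longrightarrow> A $$ (j, l) = A $$ (l, j)"
  shows "lambda_min A * dot p d d \<le> quad_form A p d d"
proof -
  obtain u where u: "dot p u u = 1" "\<And>d. quad_form A p u u * dot p d d \<le> quad_form A p d d"
    using quad_form_attains_min_on_sphere[OF p] by blast
  define \<mu> where "\<mu> = quad_form A p u u"
  have qsym: "quad_form A p x y = quad_form A p y x" for x y
  proof -
    have "quad_form A p x y = (\<Sum>l<p. \<Sum>j<p. x j * y l * A $$ (j, l))"
      unfolding quad_form_def by (rule sum.swap)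
    also have "\<dots> = quad_form A p y x"
      unfolding quad_form_def by (intro sum.cong refl) (simp add: sym mult_ac)
    finally show ?thesis .
  qed
  \<comment> \<open>Perturbing \<open>u\<close> to \<open>u + t * y\<close> keeps the form above
    \<open>\<mu>\<close> times the squared norm. The difference has no constant term, so its linear
    term must vanish.\<close>
  have stat: "quad_form A p u y - \<mu> * dot p u y = 0" for y
  proof (rule nonneg_quadratic_linear_term_zero)
    fix t
    let ?d = "\<lambda>j. u j + t * y j"
    have "quad_form A p ?d ?d = \<mu> + 2 * t * quad_form A p u y + t\<^sup>2 * quad_form A p y y"
    proof -
      have "quad_form A p ?d ?d = quad_form A p u u + t * quad_form A p u y + t * quad_form A p y u + t\<^sup>2 * quad_form A p y y"
        unfolding quad_form_def by (simp add: algebra_simps sum.distrib sum_distrib_left power2_eq_square)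
      then show ?thesis unfolding qsym[of y u] by (simp add: \<mu>_def)
    qed
    moreover have "dot p ?d ?d = 1 + 2 * t * dot p u y + t\<^sup>2 * dot p y y"
      using u(1) by (simp add: dot_left dot_right dot_commute[of p y u] power2_eq_square algebra_simps)
    ultimately show "0 \<le> 2 * t * (quad_form A p u y - \<mu> * dot p u y) + t\<^sup>2 * (quad_form A p y y - \<mu> * dot p y y)"
      using u(2)[of ?d] by (simp add: \<mu>_def[symmetric] algebra_simps)
  qed
  have row: "(\<Sum>l<p. A $$ (j, l) * u l) = \<mu> * u j" if j: "j < p" for j
  proof -
    \<comment> \<open>Stationarity tested against a unit vector is one row of the eigenvalue
      equation.\<close>
    let ?e = "\<lambda>l. if l = j then 1 else 0 :: real"
    have "quad_form A p u ?e = (\<Sum>l<p. A $$ (j, l) * u l)"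
      unfolding quad_form_def using j
      by (auto simp: if_distrib[of "\<lambda>x. _ * x"] if_distrib[of "\<lambda>x. x * _"] sum.delta sym mult.commute intro!: sum.cong cong: if_cong)
    moreover have "dot p u ?e = u j"
      unfolding dot_def using j by (simp add: if_distrib[of "\<lambda>x. _ * x"] sum.delta cong: if_cong)
    ultimately show ?thesis using stat[of ?e] by simp
  qed
  have "eigenvector A (vec p u) \<mu>"
    unfolding eigenvector_def
  proof (intro conjI)
    show "vec p u \<in> carrier_vec (dim_row A)" using A by auto
    show "vec p u \<noteq> 0\<^sub>v (dim_row A)"
    proof
      assume "vec p u = 0\<^sub>v (dim_row A)"
      then have "\<forall>j<p. u j = 0" using A by (metis carrier_matD(1) index_vec index_zero_vec(1))
      then show False using u(1) by (simp add: dot_self_eq_0_iff[symmetric])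
    qed
    show "A *\<^sub>v vec p u = \<mu> \<cdot>\<^sub>v vec p u"
      using A row by (intro eq_vecI) (auto simp: scalar_prod_def lessThan_atLeast0)
  qed
  then have "\<mu> \<in> spectrum A" by (auto simp: spectrum_def eigenvalue_def)
  then have "lambda_min A \<le> \<mu>"
    unfolding lambda_min_def using card_finite_spectrum(1)[OF A] by (intro Min_le)
  then have "lambda_min A * dot p d d \<le> \<mu> * dot p d d" by (intro mult_right_mono) auto
  also have "\<dots> \<le> quad_form A p d d" using u(2) by (simp add: \<mu>_def)
  finally show ?thesis .
qed

section \<open>Moments of statistics of an i.i.d. sample\<close>

context prob_space
begin

abbreviation sample_law :: "nat \<Rightarrow> (nat \<Rightarrow> 'a) measure" where
  "sample_law n \<equiv> \<Pi>\<^sub>M i\<in>{..<n}. M"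

lemma prob_space_sample_law: "prob_space (sample_law n)"
  by (rule prob_space_PiM) (rule prob_space_axioms)

lemma product_sigma_finite_const: "product_sigma_finite (\<lambda>_::nat. M)"
  by unfold_locales

lemma lessThan_split: "l < n \<Longrightarrow> {..<n} = insert l ({..<n} - {l})" for l n :: nat
  by auto

text \<open>Fubini's theorem in place of conditioning on all observations but the
  \<open>l\<close>-th: it suffices to compare integrals over that coordinate with the others
  frozen.\<close>

lemma nn_integral_sample_law_coordinate_mono:
  fixes F F' :: "(nat \<Rightarrow> 'a) \<Rightarrow> ennreal"
  assumes "l < n" "F \<in> borel_measurable (sample_law n)" "F' \<in> borel_measurable (sample_law n)"
    and le: "\<And>s. (\<And>i. i < n \<Longrightarrow> i \<noteq> l \<Longrightarrow> s i \<in> space M) \<Longrightarrow>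
      (\<integral>\<^sup>+ y. F (s(l := y)) \<partial>M) \<le> (\<integral>\<^sup>+ y. F' (s(l := y)) \<partial>M)"
  shows "(\<integral>\<^sup>+ s. F s \<partial>sample_law n) \<le> (\<integral>\<^sup>+ s. F' s \<partial>sample_law n)"
proof -
  interpret product_sigma_finite "\<lambda>_::nat. M" by (rule product_sigma_finite_const)
  have split: "(\<integral>\<^sup>+ s. G s \<partial>sample_law n) = (\<integral>\<^sup>+ s. (\<integral>\<^sup>+ y. G (s(l := y)) \<partial>M) \<partial>PiM ({..<n} - {l}) (\<lambda>_. M))"
    if "G \<in> borel_measurable (sample_law n)" for G :: "(nat \<Rightarrow> 'a) \<Rightarrow> ennreal"
    using product_nn_integral_insert[of "{..<n} - {l}" l G] that lessThan_split[OF assms(1)] by auto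
  show ?thesis
    unfolding split[OF assms(2)] split[OF assms(3)]
    by (intro nn_integral_mono le) (auto simp: space_PiM PiE_iff)
qed

text \<open>The signed counterpart, used for cross terms. Integrability is assumed for the whole
  product only; the inner integrals are given as values.\<close>

lemma integral_sample_law_eq_0:
  fixes F :: "(nat \<Rightarrow> 'a) \<Rightarrow> real"
  assumes "l < n" "integrable (sample_law n) F"
    and eq: "\<And>s. (\<And>i. i < n \<Longrightarrow> i \<noteq> l \<Longrightarrow> s i \<in> space M) \<Longrightarrow> (\<integral> y. F (s(l := y)) \<partial>M) = 0"
  shows "(\<integral> s. F s \<partial>sample_law n) = 0"
proof -
  interpret product_sigma_finite "\<lambda>_::nat. M" by (rule product_sigma_finite_const)
  have "(\<integral> s. F s \<partial>sample_law n) = (\<integral> s. (\<integral> y. F (s(l := y)) \<partial>M) \<partial>PiM ({..<n} - {l}) (\<lambda>_. M))"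
    using product_integral_insert[of "{..<n} - {l}" l F] assms(2) lessThan_split[OF assms(1)] by auto
  also have "\<dots> = (\<integral> s. 0 \<partial>PiM ({..<n} - {l}) (\<lambda>_. M))"
    by (intro Bochner_Integration.integral_cong eq refl) (auto simp: space_PiM PiE_iff)
  finally show ?thesis by simp
qed

text \<open>The summands need not be independent of each other: it is enough that, for \<open>i \<noteq> l\<close>, the product
  of the \<open>i\<close>-th and the \<open>l\<close>-th one averages to zero over the \<open>l\<close>-th observation alone.\<close>

lemma second_moment_of_sum:
  fixes f :: "nat \<Rightarrow> (nat \<Rightarrow> 'a) \<Rightarrow> real"
  assumes meas [measurable]: "\<And>i. i < n \<Longrightarrow> f i \<in> borel_measurable (sample_law n)"
    and fin: "\<And>i. i < n \<Longrightarrow> (\<integral>\<^sup>+ s. ennreal ((f i s)\<^sup>2) \<partial>sample_law n) < \<infinity>"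
    and cross: "\<And>i l s. i < n \<Longrightarrow> l < n \<Longrightarrow> i \<noteq> l \<Longrightarrow> (\<And>j. j < n \<Longrightarrow> j \<noteq> l \<Longrightarrow> s j \<in> space M) \<Longrightarrow>
      (\<integral> y. f i (s(l := y)) * f l (s(l := y)) \<partial>M) = 0"
  shows "(\<integral>\<^sup>+ s. ennreal ((\<Sum>i<n. f i s)\<^sup>2) \<partial>sample_law n) = (\<Sum>i<n. \<integral>\<^sup>+ s. ennreal ((f i s)\<^sup>2) \<partial>sample_law n)"
proof -
  have sq: "integrable (sample_law n) (\<lambda>s. (f i s)\<^sup>2)" if "i < n" for i
    using fin[OF that] that by (intro integrableI_bounded) auto
  have prod: "integrable (sample_law n) (\<lambda>s. f i s * f l s)" if "i < n" "l < n" for i l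
  proof (rule Bochner_Integration.integrable_bound[of _ "\<lambda>s. (f i s)\<^sup>2 + (f l s)\<^sup>2"])
    show "integrable (sample_law n) (\<lambda>s. (f i s)\<^sup>2 + (f l s)\<^sup>2)" using sq that by auto
    show "(\<lambda>s. f i s * f l s) \<in> borel_measurable (sample_law n)" using that by measurable
    have "\<bar>x * y\<bar> \<le> \<bar>x\<^sup>2 + y\<^sup>2\<bar>" for x y :: real
    proof -
      have "2 * (\<bar>x\<bar> * \<bar>y\<bar>) \<le> x\<^sup>2 + y\<^sup>2" using sum_squares_bound[of "\<bar>x\<bar>" "\<bar>y\<bar>"] by simp
      moreover have "0 \<le> \<bar>x\<bar> * \<bar>y\<bar>" by simp
      ultimately show ?thesis unfolding abs_mult by linarith
    qed
    then show "AE s in sample_law n. norm (f i s * f l s) \<le> norm ((f i s)\<^sup>2 + (f l s)\<^sup>2)"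
      by simp
  qed
  have zero: "(\<integral> s. f i s * f l s \<partial>sample_law n) = 0" if "i < n" "l < n" "i \<noteq> l" for i l
    using that by (intro integral_sample_law_eq_0[of l] prod cross) auto
  have expand: "(\<Sum>i<n. f i s)\<^sup>2 = (\<Sum>i<n. \<Sum>l<n. f i s * f l s)" for s
    by (simp add: power2_eq_square sum_product)
  have int: "integrable (sample_law n) (\<lambda>s. (\<Sum>i<n. f i s)\<^sup>2)"
    unfolding expand by (intro Bochner_Integration.integrable_sum prod) auto
  have "(\<integral> s. (\<Sum>i<n. f i s)\<^sup>2 \<partial>sample_law n) = (\<Sum>i<n. \<Sum>l<n. \<integral> s. f i s * f l s \<partial>sample_law n)"
  proof -
    have "(\<integral> s. (\<Sum>i<n. f i s)\<^sup>2 \<partial>sample_law n) = (\<Sum>i<n. \<integral> s. (\<Sum>l<n. f i s * f l s) \<partial>sample_law n)"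
      unfolding expand by (rule Bochner_Integration.integral_sum) (auto intro!: Bochner_Integration.integrable_sum prod)
    also have "\<dots> = (\<Sum>i<n. \<Sum>l<n. \<integral> s. f i s * f l s \<partial>sample_law n)"
      by (rule sum.cong[OF refl], rule Bochner_Integration.integral_sum) (auto intro!: prod)
    finally show ?thesis .
  qed
  also have "\<dots> = (\<Sum>i<n. \<Sum>l<n. if l = i then \<integral> s. (f i s)\<^sup>2 \<partial>sample_law n else 0)"
    by (intro sum.cong refl) (auto simp: zero power2_eq_square)
  also have "\<dots> = (\<Sum>i<n. \<integral> s. (f i s)\<^sup>2 \<partial>sample_law n)" by simp
  finally have eq: "(\<integral> s. (\<Sum>i<n. f i s)\<^sup>2 \<partial>sample_law n) = (\<Sum>i<n. \<integral> s. (f i s)\<^sup>2 \<partial>sample_law n)" .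
  have "(\<integral>\<^sup>+ s. ennreal ((\<Sum>i<n. f i s)\<^sup>2) \<partial>sample_law n) = ennreal (\<Sum>i<n. \<integral> s. (f i s)\<^sup>2 \<partial>sample_law n)"
    using nn_integral_eq_integral[OF int] eq by simp
  also have "\<dots> = (\<Sum>i<n. ennreal (\<integral> s. (f i s)\<^sup>2 \<partial>sample_law n))"
    by (rule sum_ennreal[symmetric]) simp
  also have "\<dots> = (\<Sum>i<n. \<integral>\<^sup>+ s. ennreal ((f i s)\<^sup>2) \<partial>sample_law n)"
    by (intro sum.cong refl nn_integral_eq_integral[symmetric] sq) auto
  finally show ?thesis .
qed

lemma nn_integral_sample_law_coordinate:
  fixes h :: "'a \<Rightarrow> ennreal"
  assumes "i < n" "h \<in> borel_measurable M"
  shows "(\<integral>\<^sup>+ s. h (s i) \<partial>sample_law n) = (\<integral>\<^sup>+ y. h y \<partial>M)"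
proof -
  have "distr (sample_law n) M (\<lambda>s. s i) = M"
    by (rule distr_PiM_component) (use assms(1) prob_space_axioms in auto)
  then show ?thesis
    using assms nn_integral_distr[of "\<lambda>s. s i" "sample_law n" M h] by simp
qed

end

lemma nn_integral_double_sum:
  fixes f :: "nat \<Rightarrow> nat \<Rightarrow> 'k \<Rightarrow> real"
  assumes "\<And>j w. j < p \<Longrightarrow> w < q \<Longrightarrow> f j w \<in> borel_measurable K" "\<And>j w s. 0 \<le> f j w s"
  shows "(\<integral>\<^sup>+ s. ennreal (\<Sum>j<p. \<Sum>w<q. f j w s) \<partial>K) = (\<Sum>j<p. \<Sum>w<q. \<integral>\<^sup>+ s. ennreal (f j w s) \<partial>K)"
proof -
  have "ennreal (\<Sum>j<p. \<Sum>w<q. f j w s) = (\<Sum>j<p. \<Sum>w<q. ennreal (f j w s))" for s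
    using assms(2) by (simp add: sum_ennreal sum_nonneg)
  then have "(\<integral>\<^sup>+ s. ennreal (\<Sum>j<p. \<Sum>w<q. f j w s) \<partial>K) = (\<integral>\<^sup>+ s. (\<Sum>j<p. \<Sum>w<q. ennreal (f j w s)) \<partial>K)"
    by simp
  also have "\<dots> = (\<Sum>j<p. \<integral>\<^sup>+ s. (\<Sum>w<q. ennreal (f j w s)) \<partial>K)"
    by (rule nn_integral_sum) (use assms(1) in \<open>auto intro!: borel_measurable_sum measurable_compose[OF _ measurable_ennreal]\<close>)
  also have "\<dots> = (\<Sum>j<p. \<Sum>w<q. \<integral>\<^sup>+ s. ennreal (f j w s) \<partial>K)"
    by (rule sum.cong[OF refl], rule nn_integral_sum) (use assms(1) in \<open>auto intro!: measurable_compose[OF _ measurable_ennreal]\<close>)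
  finally show ?thesis .
qed

section \<open>The law of one observation and three error statistics\<close>

definition spline_rows :: "(nat \<Rightarrow> real \<Rightarrow> real) \<Rightarrow> (nat \<Rightarrow> real) \<Rightarrow> nat \<Rightarrow> nat \<Rightarrow> real" where
  "spline_rows b \<tau> w i = b w (\<tau> i)"

text \<open>Independence and conditional moments are stated as integrals against arbitrary
  measurable functions, which is the form in which frozen coordinates deliver them. The Bochner
  integral of a non-integrable function is 0, so the mean conditions can be stated for all
  \<open>h\<close>; the second and fourth moments use nonnegative integrals and allow infinite
  values.\<close>

locale partially_linear_law = prob_space M for M :: "'d measure" +
  fixes N :: "'x measure" and xt :: "'d \<Rightarrow> 'x" and noise :: "'d \<Rightarrow> real" and tt :: "'x \<Rightarrow> real"
    and x :: "nat \<Rightarrow> 'x \<Rightarrow> real" and \<theta> :: "nat \<Rightarrow> real \<Rightarrow> real" and \<Xi> :: "nat \<Rightarrow> nat \<Rightarrow> real"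
    and p :: nat and v s4 :: real
  assumes xt_measurable [measurable]: "xt \<in> measurable M N"
    and noise_measurable [measurable]: "noise \<in> borel_measurable M"
    and tt_measurable [measurable]: "tt \<in> borel_measurable N"
    and x_measurable [measurable]: "\<And>j. j < p \<Longrightarrow> x j \<in> borel_measurable N"
    and \<theta>_measurable [measurable]: "\<And>j. j < p \<Longrightarrow> \<theta> j \<in> borel_measurable borel"
    and nonneg: "0 \<le> v" "0 \<le> s4"
    and noise_mean: "\<And>h. h \<in> borel_measurable N \<Longrightarrow> (\<integral> y. h (xt y) * noise y \<partial>M) = 0"
    and noise_var: "\<And>h :: 'x \<Rightarrow> real. h \<in> borel_measurable N \<Longrightarrow>
      (\<integral>\<^sup>+ y. ennreal ((h (xt y) * noise y)\<^sup>2) \<partial>M) \<le> ennreal v * (\<integral>\<^sup>+ y. ennreal ((h (xt y))\<^sup>2) \<partial>M)"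
    and resid_mean: "\<And>h j. j < p \<Longrightarrow> h \<in> borel_measurable borel \<Longrightarrow>
      (\<integral> y. h (tt (xt y)) * (x j (xt y) - \<theta> j (tt (xt y))) \<partial>M) = 0"
    and resid_fourth: "\<And>h j. j < p \<Longrightarrow> h \<in> borel_measurable borel \<Longrightarrow>
      (\<integral>\<^sup>+ y. ennreal ((h (tt (xt y)))\<^sup>2 * (x j (xt y) - \<theta> j (tt (xt y))) ^ 4) \<partial>M)
        \<le> ennreal s4 * (\<integral>\<^sup>+ y. ennreal ((h (tt (xt y)))\<^sup>2) \<partial>M)"
    and resid_cov: "\<And>j l. j < p \<Longrightarrow> l < p \<Longrightarrow>
      (\<integral> y. (x j (xt y) - \<theta> j (tt (xt y))) * (x l (xt y) - \<theta> l (tt (xt y))) \<partial>M) = \<Xi> j l"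
begin

definition resid :: "nat \<Rightarrow> 'd \<Rightarrow> real" where
  "resid j y = x j (xt y) - \<theta> j (tt (xt y))"

lemma resid_measurable [measurable]: "j < p \<Longrightarrow> resid j \<in> borel_measurable M"
  unfolding resid_def[abs_def] by measurable

text \<open>The bound \<open>u^2 \<le> 1 + u^4\<close> derives the second moment from the fourth.
  The weight \<open>h\<close> will be a Gram-Schmidt coordinate.\<close>

lemma resid_second:
  assumes j: "j < p" and h [measurable]: "h \<in> borel_measurable borel"
  shows "(\<integral>\<^sup>+ y. ennreal ((h (tt (xt y)) * resid j y)\<^sup>2) \<partial>M)
    \<le> ennreal (1 + s4) * (\<integral>\<^sup>+ y. ennreal ((h (tt (xt y)))\<^sup>2) \<partial>M)"
proof -
  have "u\<^sup>2 \<le> 1 + u ^ 4" for u :: real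
  proof -
    have "2 * u\<^sup>2 \<le> 1 + (u\<^sup>2)\<^sup>2" using sum_squares_bound[of 1 "u\<^sup>2"] by simp
    moreover have "u ^ 4 = (u\<^sup>2)\<^sup>2" "0 \<le> u\<^sup>2" by simp_all
    ultimately show ?thesis by linarith
  qed
  then have le: "(c * u)\<^sup>2 \<le> c\<^sup>2 + c\<^sup>2 * u ^ 4" for c u :: real
    using mult_left_mono[of "u\<^sup>2" "1 + u ^ 4" "c\<^sup>2"] by (simp add: power_mult_distrib algebra_simps)
  have "(\<integral>\<^sup>+ y. ennreal ((h (tt (xt y)) * resid j y)\<^sup>2) \<partial>M)
      \<le> (\<integral>\<^sup>+ y. ennreal ((h (tt (xt y)))\<^sup>2) + ennreal ((h (tt (xt y)))\<^sup>2 * resid j y ^ 4) \<partial>M)"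
    by (intro nn_integral_mono) (simp add: le ennreal_plus[symmetric] del: ennreal_plus)
  also have "\<dots> = (\<integral>\<^sup>+ y. ennreal ((h (tt (xt y)))\<^sup>2) \<partial>M) + (\<integral>\<^sup>+ y. ennreal ((h (tt (xt y)))\<^sup>2 * resid j y ^ 4) \<partial>M)"
    using j by (intro nn_integral_add) auto
  also have "\<dots> \<le> (\<integral>\<^sup>+ y. ennreal ((h (tt (xt y)))\<^sup>2) \<partial>M) + ennreal s4 * (\<integral>\<^sup>+ y. ennreal ((h (tt (xt y)))\<^sup>2) \<partial>M)"
    using resid_fourth[OF j h] by (intro add_left_mono) (simp add: resid_def)
  also have "\<dots> = ennreal (1 + s4) * (\<integral>\<^sup>+ y. ennreal ((h (tt (xt y)))\<^sup>2) \<partial>M)"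
    using nonneg by (simp add: ennreal_plus distrib_right)
  finally show ?thesis .
qed

lemma resid_second_const: "j < p \<Longrightarrow> (\<integral>\<^sup>+ y. ennreal ((resid j y)\<^sup>2) \<partial>M) \<le> ennreal (1 + s4)"
  using resid_second[of j "\<lambda>_. 1"] by (simp add: emeasure_space_1)

lemma resid_fourth_const: "j < p \<Longrightarrow> (\<integral>\<^sup>+ y. ennreal (resid j y ^ 4) \<partial>M) \<le> ennreal s4"
  using resid_fourth[of j "\<lambda>_. 1"] by (simp add: emeasure_space_1 resid_def)

lemma resid_product_second:
  assumes [simp]: "j < p" "l < p"
  shows "(\<integral>\<^sup>+ y. ennreal ((resid j y * resid l y)\<^sup>2) \<partial>M) \<le> ennreal s4"
proof -
  \<comment> \<open>The weight is \<open>1 / 2\<close>, as in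
    \<open>(a * b)^2 \<le> (a^4 + b^4) / 2\<close>.\<close>
  obtain c :: real where c: "0 \<le> c" "c + c = 1" by (rule that[of "1 / 2"]) simp_all
  have young: "(a * b)\<^sup>2 \<le> c * a ^ 4 + c * b ^ 4" for a b :: real
  proof -
    have "a ^ 4 = (a\<^sup>2)\<^sup>2" "b ^ 4 = (b\<^sup>2)\<^sup>2" by simp_all
    moreover have "c = 1 / 2" using c by simp
    ultimately show ?thesis
      unfolding \<open>c = 1 / 2\<close> using sum_squares_bound[of "a\<^sup>2" "b\<^sup>2"] by (simp add: power_mult_distrib)
  qed
  have "(\<integral>\<^sup>+ y. ennreal ((resid j y * resid l y)\<^sup>2) \<partial>M)
      \<le> (\<integral>\<^sup>+ y. ennreal c * ennreal (resid j y ^ 4) + ennreal c * ennreal (resid l y ^ 4) \<partial>M)"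
    using young c by (intro nn_integral_mono) (simp add: ennreal_mult[symmetric] ennreal_plus[symmetric] del: ennreal_plus)
  also have "\<dots> = ennreal c * (\<integral>\<^sup>+ y. ennreal (resid j y ^ 4) \<partial>M) + ennreal c * (\<integral>\<^sup>+ y. ennreal (resid l y ^ 4) \<partial>M)"
    by (simp add: nn_integral_add nn_integral_cmult)
  also have "\<dots> \<le> ennreal c * ennreal s4 + ennreal c * ennreal s4"
    by (intro add_mono mult_left_mono resid_fourth_const) auto
  also have "\<dots> = ennreal s4"
    using nonneg c by (simp add: distrib_right[symmetric] ennreal_plus[symmetric] del: ennreal_plus)
  finally show ?thesis .
qed

lemma component_measurable [measurable]: "i < n \<Longrightarrow> (\<lambda>s. s i) \<in> measurable (sample_law n) M"
  by (rule measurable_component_singleton) simp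

text \<open>The quantity \<open>F\<close> of \<open>residual_design_lower_bound\<close> as a
  function of the sample.\<close>

definition gram_error :: "nat \<Rightarrow> (nat \<Rightarrow> 'd) \<Rightarrow> real" where
  "gram_error n s = (\<Sum>j<p. \<Sum>l<p. ((\<Sum>i<n. resid j (s i) * resid l (s i)) - real n * \<Xi> j l)\<^sup>2)"

text \<open>Each of the \<open>p^2\<close> entries is a sum of \<open>n\<close> independent centered
  terms with variance at most \<open>s4\<close>.\<close>

lemma gram_error_moment:
  "(\<integral>\<^sup>+ s. ennreal (gram_error n s) \<partial>sample_law n) \<le> ennreal (real n * (real p)\<^sup>2 * s4)"
proof -
  have entry: "(\<integral>\<^sup>+ s. ennreal (((\<Sum>i<n. resid j (s i) * resid l (s i)) - real n * \<Xi> j l)\<^sup>2) \<partial>sample_law n)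
      \<le> ennreal (real n * s4)" if [simp]: "j < p" "l < p" for j l
  proof -
    define f where "f y = resid j y * resid l y - \<Xi> j l" for y
    have [measurable]: "f \<in> borel_measurable M" unfolding f_def[abs_def] by measurable
    have sq: "integrable M (\<lambda>y. (resid j y * resid l y)\<^sup>2)"
      using resid_product_second[of j l] by (intro integrableI_bounded) (auto simp: le_less_trans)
    have int: "integrable M (\<lambda>y. resid j y * resid l y)"
      by (rule square_integrable_imp_integrable[OF _ sq]) measurable
    have mean: "(\<integral> y. resid j y * resid l y \<partial>M) = \<Xi> j l"
      using resid_cov[of j l] by (simp add: resid_def)
    have f0: "(\<integral> y. f y \<partial>M) = 0" unfolding f_def using int mean by (simp add: prob_space)
    have fsq: "(f y)\<^sup>2 = (resid j y * resid l y)\<^sup>2 - 2 * \<Xi> j l * (resid j y * resid l y) + (\<Xi> j l)\<^sup>2" for y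
      by (simp add: f_def power2_eq_square algebra_simps)
    have "(\<integral> y. (f y)\<^sup>2 \<partial>M) = (\<integral> y. (resid j y * resid l y)\<^sup>2 \<partial>M) - 2 * \<Xi> j l * \<Xi> j l + (\<Xi> j l)\<^sup>2"
      unfolding fsq using sq int mean by (simp add: prob_space)
    also have "\<dots> \<le> (\<integral> y. (resid j y * resid l y)\<^sup>2 \<partial>M)"
      by (simp add: power2_eq_square)
    also have "\<dots> \<le> s4"
      using resid_product_second[of j l] nn_integral_eq_integral[OF sq] nonneg by (simp add: ennreal_le_iff)
    finally have "(\<integral> y. (f y)\<^sup>2 \<partial>M) \<le> s4" .
    moreover have "integrable M (\<lambda>y. (f y)\<^sup>2)" unfolding fsq using sq int by simp
    ultimately have f2: "(\<integral>\<^sup>+ y. ennreal ((f y)\<^sup>2) \<partial>M) \<le> ennreal s4"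
      by (simp add: nn_integral_eq_integral ennreal_leI)
    have coord: "(\<integral>\<^sup>+ s. ennreal ((f (s i))\<^sup>2) \<partial>sample_law n) \<le> ennreal s4" if "i < n" for i
      using nn_integral_sample_law_coordinate[OF that, of "\<lambda>y. ennreal ((f y)\<^sup>2)"] f2 by simp
    have "(\<integral>\<^sup>+ s. ennreal ((\<Sum>i<n. f (s i))\<^sup>2) \<partial>sample_law n) = (\<Sum>i<n. \<integral>\<^sup>+ s. ennreal ((f (s i))\<^sup>2) \<partial>sample_law n)"
    proof (rule second_moment_of_sum)
      show "(\<integral>\<^sup>+ s. ennreal ((f (s i))\<^sup>2) \<partial>sample_law n) < \<infinity>" if "i < n" for i
        using coord[OF that] by (auto simp: le_less_trans)
      show "(\<integral> y. f ((s(l := y)) i) * f ((s(l := y)) l) \<partial>M) = 0" if "i \<noteq> l" for i l and s :: "nat \<Rightarrow> 'd"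
        using that f0 by simp
    qed measurable
    also have "\<dots> \<le> (\<Sum>i<n. ennreal s4)" by (intro sum_mono coord) auto
    also have "\<dots> = ennreal (real n * s4)" using nonneg by (simp add: ennreal_of_nat_eq_real_of_nat ennreal_mult)
    also have "(\<lambda>s. \<Sum>i<n. f (s i)) = (\<lambda>s. (\<Sum>i<n. resid j (s i) * resid l (s i)) - real n * \<Xi> j l)"
      by (rule ext) (simp add: f_def sum_subtractf)
    finally show ?thesis by (simp add: fun_eq_iff f_def sum_subtractf)
  qed
  have "(\<integral>\<^sup>+ s. ennreal (gram_error n s) \<partial>sample_law n)
    = (\<Sum>j<p. \<Sum>l<p. \<integral>\<^sup>+ s. ennreal (((\<Sum>i<n. resid j (s i) * resid l (s i)) - real n * \<Xi> j l)\<^sup>2) \<partial>sample_law n)"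
    unfolding gram_error_def by (rule nn_integral_double_sum) auto
  also have "\<dots> \<le> (\<Sum>j<p. \<Sum>l<p. ennreal (real n * s4))"
    by (intro sum_mono entry) auto
  also have "\<dots> = ennreal (real n * (real p)\<^sup>2 * s4)"
    using nonneg by (simp add: ennreal_of_nat_eq_real_of_nat ennreal_mult[symmetric] power2_eq_square mult_ac)
  finally show ?thesis .
qed

text \<open>The quantity \<open>S\<close> of \<open>residual_design_lower_bound\<close> as a
  function of the sample.\<close>

definition projection_error :: "nat \<Rightarrow> (nat \<Rightarrow> real \<Rightarrow> real) \<Rightarrow> nat \<Rightarrow> (nat \<Rightarrow> 'd) \<Rightarrow> real" where
  "projection_error n b q s =
    (\<Sum>j<p. \<Sum>w<q. (dot n (\<lambda>i. resid j (s i)) (gs_dir n (spline_rows b (\<lambda>i. tt (xt (s i)))) w))\<^sup>2)"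

text \<open>A direction has norm at most 1 and depends on the points \<open>T\<close> alone. With
  all but the \<open>l\<close>-th observation frozen, a cross term is a function of that point times
  its centered residual, so it averages to zero. The diagonal terms add up to at most
  \<open>1 + s4\<close> for each of the \<open>p * q\<close> pairs, whatever \<open>n\<close>
  is.\<close>

lemma projection_error_moment:
  assumes b [measurable]: "\<And>w. w < q \<Longrightarrow> b w \<in> borel_measurable borel"
  shows "(\<integral>\<^sup>+ s. ennreal (projection_error n b q s) \<partial>sample_law n) \<le> ennreal (real p * real q * (1 + s4))"
proof -
  \<comment> \<open>Needed twice: as a function of the whole sample, and as a function of one
    replaced point with the other points frozen.\<close>
  have V_measurable: "(\<lambda>\<omega>. gs_dir n (spline_rows b (\<tau> \<omega>)) w i) \<in> borel_measurable K"
    if "\<And>i. i < n \<Longrightarrow> (\<lambda>\<omega>. \<tau> \<omega> i) \<in> borel_measurable K" "w < q" "i < n"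
    for \<tau> and K :: "'k measure" and w i
    by (rule gs_dir_measurable[where q=q])
       (use that measurable_compose[OF that(1) b] in \<open>auto simp: spline_rows_def\<close>)
  have entry: "(\<integral>\<^sup>+ s. ennreal ((dot n (\<lambda>i. resid j (s i)) (gs_dir n (spline_rows b (\<lambda>i. tt (xt (s i)))) w))\<^sup>2) \<partial>sample_law n)
      \<le> ennreal (1 + s4)" if j: "j < p" and w: "w < q" for j w
  proof -
    define V where "V \<tau> i = gs_dir n (spline_rows b \<tau>) w i" for \<tau> i
    define f where "f i s = V (\<lambda>i. tt (xt (s i))) i * resid j (s i)" for i and s :: "nat \<Rightarrow> 'd"
    have V_meas: "(\<lambda>s. V (\<lambda>i. tt (xt (s i))) i) \<in> borel_measurable (sample_law n)" if "i < n" for i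
      unfolding V_def by (rule V_measurable) (use that w in auto)
    have V_upd_meas: "(\<lambda>t. V (\<tau>(l := t)) i) \<in> borel_measurable borel" if "i < n" for i l \<tau>
      unfolding V_def by (rule V_measurable) (use that w in \<open>auto simp: fun_upd_def\<close>)
    have f_meas: "f i \<in> borel_measurable (sample_law n)" if "i < n" for i
      unfolding f_def[abs_def] using V_meas[OF that] that j by measurable
    have upd: "(\<lambda>i. tt (xt ((s(l := y)) i))) = (\<lambda>i. tt (xt (s i)))(l := tt (xt y))" for s l y
      by auto
    have f2: "(\<integral>\<^sup>+ s. ennreal ((f i s)\<^sup>2) \<partial>sample_law n)
        \<le> ennreal (1 + s4) * (\<integral>\<^sup>+ s. ennreal ((V (\<lambda>i. tt (xt (s i))) i)\<^sup>2) \<partial>sample_law n)" if i: "i < n" for i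
    proof -
      have "(\<integral>\<^sup>+ s. ennreal ((f i s)\<^sup>2) \<partial>sample_law n)
          \<le> (\<integral>\<^sup>+ s. ennreal (1 + s4) * ennreal ((V (\<lambda>i. tt (xt (s i))) i)\<^sup>2) \<partial>sample_law n)"
      proof (rule nn_integral_sample_law_coordinate_mono[OF i])
        show "(\<lambda>s. ennreal ((f i s)\<^sup>2)) \<in> borel_measurable (sample_law n)"
          using f_meas[OF i] by measurable
        show "(\<lambda>s. ennreal (1 + s4) * ennreal ((V (\<lambda>i. tt (xt (s i))) i)\<^sup>2)) \<in> borel_measurable (sample_law n)"
          using V_meas[OF i] by measurable
        fix s :: "nat \<Rightarrow> 'd"
        let ?h = "\<lambda>t. V ((\<lambda>i. tt (xt (s i)))(i := t)) i"
        have h [measurable]: "?h \<in> borel_measurable borel" by (rule V_upd_meas[OF i])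
        show "(\<integral>\<^sup>+ y. ennreal ((f i (s(i := y)))\<^sup>2) \<partial>M)
          \<le> (\<integral>\<^sup>+ y. ennreal (1 + s4) * ennreal ((V (\<lambda>l. tt (xt ((s(i := y)) l))) i)\<^sup>2) \<partial>M)"
          using resid_second[OF j h] unfolding f_def upd
          by (subst nn_integral_cmult) auto
      qed
      also have "\<dots> = ennreal (1 + s4) * (\<integral>\<^sup>+ s. ennreal ((V (\<lambda>i. tt (xt (s i))) i)\<^sup>2) \<partial>sample_law n)"
        using V_meas[OF i] by (intro nn_integral_cmult) measurable
      finally show ?thesis .
    qed
    have V_le: "(\<Sum>i<n. (V \<tau> i)\<^sup>2) \<le> 1" for \<tau>
      using gs_dir_self_le_1[of n "spline_rows b \<tau>" w] by (simp add: V_def dot_def power2_eq_square)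
    have V1: "(V \<tau> i)\<^sup>2 \<le> 1" if "i < n" for \<tau> i
      using member_le_sum[of i "{..<n}" "\<lambda>i. (V \<tau> i)\<^sup>2"] V_le[of \<tau>] that by auto
    interpret S: prob_space "sample_law n" by (rule prob_space_sample_law)
    have fin: "(\<integral>\<^sup>+ s. ennreal ((f i s)\<^sup>2) \<partial>sample_law n) < \<infinity>" if i: "i < n" for i
    proof -
      have "(\<integral>\<^sup>+ s. ennreal ((V (\<lambda>i. tt (xt (s i))) i)\<^sup>2) \<partial>sample_law n) \<le> (\<integral>\<^sup>+ s. 1 \<partial>sample_law n)"
        using V1[OF i] by (intro nn_integral_mono) (simp add: ennreal_le_1)
      then have "(\<integral>\<^sup>+ s. ennreal ((V (\<lambda>i. tt (xt (s i))) i)\<^sup>2) \<partial>sample_law n) \<le> 1"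
        by (simp add: S.emeasure_space_1)
      from order_trans[OF f2[OF i] mult_left_mono[OF this]] show ?thesis
        by (auto simp: le_less_trans)
    qed
    have "(\<integral>\<^sup>+ s. ennreal ((\<Sum>i<n. f i s)\<^sup>2) \<partial>sample_law n) = (\<Sum>i<n. \<integral>\<^sup>+ s. ennreal ((f i s)\<^sup>2) \<partial>sample_law n)"
    proof (rule second_moment_of_sum[OF f_meas fin])
      fix i l and s :: "nat \<Rightarrow> 'd" assume il: "i < n" "l < n" "i \<noteq> l"
      let ?h = "\<lambda>t. V ((\<lambda>i. tt (xt (s i)))(l := t)) i * resid j (s i) * V ((\<lambda>i. tt (xt (s i)))(l := t)) l"
      have "?h \<in> borel_measurable borel" by (intro borel_measurable_times V_upd_meas il) auto
      from resid_mean[OF j this]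
      show "(\<integral> y. f i (s(l := y)) * f l (s(l := y)) \<partial>M) = 0"
        using il unfolding f_def upd by (simp add: resid_def mult_ac)
    qed
    also have "\<dots> \<le> (\<Sum>i<n. ennreal (1 + s4) * (\<integral>\<^sup>+ s. ennreal ((V (\<lambda>i. tt (xt (s i))) i)\<^sup>2) \<partial>sample_law n))"
      by (intro sum_mono f2) auto
    also have "\<dots> = ennreal (1 + s4) * (\<integral>\<^sup>+ s. ennreal (\<Sum>i<n. (V (\<lambda>i. tt (xt (s i))) i)\<^sup>2) \<partial>sample_law n)"
    proof -
      have "(\<Sum>i<n. \<integral>\<^sup>+ s. ennreal ((V (\<lambda>i. tt (xt (s i))) i)\<^sup>2) \<partial>sample_law n)
          = (\<integral>\<^sup>+ s. (\<Sum>i<n. ennreal ((V (\<lambda>i. tt (xt (s i))) i)\<^sup>2)) \<partial>sample_law n)"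
        by (rule nn_integral_sum[symmetric]) (use V_meas in simp)
      then show ?thesis by (simp add: sum_distrib_left[symmetric] sum_ennreal)
    qed
    also have "\<dots> \<le> ennreal (1 + s4) * (\<integral>\<^sup>+ s. 1 \<partial>sample_law n)"
      using V_le by (intro mult_left_mono nn_integral_mono) (auto simp: ennreal_le_1)
    also have "\<dots> = ennreal (1 + s4)" by (simp add: S.emeasure_space_1)
    finally show ?thesis by (simp add: dot_def f_def V_def mult.commute)
  qed
  have meas: "(\<lambda>s. dot n (\<lambda>i. resid j (s i)) (gs_dir n (spline_rows b (\<lambda>i. tt (xt (s i)))) w)) \<in> borel_measurable (sample_law n)"
    if "j < p" "w < q" for j w
    unfolding dot_def using that by (intro borel_measurable_sum borel_measurable_times V_measurable) auto
  have "(\<integral>\<^sup>+ s. ennreal (projection_error n b q s) \<partial>sample_law n)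
    = (\<Sum>j<p. \<Sum>w<q. \<integral>\<^sup>+ s. ennreal ((dot n (\<lambda>i. resid j (s i)) (gs_dir n (spline_rows b (\<lambda>i. tt (xt (s i)))) w))\<^sup>2) \<partial>sample_law n)"
    unfolding projection_error_def by (rule nn_integral_double_sum) (use meas in auto)
  also have "\<dots> \<le> (\<Sum>j<p. \<Sum>w<q. ennreal (1 + s4))"
    by (intro sum_mono entry) auto
  also have "\<dots> = ennreal (real p * real q * (1 + s4))"
    using nonneg by (simp add: ennreal_of_nat_eq_real_of_nat ennreal_mult[symmetric] mult_ac del: ennreal_plus)
  finally show ?thesis .
qed

end

context partially_linear_law
begin

text \<open>The sum bounded by the hypothesis \<open>R\<close> of \<open>scad_error_bound\<close>,
  as a function of the sample.\<close>

definition noise_error :: "nat \<Rightarrow> (nat \<Rightarrow> real \<Rightarrow> real) \<Rightarrow> nat \<Rightarrow> (nat \<Rightarrow> 'd) \<Rightarrow> real" where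
  "noise_error n b q s = (\<Sum>j<p. (dot n (residual n (spline_rows b (\<lambda>i. tt (xt (s i)))) q (\<lambda>i. x j (xt (s i))))
     (\<lambda>i. noise (s i)))\<^sup>2)"

lemma spline_rows_measurable:
  assumes "\<And>w. w < q \<Longrightarrow> b w \<in> borel_measurable borel" "(\<lambda>\<omega>. \<tau> \<omega> i) \<in> borel_measurable K" "w < q"
  shows "(\<lambda>\<omega>. spline_rows b (\<tau> \<omega>) w i) \<in> borel_measurable K"
  unfolding spline_rows_def by (rule measurable_compose[OF assms(2) assms(1)[OF assms(3)]])

lemma design_residual_measurable:
  assumes "\<And>w. w < q \<Longrightarrow> b w \<in> borel_measurable borel" "\<And>i. i < n \<Longrightarrow> (\<lambda>\<omega>. u \<omega> i) \<in> measurable K N"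
    "j < p" "i < n"
  shows "(\<lambda>\<omega>. residual n (spline_rows b (\<lambda>i. tt (u \<omega> i))) q (\<lambda>i. x j (u \<omega> i)) i) \<in> borel_measurable K"
proof (rule residual_measurable[where q=q and w=q])
  show "(\<lambda>\<omega>. spline_rows b (\<lambda>i. tt (u \<omega> i)) w i) \<in> borel_measurable K" if "w < q" "i < n" for w i
    by (rule spline_rows_measurable[OF assms(1) measurable_compose[OF assms(2) tt_measurable]]) (use that in auto)
  show "(\<lambda>\<omega>. x j (u \<omega> i)) \<in> borel_measurable K" if "i < n" for i
    by (rule measurable_compose[OF assms(2)[OF that] x_measurable[OF assms(3)]])
qed (use assms(4) in auto)

text \<open>The weights now depend on all covariates, so the cross terms vanish by independence of
  the noise from the pair (X, T). Up to the variance, what remains is the expected squared norm of a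
  projected column. Comparison with the spline near \<open>\<theta> j\<close> bounds it by the
  residuals of that column plus the approximation error.\<close>

lemma noise_error_moment:
  assumes b: "\<And>w. w < q \<Longrightarrow> b w \<in> borel_measurable borel"
    and approx: "\<And>j. j < p \<Longrightarrow> \<exists>c. \<forall>t. \<bar>\<theta> j t - (\<Sum>w<q. c w * b w t)\<bar> \<le> \<eta>"
  shows "(\<integral>\<^sup>+ s. ennreal (noise_error n b q s) \<partial>sample_law n)
    \<le> ennreal (real p * (v * (2 * (real n * (1 + s4)) + 2 * (real n * \<eta>\<^sup>2))))"
proof -
  have entry: "(\<integral>\<^sup>+ s. ennreal ((dot n (residual n (spline_rows b (\<lambda>i. tt (xt (s i)))) q (\<lambda>i. x j (xt (s i))))
     (\<lambda>i. noise (s i)))\<^sup>2) \<partial>sample_law n) \<le> ennreal (v * (2 * (real n * (1 + s4)) + 2 * (real n * \<eta>\<^sup>2)))"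
    if j: "j < p" for j
  proof -
    define W where "W u i = residual n (spline_rows b (\<lambda>i. tt (u i))) q (\<lambda>i. x j (u i)) i" for u i
    define f where "f i s = W (\<lambda>i. xt (s i)) i * noise (s i)" for i and s :: "nat \<Rightarrow> 'd"
    have W_meas: "(\<lambda>s. W (\<lambda>i. xt (s i)) i) \<in> borel_measurable (sample_law n)" if "i < n" for i
      unfolding W_def by (rule design_residual_measurable) (use b j that in auto)
    have W_upd_meas: "(\<lambda>t. W (u(l := t)) i) \<in> borel_measurable N"
      if "i < n" "\<And>i. i < n \<Longrightarrow> i \<noteq> l \<Longrightarrow> u i \<in> space N" for i l u
    proof -
      \<comment> \<open>For \<open>i \<noteq> l\<close> this map is constant, and a constant is
        measurable only if its value lies in \<open>space N\<close>.\<close>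
      have "(\<lambda>t. (u(l := t)) i) \<in> measurable N N" if "i < n" for i
        by (cases "i = l") (use that \<open>\<And>i. i < n \<Longrightarrow> i \<noteq> l \<Longrightarrow> u i \<in> space N\<close> in auto)
      then show ?thesis
        unfolding W_def using \<open>i < n\<close> by (intro design_residual_measurable[where K=N] b j)
    qed
    have f_meas: "f i \<in> borel_measurable (sample_law n)" if "i < n" for i
      unfolding f_def[abs_def] using W_meas[OF that] that by measurable
    have upd: "(\<lambda>i. xt ((s(l := y)) i)) = (\<lambda>i. xt (s i))(l := xt y)" for s l y
      by auto
    have f2: "(\<integral>\<^sup>+ s. ennreal ((f i s)\<^sup>2) \<partial>sample_law n)
        \<le> ennreal v * (\<integral>\<^sup>+ s. ennreal ((W (\<lambda>i. xt (s i)) i)\<^sup>2) \<partial>sample_law n)" if i: "i < n" for i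
    proof -
      have "(\<integral>\<^sup>+ s. ennreal ((f i s)\<^sup>2) \<partial>sample_law n)
          \<le> (\<integral>\<^sup>+ s. ennreal v * ennreal ((W (\<lambda>i. xt (s i)) i)\<^sup>2) \<partial>sample_law n)"
      proof (rule nn_integral_sample_law_coordinate_mono[OF i])
        show "(\<lambda>s. ennreal ((f i s)\<^sup>2)) \<in> borel_measurable (sample_law n)"
          using f_meas[OF i] by measurable
        show "(\<lambda>s. ennreal v * ennreal ((W (\<lambda>i. xt (s i)) i)\<^sup>2)) \<in> borel_measurable (sample_law n)"
          using W_meas[OF i] by measurable
        fix s :: "nat \<Rightarrow> 'd" assume s: "\<And>l. l < n \<Longrightarrow> l \<noteq> i \<Longrightarrow> s l \<in> space M"
        let ?h = "\<lambda>t. W ((\<lambda>i. xt (s i))(i := t)) i"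
        have h [measurable]: "?h \<in> borel_measurable N"
          using W_upd_meas[OF i, of i "\<lambda>i. xt (s i)"] s measurable_space[OF xt_measurable] by blast
        show "(\<integral>\<^sup>+ y. ennreal ((f i (s(i := y)))\<^sup>2) \<partial>M)
          \<le> (\<integral>\<^sup>+ y. ennreal v * ennreal ((W (\<lambda>l. xt ((s(i := y)) l)) i)\<^sup>2) \<partial>M)"
          using noise_var[OF h] unfolding f_def upd
          by (subst nn_integral_cmult) auto
      qed
      also have "\<dots> = ennreal v * (\<integral>\<^sup>+ s. ennreal ((W (\<lambda>i. xt (s i)) i)\<^sup>2) \<partial>sample_law n)"
        using W_meas[OF i] by (intro nn_integral_cmult) measurable
      finally show ?thesis .
    qed
    obtain c where c: "\<And>t. \<bar>\<theta> j t - (\<Sum>w<q. c w * b w t)\<bar> \<le> \<eta>" using approx[OF j] by blast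
    have \<eta>0: "0 \<le> \<eta>" using c[of 0] by linarith
    have W_le: "(\<Sum>i<n. (W (\<lambda>i. xt (s i)) i)\<^sup>2) \<le> 2 * (\<Sum>i<n. (resid j (s i))\<^sup>2) + 2 * (real n * \<eta>\<^sup>2)" for s
    proof -
      let ?z = "spline_rows b (\<lambda>i. tt (xt (s i)))"
      \<comment> \<open>Subtracting the approximating spline leaves the regression residual plus an
        error of size at most \<open>\<eta>\<close>.\<close>
      let ?u = "\<lambda>i. x j (xt (s i)) - (\<Sum>w<q. c w * ?z w i)"
      have "(\<Sum>i<n. (W (\<lambda>i. xt (s i)) i)\<^sup>2) \<le> dot n ?u ?u"
        using residual_least_squares[of n ?z q "\<lambda>i. x j (xt (s i))" c]
        by (simp add: W_def dot_def power2_eq_square)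
      also have "\<dots> = (\<Sum>i<n. (?u i)\<^sup>2)" by (simp add: dot_def power2_eq_square)
      also have "\<dots> \<le> (\<Sum>i<n. 2 * (resid j (s i))\<^sup>2 + 2 * \<eta>\<^sup>2)"
      proof (rule sum_mono)
        fix i
        define r where "r = \<theta> j (tt (xt (s i))) - (\<Sum>w<q. c w * b w (tt (xt (s i))))"
        have "?u i = resid j (s i) + r" by (simp add: resid_def r_def spline_rows_def)
        moreover have "(resid j (s i) + r)\<^sup>2 \<le> 2 * (resid j (s i))\<^sup>2 + 2 * r\<^sup>2"
          using sum_squares_bound[of "resid j (s i)" r] by (simp add: power2_sum)
        moreover have "r\<^sup>2 \<le> \<eta>\<^sup>2" using power_mono[OF c[of "tt (xt (s i))"], of 2] by (simp add: r_def)
        ultimately show "(?u i)\<^sup>2 \<le> 2 * (resid j (s i))\<^sup>2 + 2 * \<eta>\<^sup>2" by simp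
      qed
      finally show ?thesis by (simp add: sum.distrib sum_distrib_left mult_ac)
    qed
    interpret S: prob_space "sample_law n" by (rule prob_space_sample_law)
    have W_total: "(\<integral>\<^sup>+ s. ennreal (\<Sum>i<n. (W (\<lambda>i. xt (s i)) i)\<^sup>2) \<partial>sample_law n)
        \<le> ennreal (2 * (real n * (1 + s4)) + 2 * (real n * \<eta>\<^sup>2))"
    proof -
      have "(\<integral>\<^sup>+ s. ennreal (\<Sum>i<n. (W (\<lambda>i. xt (s i)) i)\<^sup>2) \<partial>sample_law n)
          \<le> (\<integral>\<^sup>+ s. 2 * (\<Sum>i<n. ennreal ((resid j (s i))\<^sup>2)) + ennreal (2 * (real n * \<eta>\<^sup>2)) \<partial>sample_law n)"
      proof (rule nn_integral_mono)
        fix s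
        have "ennreal (\<Sum>i<n. (W (\<lambda>i. xt (s i)) i)\<^sup>2) \<le> ennreal (2 * (\<Sum>i<n. (resid j (s i))\<^sup>2) + 2 * (real n * \<eta>\<^sup>2))"
          by (rule ennreal_leI) (rule W_le)
        then show "ennreal (\<Sum>i<n. (W (\<lambda>i. xt (s i)) i)\<^sup>2) \<le> 2 * (\<Sum>i<n. ennreal ((resid j (s i))\<^sup>2)) + ennreal (2 * (real n * \<eta>\<^sup>2))"
          by (simp add: sum_ennreal ennreal_mult sum_nonneg)
      qed
      also have "\<dots> = 2 * (\<Sum>i<n. \<integral>\<^sup>+ s. ennreal ((resid j (s i))\<^sup>2) \<partial>sample_law n) + ennreal (2 * (real n * \<eta>\<^sup>2))"
        using j by (simp add: nn_integral_add nn_integral_cmult nn_integral_sum S.emeasure_space_1 del: sum_ennreal)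
      also have "\<dots> \<le> 2 * (\<Sum>i<n. ennreal (1 + s4)) + ennreal (2 * (real n * \<eta>\<^sup>2))"
      proof (intro add_right_mono mult_left_mono sum_mono)
        fix i assume "i \<in> {..<n}"
        then show "(\<integral>\<^sup>+ s. ennreal ((resid j (s i))\<^sup>2) \<partial>sample_law n) \<le> ennreal (1 + s4)"
          using nn_integral_sample_law_coordinate[of i n "\<lambda>y. ennreal ((resid j y)\<^sup>2)"] resid_second_const[OF j] j by simp
      qed simp
      also have "\<dots> = ennreal (2 * (real n * (1 + s4)) + 2 * (real n * \<eta>\<^sup>2))"
        using nonneg by (subst ennreal_plus) (simp_all add: ennreal_mult ennreal_of_nat_eq_real_of_nat del: ennreal_plus)
      finally show ?thesis .
    qed
    have W_single: "(\<integral>\<^sup>+ s. ennreal ((W (\<lambda>i. xt (s i)) i)\<^sup>2) \<partial>sample_law n) < \<infinity>" if i: "i < n" for i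
    proof -
      have "(\<integral>\<^sup>+ s. ennreal ((W (\<lambda>i. xt (s i)) i)\<^sup>2) \<partial>sample_law n)
          \<le> (\<integral>\<^sup>+ s. ennreal (\<Sum>i<n. (W (\<lambda>i. xt (s i)) i)\<^sup>2) \<partial>sample_law n)"
        using i by (intro nn_integral_mono ennreal_leI member_le_sum) auto
      also have "\<dots> < \<infinity>" using W_total by (auto simp: le_less_trans)
      finally show ?thesis .
    qed
    have fin: "(\<integral>\<^sup>+ s. ennreal ((f i s)\<^sup>2) \<partial>sample_law n) < \<infinity>" if i: "i < n" for i
      by (rule le_less_trans[OF f2[OF i]]) (use W_single[OF i] in \<open>simp add: ennreal_mult_less_top\<close>)
    have "(\<integral>\<^sup>+ s. ennreal ((\<Sum>i<n. f i s)\<^sup>2) \<partial>sample_law n) = (\<Sum>i<n. \<integral>\<^sup>+ s. ennreal ((f i s)\<^sup>2) \<partial>sample_law n)"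
    proof (rule second_moment_of_sum[OF f_meas fin])
      fix i l and s :: "nat \<Rightarrow> 'd" assume il: "i < n" "l < n" "i \<noteq> l" and s: "\<And>i. i < n \<Longrightarrow> i \<noteq> l \<Longrightarrow> s i \<in> space M"
      let ?h = "\<lambda>t. W ((\<lambda>i. xt (s i))(l := t)) i * noise (s i) * W ((\<lambda>i. xt (s i))(l := t)) l"
      have "\<And>i. i < n \<Longrightarrow> i \<noteq> l \<Longrightarrow> xt (s i) \<in> space N" using s measurable_space[OF xt_measurable] by blast
      then have "?h \<in> borel_measurable N" by (intro borel_measurable_times W_upd_meas il) auto
      from noise_mean[OF this]
      show "(\<integral> y. f i (s(l := y)) * f l (s(l := y)) \<partial>M) = 0"
        using il unfolding f_def upd by (simp add: mult_ac)
    qed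
    also have "\<dots> \<le> (\<Sum>i<n. ennreal v * (\<integral>\<^sup>+ s. ennreal ((W (\<lambda>i. xt (s i)) i)\<^sup>2) \<partial>sample_law n))"
      by (intro sum_mono f2) auto
    also have "\<dots> = ennreal v * (\<integral>\<^sup>+ s. ennreal (\<Sum>i<n. (W (\<lambda>i. xt (s i)) i)\<^sup>2) \<partial>sample_law n)"
    proof -
      have "(\<Sum>i<n. \<integral>\<^sup>+ s. ennreal ((W (\<lambda>i. xt (s i)) i)\<^sup>2) \<partial>sample_law n)
          = (\<integral>\<^sup>+ s. (\<Sum>i<n. ennreal ((W (\<lambda>i. xt (s i)) i)\<^sup>2)) \<partial>sample_law n)"
        by (rule nn_integral_sum[symmetric]) (use W_meas in simp)
      then show ?thesis by (simp add: sum_distrib_left[symmetric] sum_ennreal)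
    qed
    also have "\<dots> \<le> ennreal v * ennreal (2 * (real n * (1 + s4)) + 2 * (real n * \<eta>\<^sup>2))"
      by (intro mult_left_mono W_total) simp
    also have "\<dots> = ennreal (v * (2 * (real n * (1 + s4)) + 2 * (real n * \<eta>\<^sup>2)))"
      using nonneg by (intro ennreal_mult[symmetric]) auto
    finally show ?thesis by (simp add: dot_def f_def W_def)
  qed
  have meas: "(\<lambda>s. dot n (residual n (spline_rows b (\<lambda>i. tt (xt (s i)))) q (\<lambda>i. x j (xt (s i)))) (\<lambda>i. noise (s i)))
      \<in> borel_measurable (sample_law n)" if "j < p" for j
    unfolding dot_def using b that by (intro borel_measurable_sum borel_measurable_times design_residual_measurable) auto
  have "ennreal (noise_error n b q s) = (\<Sum>j<p. ennreal ((dot n (residual n (spline_rows b (\<lambda>i. tt (xt (s i)))) q (\<lambda>i. x j (xt (s i))))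
     (\<lambda>i. noise (s i)))\<^sup>2))" for s
    unfolding noise_error_def by (simp add: sum_ennreal)
  then have "(\<integral>\<^sup>+ s. ennreal (noise_error n b q s) \<partial>sample_law n)
    = (\<Sum>j<p. \<integral>\<^sup>+ s. ennreal ((dot n (residual n (spline_rows b (\<lambda>i. tt (xt (s i)))) q (\<lambda>i. x j (xt (s i))))
     (\<lambda>i. noise (s i)))\<^sup>2) \<partial>sample_law n)"
    by (simp only:) (rule nn_integral_sum, use meas in simp)
  also have "\<dots> \<le> (\<Sum>j<p. ennreal (v * (2 * (real n * (1 + s4)) + 2 * (real n * \<eta>\<^sup>2))))"
    by (intro sum_mono entry) auto
  also have "\<dots> = ennreal (real p * (v * (2 * (real n * (1 + s4)) + 2 * (real n * \<eta>\<^sup>2))))"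
    using nonneg by (simp add: ennreal_of_nat_eq_real_of_nat ennreal_mult[symmetric] del: ennreal_plus)
  finally show ?thesis .
qed

lemma gram_error_measurable: "gram_error n \<in> borel_measurable (sample_law n)"
  unfolding gram_error_def[abs_def]
  by (intro borel_measurable_sum borel_measurable_power borel_measurable_diff borel_measurable_times) auto

lemma projection_error_measurable:
  assumes b: "\<And>w. w < q \<Longrightarrow> b w \<in> borel_measurable borel"
  shows "projection_error n b q \<in> borel_measurable (sample_law n)"
  unfolding projection_error_def[abs_def] dot_def
  by (intro borel_measurable_sum borel_measurable_power borel_measurable_times gs_dir_measurable[where q=q]
      spline_rows_measurable[OF b]) auto

lemma noise_error_measurable:
  assumes b: "\<And>w. w < q \<Longrightarrow> b w \<in> borel_measurable borel"
  shows "noise_error n b q \<in> borel_measurable (sample_law n)"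
  unfolding noise_error_def[abs_def] dot_def
  using b by (intro borel_measurable_sum borel_measurable_power borel_measurable_times design_residual_measurable) auto

end

section \<open>Conditional moments in terms of unconditional ones\<close>

context prob_space
begin

lemma sigma_finite_subalgebra_sigma_of:
  assumes [measurable]: "T \<in> borel_measurable M"
  shows "sigma_finite_subalgebra M (sigma_of M T)"
proof (rule finite_measure_subalgebra_is_sigma_finite)
  have "sets (sigma_of M T) \<subseteq> sets M"
    by (subst sets_vimage_algebra2) auto
  then show "finite_measure_subalgebra M (sigma_of M T)"
    by (intro finite_measure_subalgebra.intro finite_measure_subalgebra_axioms.intro finite_measure_axioms)
       (simp add: subalgebra_def)
qed

lemma measurable_sigma_of: "h \<in> measurable borel K \<Longrightarrow> (\<lambda>\<omega>. h (T \<omega>)) \<in> measurable (sigma_of M T) K"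
  by (rule measurable_compose[OF measurable_vimage_algebra1]) auto

lemma cond_exp_cond_residual_eq_0:
  assumes [measurable]: "T \<in> borel_measurable M" and U: "integrable M U"
  shows "AE \<omega> in M. real_cond_exp M (sigma_of M T) (cond_residual M T U) \<omega> = 0"
proof -
  interpret sigma_finite_subalgebra M "sigma_of M T" by (rule sigma_finite_subalgebra_sigma_of) fact
  have "AE \<omega> in M. real_cond_exp M (sigma_of M T) (\<lambda>\<omega>. U \<omega> - real_cond_exp M (sigma_of M T) U \<omega>) \<omega>
      = real_cond_exp M (sigma_of M T) U \<omega> - real_cond_exp M (sigma_of M T) (real_cond_exp M (sigma_of M T) U) \<omega>"
    by (rule real_cond_exp_diff[OF U real_cond_exp_int(1)[OF U]])
  moreover have "AE \<omega> in M. real_cond_exp M (sigma_of M T) (real_cond_exp M (sigma_of M T) U) \<omega> = real_cond_exp M (sigma_of M T) U \<omega>"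
    by (rule real_cond_exp_F_meas[OF real_cond_exp_int(1)[OF U]]) simp
  ultimately show ?thesis unfolding cond_residual_def by auto
qed

lemma cond_residual_measurable [measurable]:
  "U \<in> borel_measurable M \<Longrightarrow> cond_residual M T U \<in> borel_measurable M"
  unfolding cond_residual_def[abs_def] by (intro borel_measurable_diff borel_measurable_cond_exp2) assumption

text \<open>\<open>Xi_matrix\<close> passes residuals to \<open>cond_cov\<close>, which centers its
  arguments once more; the second centering changes nothing almost everywhere.\<close>

lemma cond_residual_cond_residual:
  assumes "T \<in> borel_measurable M" "integrable M U"
  shows "AE \<omega> in M. cond_residual M T (cond_residual M T U) \<omega> = cond_residual M T U \<omega>"
  using cond_exp_cond_residual_eq_0[OF assms] unfolding cond_residual_def[of M T "cond_residual M T U"] by auto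

lemma regression_residual:
  assumes "AE \<omega> in M. real_cond_exp M (sigma_of M T) U \<omega> = \<theta> (T \<omega>)"
  shows "AE \<omega> in M. cond_residual M T U \<omega> = U \<omega> - \<theta> (T \<omega>)"
  using assms by eventually_elim (simp add: cond_residual_def)

lemma regression_residual_mean:
  assumes T [measurable]: "T \<in> borel_measurable M" and U: "integrable M U"
    and reg: "AE \<omega> in M. real_cond_exp M (sigma_of M T) U \<omega> = \<theta> (T \<omega>)"
    and [measurable]: "h \<in> borel_measurable borel" "\<theta> \<in> borel_measurable borel"
  shows "(\<integral> \<omega>. h (T \<omega>) * (U \<omega> - \<theta> (T \<omega>)) \<partial>M) = 0"
proof -
  interpret sigma_finite_subalgebra M "sigma_of M T" by (rule sigma_finite_subalgebra_sigma_of) fact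
  have [measurable]: "U \<in> borel_measurable M" using U by simp
  have eq: "(\<integral> \<omega>. h (T \<omega>) * (U \<omega> - \<theta> (T \<omega>)) \<partial>M) = (\<integral> \<omega>. h (T \<omega>) * cond_residual M T U \<omega> \<partial>M)"
    by (rule integral_cong_AE) (use regression_residual[OF reg] in auto)
  show ?thesis
  \<comment> \<open>Without integrability the integral is 0 by convention; otherwise the function of
    \<open>T\<close> is pulled out of the conditional expectation.\<close>
  proof (cases "integrable M (\<lambda>\<omega>. h (T \<omega>) * cond_residual M T U \<omega>)")
    case True
    have "AE \<omega> in M. real_cond_exp M (sigma_of M T) (\<lambda>\<omega>. h (T \<omega>) * cond_residual M T U \<omega>) \<omega>
        = h (T \<omega>) * real_cond_exp M (sigma_of M T) (cond_residual M T U) \<omega>"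
      by (rule real_cond_exp_mult[OF measurable_sigma_of _ True]) measurable
    then have "AE \<omega> in M. real_cond_exp M (sigma_of M T) (\<lambda>\<omega>. h (T \<omega>) * cond_residual M T U \<omega>) \<omega> = 0"
      using cond_exp_cond_residual_eq_0[OF T U] by eventually_elim simp
    then have "(\<integral> \<omega>. real_cond_exp M (sigma_of M T) (\<lambda>\<omega>. h (T \<omega>) * cond_residual M T U \<omega>) \<omega> \<partial>M) = 0"
      by (subst integral_cong_AE[where g="\<lambda>_. 0"]) auto
    then show ?thesis using real_cond_exp_int(2)[OF True] eq by simp
  qed (simp add: eq not_integrable_integral_eq)
qed

lemma regression_residual_fourth:
  assumes T [measurable]: "T \<in> borel_measurable M" and U: "integrable M U"
    and reg: "AE \<omega> in M. real_cond_exp M (sigma_of M T) U \<omega> = \<theta> (T \<omega>)"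
    and fourth: "AE \<omega> in M. nn_cond_exp M (sigma_of M T) (\<lambda>\<omega>'. ennreal (cond_residual M T U \<omega>' ^ 4)) \<omega> \<le> c"
    and [measurable]: "h \<in> borel_measurable borel" "\<theta> \<in> borel_measurable borel"
  shows "(\<integral>\<^sup>+ \<omega>. ennreal ((h (T \<omega>))\<^sup>2 * (U \<omega> - \<theta> (T \<omega>)) ^ 4) \<partial>M) \<le> c * (\<integral>\<^sup>+ \<omega>. ennreal ((h (T \<omega>))\<^sup>2) \<partial>M)"
proof -
  interpret sigma_finite_subalgebra M "sigma_of M T" by (rule sigma_finite_subalgebra_sigma_of) fact
  have [measurable]: "U \<in> borel_measurable M" using U by simp
  let ?E = "nn_cond_exp M (sigma_of M T) (\<lambda>\<omega>'. ennreal (cond_residual M T U \<omega>' ^ 4))"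
  have "(\<integral>\<^sup>+ \<omega>. ennreal ((h (T \<omega>))\<^sup>2 * (U \<omega> - \<theta> (T \<omega>)) ^ 4) \<partial>M)
      = (\<integral>\<^sup>+ \<omega>. ennreal ((h (T \<omega>))\<^sup>2) * ennreal (cond_residual M T U \<omega> ^ 4) \<partial>M)"
    using regression_residual[OF reg] by (intro nn_integral_cong_AE) (auto simp: ennreal_mult)
  also have "\<dots> = (\<integral>\<^sup>+ \<omega>. ennreal ((h (T \<omega>))\<^sup>2) * ?E \<omega> \<partial>M)"
  proof (rule nn_cond_exp_intg[symmetric])
    show "(\<lambda>\<omega>. ennreal ((h (T \<omega>))\<^sup>2)) \<in> borel_measurable (sigma_of M T)"
      by (rule measurable_sigma_of[where h="\<lambda>t. ennreal ((h t)\<^sup>2)"]) measurable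
  qed measurable
  also have "\<dots> \<le> (\<integral>\<^sup>+ \<omega>. c * ennreal ((h (T \<omega>))\<^sup>2) \<partial>M)"
    unfolding mult.commute[of c]
    by (rule nn_integral_mono_AE, use fourth in eventually_elim) (simp add: mult_left_mono)
  also have "\<dots> = c * (\<integral>\<^sup>+ \<omega>. ennreal ((h (T \<omega>))\<^sup>2) \<partial>M)"
    by (rule nn_integral_cmult) measurable
  finally show ?thesis .
qed

text \<open>The tower property removes the inner conditional expectation, which turns the expected
  conditional covariance into a plain second moment.\<close>

lemma Xi_matrix_entry:
  assumes T [measurable]: "T \<in> borel_measurable M"
    and U: "\<And>j. j < p \<Longrightarrow> integrable M (U j)"
    and reg: "\<And>j. j < p \<Longrightarrow> AE \<omega> in M. real_cond_exp M (sigma_of M T) (U j) \<omega> = \<theta> j (T \<omega>)"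
    and [measurable]: "\<And>j. j < p \<Longrightarrow> \<theta> j \<in> borel_measurable borel"
    and int: "integrable M (\<lambda>\<omega>. (U j \<omega> - \<theta> j (T \<omega>)) * (U l \<omega> - \<theta> l (T \<omega>)))"
    and jl: "j < p" "l < p"
  shows "Xi_matrix M p U T $$ (j, l) = (\<integral> \<omega>. (U j \<omega> - \<theta> j (T \<omega>)) * (U l \<omega> - \<theta> l (T \<omega>)) \<partial>M)"
proof -
  interpret sigma_finite_subalgebra M "sigma_of M T" by (rule sigma_finite_subalgebra_sigma_of) fact
  have [measurable]: "U j \<in> borel_measurable M" if "j < p" for j using U[OF that] by simp
  let ?r = "\<lambda>j. cond_residual M T (cond_residual M T (U j))"
  have r: "AE \<omega> in M. ?r j \<omega> = U j \<omega> - \<theta> j (T \<omega>)" if "j < p" for j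
    using cond_residual_cond_residual[OF T U[OF that]] regression_residual[OF reg[OF that]] by eventually_elim simp
  have ae: "AE \<omega> in M. ?r j \<omega> * ?r l \<omega> = (U j \<omega> - \<theta> j (T \<omega>)) * (U l \<omega> - \<theta> l (T \<omega>))"
    using r[OF jl(1)] r[OF jl(2)] by eventually_elim simp
  have "integrable M (\<lambda>\<omega>. ?r j \<omega> * ?r l \<omega>)"
    using int by (subst integrable_cong_AE[OF _ _ ae]) (use jl in measurable)
  then have "Xi_matrix M p U T $$ (j, l) = (\<integral> \<omega>. ?r j \<omega> * ?r l \<omega> \<partial>M)"
    unfolding Xi_matrix_def cond_cov_def using jl by (simp add: real_cond_exp_int(2))
  also have "\<dots> = (\<integral> \<omega>. (U j \<omega> - \<theta> j (T \<omega>)) * (U l \<omega> - \<theta> l (T \<omega>)) \<partial>M)"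
    by (rule integral_cong_AE[OF _ _ ae]) (use jl in measurable)
  finally show ?thesis .
qed

section \<open>Independence of noise and covariates as a product of laws\<close>

lemma independent_vars_distr_pair:
  assumes "independent_vars M B U A V"
  shows "distr M (A \<Otimes>\<^sub>M B) (\<lambda>\<omega>. (V \<omega>, U \<omega>)) = distr M A V \<Otimes>\<^sub>M distr M B U"
proof -
  have [measurable]: "U \<in> measurable M B" "V \<in> measurable M A"
    and ind: "indep_set {U -` A \<inter> space M | A. A \<in> sets B} {V -` A' \<inter> space M | A'. A' \<in> sets A}"
    using assms by (auto simp: independent_vars_def)
  interpret V: prob_space "distr M A V" by (rule prob_space_distr) measurable
  interpret U: prob_space "distr M B U" by (rule prob_space_distr) measurable
  show ?thesis
  proof (rule pair_measure_eqI[symmetric])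
    fix a b assume a: "a \<in> sets (distr M A V)" and b: "b \<in> sets (distr M B U)"
    then have [measurable]: "a \<in> sets A" "b \<in> sets B" by simp_all
    have "prob ((U -` b \<inter> space M) \<inter> (V -` a \<inter> space M)) = prob (U -` b \<inter> space M) * prob (V -` a \<inter> space M)"
      by (rule indep_setD[OF ind]) (use a b in auto)
    moreover have "(\<lambda>\<omega>. (V \<omega>, U \<omega>)) -` (a \<times> b) \<inter> space M = (U -` b \<inter> space M) \<inter> (V -` a \<inter> space M)"
      by auto
    ultimately show "emeasure (distr M A V) a * emeasure (distr M B U) b
        = emeasure (distr M (A \<Otimes>\<^sub>M B) (\<lambda>\<omega>. (V \<omega>, U \<omega>))) (a \<times> b)"
      by (simp add: emeasure_distr emeasure_eq_measure ennreal_mult[symmetric] mult.commute)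
  qed (unfold_locales, simp cong: sets_pair_measure_cong)
qed

lemma independent_vars_integral_eq_0:
  fixes U :: "'a \<Rightarrow> real"
  assumes ind: "independent_vars M borel U A V" and mean: "(\<integral> \<omega>. U \<omega> \<partial>M) = 0"
    and [measurable]: "h \<in> borel_measurable A"
  shows "(\<integral> \<omega>. h (V \<omega>) * U \<omega> \<partial>M) = 0"
proof -
  have [measurable]: "U \<in> borel_measurable M" "V \<in> measurable M A"
    using ind by (auto simp: independent_vars_def)
  interpret V: prob_space "distr M A V" by (rule prob_space_distr) measurable
  interpret U: prob_space "distr M borel U" by (rule prob_space_distr) measurable
  interpret pair_sigma_finite "distr M A V" "distr M borel U" ..
  let ?f = "\<lambda>y. h (fst y) * snd y"
  have "(\<integral> \<omega>. h (V \<omega>) * U \<omega> \<partial>M) = (\<integral> y. ?f y \<partial>distr M (A \<Otimes>\<^sub>M borel) (\<lambda>\<omega>. (V \<omega>, U \<omega>)))"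
    by (subst integral_distr) auto
  also have "\<dots> = (\<integral> y. ?f y \<partial>(distr M A V \<Otimes>\<^sub>M distr M borel U))"
    by (simp add: independent_vars_distr_pair[OF ind])
  also have "\<dots> = 0"
  \<comment> \<open>Again a non-integrable product has integral 0 by convention.\<close>
  proof (cases "integrable (distr M A V \<Otimes>\<^sub>M distr M borel U) ?f")
    case True
    have "(\<integral> u. u \<partial>distr M borel U) = 0" using mean by (subst integral_distr) auto
    then show ?thesis using integral_fst'[OF True] by simp
  qed (rule not_integrable_integral_eq)
  finally show ?thesis .
qed

lemma independent_vars_nn_integral_square:
  fixes U :: "'a \<Rightarrow> real" and h :: "'v \<Rightarrow> real"
  assumes ind: "independent_vars M borel U A V" and [measurable]: "h \<in> borel_measurable A"
  shows "(\<integral>\<^sup>+ \<omega>. ennreal ((h (V \<omega>) * U \<omega>)\<^sup>2) \<partial>M)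
    = (\<integral>\<^sup>+ \<omega>. ennreal ((U \<omega>)\<^sup>2) \<partial>M) * (\<integral>\<^sup>+ \<omega>. ennreal ((h (V \<omega>))\<^sup>2) \<partial>M)"
proof -
  have [measurable]: "U \<in> borel_measurable M" "V \<in> measurable M A"
    using ind by (auto simp: independent_vars_def)
  interpret V: prob_space "distr M A V" by (rule prob_space_distr) measurable
  interpret U: prob_space "distr M borel U" by (rule prob_space_distr) measurable
  let ?f = "\<lambda>y. ennreal ((h (fst y) * snd y)\<^sup>2)"
  have "(\<integral>\<^sup>+ \<omega>. ennreal ((h (V \<omega>) * U \<omega>)\<^sup>2) \<partial>M) = (\<integral>\<^sup>+ y. ?f y \<partial>distr M (A \<Otimes>\<^sub>M borel) (\<lambda>\<omega>. (V \<omega>, U \<omega>)))"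
    by (subst nn_integral_distr) auto
  also have "\<dots> = (\<integral>\<^sup>+ a. \<integral>\<^sup>+ u. ?f (a, u) \<partial>distr M borel U \<partial>distr M A V)"
    unfolding independent_vars_distr_pair[OF ind] by (rule U.nn_integral_fst[symmetric]) measurable
  also have "\<dots> = (\<integral>\<^sup>+ a. ennreal ((h a)\<^sup>2) * (\<integral>\<^sup>+ u. ennreal (u\<^sup>2) \<partial>distr M borel U) \<partial>distr M A V)"
    by (simp add: power_mult_distrib ennreal_mult nn_integral_cmult)
  also have "\<dots> = (\<integral>\<^sup>+ a. ennreal ((h a)\<^sup>2) \<partial>distr M A V) * (\<integral>\<^sup>+ u. ennreal (u\<^sup>2) \<partial>distr M borel U)"
    by (rule nn_integral_multc) measurable
  finally show ?thesis by (simp add: nn_integral_distr mult.commute)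
qed

end

section \<open>The law of an observation\<close>

text \<open>The regression functions and the splines are arbitrary off the unit interval. Cutting
  them off makes them Borel on the line without changing their values at the points
  \<open>T\<close>.\<close>

definition on_unit :: "(real \<Rightarrow> real) \<Rightarrow> real \<Rightarrow> real" where
  "on_unit f t = (if t \<in> {0..1} then f t else 0)"

lemma on_unit_measurable:
  assumes "continuous_on {0..1} f"
  shows "on_unit f \<in> borel_measurable borel"
proof -
  have "(\<lambda>t. if t \<in> {0..1} then f t else 0) \<in> borel_measurable borel"
    by (rule borel_measurable_continuous_on_if) (use assms in auto)
  then show ?thesis by (simp add: on_unit_def[abs_def])
qed

abbreviation obs_space :: "nat \<Rightarrow> ((nat \<Rightarrow> real) \<times> real \<times> real) measure" where
  "obs_space p \<equiv> rvec_space p \<Otimes>\<^sub>M borel \<Otimes>\<^sub>M borel"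

definition obs :: "nat \<Rightarrow> (nat \<Rightarrow> nat \<Rightarrow> 'a \<Rightarrow> real) \<Rightarrow> (nat \<Rightarrow> 'a \<Rightarrow> real) \<Rightarrow> (nat \<Rightarrow> 'a \<Rightarrow> real) \<Rightarrow>
    nat \<Rightarrow> 'a \<Rightarrow> (nat \<Rightarrow> real) \<times> real \<times> real" where
  "obs p X T Y i \<omega> = (rvec p (X i) \<omega>, T i \<omega>, Y i \<omega>)"

definition obs_covariates :: "(nat \<Rightarrow> real) \<times> real \<times> real \<Rightarrow> (nat \<Rightarrow> real) \<times> real" where
  "obs_covariates y = (fst y, fst (snd y))"

text \<open>The i.i.d. hypothesis is about the triples, not about the noise variables; recovering
  the noise from a triple makes it a function of the i.i.d. data.\<close>

definition obs_noise :: "nat \<Rightarrow> (nat \<Rightarrow> real) \<Rightarrow> (real \<Rightarrow> real) \<Rightarrow> (nat \<Rightarrow> real) \<times> real \<times> real \<Rightarrow> real" where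
  "obs_noise p \<beta> g y = snd (snd y) - (\<Sum>j<p. fst y j * \<beta> j) - on_unit g (fst (snd y))"

definition obs_law :: "'a measure \<Rightarrow> nat \<Rightarrow> (nat \<Rightarrow> nat \<Rightarrow> 'a \<Rightarrow> real) \<Rightarrow> (nat \<Rightarrow> 'a \<Rightarrow> real) \<Rightarrow>
    (nat \<Rightarrow> 'a \<Rightarrow> real) \<Rightarrow> ((nat \<Rightarrow> real) \<times> real \<times> real) measure" where
  "obs_law P p X T Y = distr P (obs_space p) (obs p X T Y 0)"

lemma (in prob_space) integrable_product_if_fourth_moments:
  fixes a b :: "'a \<Rightarrow> real"
  assumes [measurable]: "a \<in> borel_measurable M" "b \<in> borel_measurable M"
    and "(\<integral>\<^sup>+ \<omega>. ennreal (a \<omega> ^ 4) \<partial>M) < \<infinity>" "(\<integral>\<^sup>+ \<omega>. ennreal (b \<omega> ^ 4) \<partial>M) < \<infinity>"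
  shows "integrable M (\<lambda>\<omega>. a \<omega> * b \<omega>)"
proof (rule Bochner_Integration.integrable_bound[of _ "\<lambda>\<omega>. 2 + (a \<omega> ^ 4 + b \<omega> ^ 4)"])
  have "integrable M (\<lambda>\<omega>. a \<omega> ^ 4)" "integrable M (\<lambda>\<omega>. b \<omega> ^ 4)"
    using assms by (auto intro!: integrableI_bounded)
  then show "integrable M (\<lambda>\<omega>. 2 + (a \<omega> ^ 4 + b \<omega> ^ 4))" by simp
  have "\<bar>u * v\<bar> \<le> \<bar>2 + (u ^ 4 + v ^ 4)\<bar>" for u v :: real
  proof -
    have "2 * (\<bar>u\<bar> * \<bar>v\<bar>) \<le> u\<^sup>2 + v\<^sup>2" using sum_squares_bound[of "\<bar>u\<bar>" "\<bar>v\<bar>"] by simp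
    moreover have "2 * u\<^sup>2 \<le> 1 + u ^ 4" "2 * v\<^sup>2 \<le> 1 + v ^ 4"
      using sum_squares_bound[of 1 "u\<^sup>2"] sum_squares_bound[of 1 "v\<^sup>2"] by simp_all
    moreover have "0 \<le> \<bar>u\<bar> * \<bar>v\<bar>" "0 \<le> u ^ 4" "0 \<le> v ^ 4" by simp_all
    ultimately show ?thesis unfolding abs_mult by linarith
  qed
  then show "AE \<omega> in M. norm (a \<omega> * b \<omega>) \<le> norm (2 + (a \<omega> ^ 4 + b \<omega> ^ 4))" by simp
qed measurable

lemma partially_linear_sample_measurable:
  assumes "partially_linear_sample P n p X T Y \<epsilon> \<beta> g \<sigma>" "i < n"
  shows "obs p X T Y i \<in> measurable P (obs_space p)" "T i \<in> borel_measurable P"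
    "(\<lambda>\<omega>. (rvec p (X i) \<omega>, T i \<omega>)) \<in> measurable P (rvec_space p \<Otimes>\<^sub>M borel)"
proof -
  interpret prob_space P using assms by (simp add: partially_linear_sample_def)
  have "indep_vars (\<lambda>_. obs_space p) (\<lambda>i \<omega>. (rvec p (X i) \<omega>, T i \<omega>, Y i \<omega>)) {..<n}"
    using assms by (simp add: partially_linear_sample_def iid_vars_def)
  then show D: "obs p X T Y i \<in> measurable P (obs_space p)"
    using assms(2) by (simp add: indep_vars_def2 obs_def[abs_def])
  have "(\<lambda>\<omega>. fst (snd (obs p X T Y i \<omega>))) \<in> borel_measurable P"
    "(\<lambda>\<omega>. obs_covariates (obs p X T Y i \<omega>)) \<in> measurable P (rvec_space p \<Otimes>\<^sub>M borel)"
    unfolding obs_covariates_def using D by measurable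
  then show "T i \<in> borel_measurable P" "(\<lambda>\<omega>. (rvec p (X i) \<omega>, T i \<omega>)) \<in> measurable P (rvec_space p \<Otimes>\<^sub>M borel)"
    by (simp_all add: obs_def obs_covariates_def)
qed

text \<open>The bridge from the sample space to the product measure on which all moments were
  computed.\<close>

lemma distr_sample_eq_PiM:
  assumes sample: "partially_linear_sample P n p X T Y \<epsilon> \<beta> g \<sigma>" and n: "1 \<le> n"
  shows "distr P (\<Pi>\<^sub>M i\<in>{..<n}. obs_space p) (\<lambda>\<omega>. \<lambda>i\<in>{..<n}. obs p X T Y i \<omega>) = (\<Pi>\<^sub>M i\<in>{..<n}. obs_law P p X T Y)"
proof -
  interpret prob_space P using sample by (simp add: partially_linear_sample_def)
  have iid: "indep_vars (\<lambda>_. obs_space p) (obs p X T Y) {..<n}"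
    and ident: "\<And>i i'. i < n \<Longrightarrow> i' < n \<Longrightarrow> distr P (obs_space p) (obs p X T Y i) = distr P (obs_space p) (obs p X T Y i')"
    using sample unfolding partially_linear_sample_def iid_vars_def obs_def[abs_def] by blast+
  have "distr P (\<Pi>\<^sub>M i\<in>{..<n}. obs_space p) (\<lambda>\<omega>. \<lambda>i\<in>{..<n}. obs p X T Y i \<omega>)
      = (\<Pi>\<^sub>M i\<in>{..<n}. distr P (obs_space p) (obs p X T Y i))"
    using iid n partially_linear_sample_measurable(1)[OF sample]
    by (subst (asm) indep_vars_iff_distr_eq_PiM') (auto simp: lessThan_empty_iff)
  also have "\<dots> = (\<Pi>\<^sub>M i\<in>{..<n}. obs_law P p X T Y)"
    using n by (intro PiM_cong refl) (auto simp: obs_law_def intro!: ident)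
  finally show ?thesis .
qed

lemma partially_linear_law_obs_law:
  assumes sample: "partially_linear_sample P n p X T Y \<epsilon> \<beta> g \<sigma>" and n: "1 \<le> n"
    and g: "continuous_on {0..1} g" and \<theta>: "\<And>j. j < p \<Longrightarrow> continuous_on {0..1} (\<theta> j)"
    and int: "\<And>j. j < p \<Longrightarrow> integrable P (X 0 j)"
    and reg: "\<And>j. j < p \<Longrightarrow> AE \<omega> in P. real_cond_exp P (sigma_of P (T 0)) (X 0 j) \<omega> = \<theta> j (T 0 \<omega>)"
    and fourth: "\<And>j. j < p \<Longrightarrow> AE \<omega> in P. nn_cond_exp P (sigma_of P (T 0))
             (\<lambda>\<omega>'. ennreal (cond_residual P (T 0) (X 0 j) \<omega>' ^ 4)) \<omega> \<le> ennreal s"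
  shows "partially_linear_law (obs_law P p X T Y) (rvec_space p \<Otimes>\<^sub>M borel) obs_covariates (obs_noise p \<beta> g) snd
    (\<lambda>j u. fst u j) (\<lambda>j. on_unit (\<theta> j)) (\<lambda>j l. Xi_matrix P p (X 0) (T 0) $$ (j, l)) p (\<sigma>\<^sup>2) (max s 0)"
proof -
  interpret prob_space P using sample by (simp add: partially_linear_sample_def)
  have meas0: "obs p X T Y 0 \<in> measurable P (obs_space p)" "T 0 \<in> borel_measurable P"
    using partially_linear_sample_measurable[OF sample, of 0] n by simp_all
  note [measurable] = meas0 on_unit_measurable[OF g] on_unit_measurable[OF \<theta>]
  have T01: "T 0 \<omega> \<in> {0..1}" if "\<omega> \<in> space P" for \<omega>
    using sample n that by (auto simp: partially_linear_sample_def)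
  have Y0: "Y 0 \<omega> = (\<Sum>j<p. X 0 j \<omega> * \<beta> j) + g (T 0 \<omega>) + \<epsilon> 0 \<omega>" if "\<omega> \<in> space P" for \<omega>
    using sample n that by (auto simp: partially_linear_sample_def)
  have ind: "independent_vars P borel (\<epsilon> 0) (rvec_space p \<Otimes>\<^sub>M borel) (\<lambda>\<omega>. (rvec p (X 0) \<omega>, T 0 \<omega>))"
    and \<epsilon>: "(LINT \<omega>|P. \<epsilon> 0 \<omega>) = 0" "integrable P (\<lambda>\<omega>. (\<epsilon> 0 \<omega>)\<^sup>2)" "variance (\<epsilon> 0) = \<sigma>\<^sup>2"
    using sample n by (auto simp: partially_linear_sample_def)
  have cov: "obs_covariates (obs p X T Y 0 \<omega>) = (rvec p (X 0) \<omega>, T 0 \<omega>)" for \<omega>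
    by (simp add: obs_covariates_def obs_def)
  have noise: "obs_noise p \<beta> g (obs p X T Y 0 \<omega>) = \<epsilon> 0 \<omega>" if "\<omega> \<in> space P" for \<omega>
    using Y0[OF that] T01[OF that] by (simp add: obs_noise_def obs_def rvec_def on_unit_def)
  have cov_meas [measurable]: "obs_covariates \<in> measurable (obs_space p) (rvec_space p \<Otimes>\<^sub>M borel)"
    unfolding obs_covariates_def[abs_def] by measurable
  have coord [measurable]: "(\<lambda>u. fst u j) \<in> borel_measurable (rvec_space p \<Otimes>\<^sub>M borel)" if "j < p" for j
    using that by (intro measurable_compose[OF measurable_fst] measurable_component_singleton) auto
  have coord' [measurable]: "(\<lambda>y. fst y j) \<in> borel_measurable (obs_space p)" if "j < p" for j
    using that by (intro measurable_compose[OF measurable_fst] measurable_component_singleton) auto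
  have noise_meas [measurable]: "obs_noise p \<beta> g \<in> borel_measurable (obs_space p)"
    unfolding obs_noise_def[abs_def] by measurable
  have reg': "AE \<omega> in P. real_cond_exp P (sigma_of P (T 0)) (X 0 j) \<omega> = on_unit (\<theta> j) (T 0 \<omega>)" if "j < p" for j
  proof -
    have "AE \<omega> in P. T 0 \<omega> \<in> {0..1}" using T01 by simp
    with reg[OF that] show ?thesis by eventually_elim (simp add: on_unit_def)
  qed
  have X0: "X 0 j \<in> borel_measurable P" if "j < p" for j using int[OF that] by simp
  have fourth': "(\<integral>\<^sup>+ \<omega>. ennreal ((h (T 0 \<omega>))\<^sup>2 * (X 0 j \<omega> - on_unit (\<theta> j) (T 0 \<omega>)) ^ 4) \<partial>P)
      \<le> ennreal (max s 0) * (\<integral>\<^sup>+ \<omega>. ennreal ((h (T 0 \<omega>))\<^sup>2) \<partial>P)"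
    if "j < p" "h \<in> borel_measurable borel" for j and h :: "real \<Rightarrow> real"
  proof -
    \<comment> \<open>\<open>ennreal\<close> sends negative numbers to 0, so the nonnegative
      constant required by the locale loses nothing.\<close>
    have "ennreal s = ennreal (max s 0)" by (simp add: max_def ennreal_neg)
    then show ?thesis
      using regression_residual_fourth[OF meas0(2) int reg' fourth that(2) on_unit_measurable[OF \<theta>]] that by simp
  qed
  have prod_int: "integrable P (\<lambda>\<omega>. (X 0 j \<omega> - on_unit (\<theta> j) (T 0 \<omega>)) * (X 0 l \<omega> - on_unit (\<theta> l) (T 0 \<omega>)))"
    if "j < p" "l < p" for j l
  proof (rule integrable_product_if_fourth_moments)
    show "(\<lambda>\<omega>. X 0 j \<omega> - on_unit (\<theta> j) (T 0 \<omega>)) \<in> borel_measurable P" "(\<lambda>\<omega>. X 0 l \<omega> - on_unit (\<theta> l) (T 0 \<omega>)) \<in> borel_measurable P"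
      using X0 that by measurable
    have "(\<integral>\<^sup>+ \<omega>. ennreal ((X 0 j \<omega> - on_unit (\<theta> j) (T 0 \<omega>)) ^ 4) \<partial>P) < \<infinity>" if "j < p" for j
      using fourth'[OF that, of "\<lambda>_. 1"] by (auto simp: emeasure_space_1 le_less_trans)
    then show "(\<integral>\<^sup>+ \<omega>. ennreal ((X 0 j \<omega> - on_unit (\<theta> j) (T 0 \<omega>)) ^ 4) \<partial>P) < \<infinity>"
      "(\<integral>\<^sup>+ \<omega>. ennreal ((X 0 l \<omega> - on_unit (\<theta> l) (T 0 \<omega>)) ^ 4) \<partial>P) < \<infinity>"
      using that by blast+
  qed
  have sets_law: "sets (obs_law P p X T Y) = sets (obs_space p)" by (simp add: obs_law_def)
  interpret law: prob_space "obs_law P p X T Y"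
    unfolding obs_law_def by (rule prob_space_distr) (rule meas0)
  show ?thesis
  proof (unfold_locales)
    show "obs_covariates \<in> measurable (obs_law P p X T Y) (rvec_space p \<Otimes>\<^sub>M borel)"
      "obs_noise p \<beta> g \<in> borel_measurable (obs_law P p X T Y)"
      by (simp_all add: measurable_cong_sets[OF sets_law refl])
    show "snd \<in> borel_measurable (rvec_space p \<Otimes>\<^sub>M borel)" by measurable
    show "(\<lambda>u. fst u j) \<in> borel_measurable (rvec_space p \<Otimes>\<^sub>M borel)" if "j < p" for j
      using coord[OF that] .
    show "on_unit (\<theta> j) \<in> borel_measurable borel" if "j < p" for j
      by (rule on_unit_measurable[OF \<theta>[OF that]])
    show "0 \<le> \<sigma>\<^sup>2" "0 \<le> max s 0" by simp_all
  next
    fix h :: "(nat \<Rightarrow> real) \<times> real \<Rightarrow> real" assume h [measurable]: "h \<in> borel_measurable (rvec_space p \<Otimes>\<^sub>M borel)"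
    have "(\<integral> y. h (obs_covariates y) * obs_noise p \<beta> g y \<partial>obs_law P p X T Y)
        = (\<integral> \<omega>. h (obs_covariates (obs p X T Y 0 \<omega>)) * obs_noise p \<beta> g (obs p X T Y 0 \<omega>) \<partial>P)"
      unfolding obs_law_def by (rule integral_distr) measurable
    also have "\<dots> = (\<integral> \<omega>. h (rvec p (X 0) \<omega>, T 0 \<omega>) * \<epsilon> 0 \<omega> \<partial>P)"
      by (intro Bochner_Integration.integral_cong refl) (simp add: cov noise)
    also have "\<dots> = 0" by (rule independent_vars_integral_eq_0[OF ind \<epsilon>(1) h])
    finally show "(\<integral> y. h (obs_covariates y) * obs_noise p \<beta> g y \<partial>obs_law P p X T Y) = 0" .
    have "(\<integral>\<^sup>+ y. ennreal ((h (obs_covariates y) * obs_noise p \<beta> g y)\<^sup>2) \<partial>obs_law P p X T Y)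
        = (\<integral>\<^sup>+ \<omega>. ennreal ((h (obs_covariates (obs p X T Y 0 \<omega>)) * obs_noise p \<beta> g (obs p X T Y 0 \<omega>))\<^sup>2) \<partial>P)"
      unfolding obs_law_def by (rule nn_integral_distr) measurable
    also have "\<dots> = (\<integral>\<^sup>+ \<omega>. ennreal ((h (rvec p (X 0) \<omega>, T 0 \<omega>) * \<epsilon> 0 \<omega>)\<^sup>2) \<partial>P)"
      by (intro nn_integral_cong) (simp add: cov noise)
    also have "\<dots> = (\<integral>\<^sup>+ \<omega>. ennreal ((\<epsilon> 0 \<omega>)\<^sup>2) \<partial>P) * (\<integral>\<^sup>+ \<omega>. ennreal ((h (rvec p (X 0) \<omega>, T 0 \<omega>))\<^sup>2) \<partial>P)"
      by (rule independent_vars_nn_integral_square[OF ind h])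
    also have "(\<integral>\<^sup>+ \<omega>. ennreal ((\<epsilon> 0 \<omega>)\<^sup>2) \<partial>P) = ennreal (\<sigma>\<^sup>2)"
      using nn_integral_eq_integral[OF \<epsilon>(2)] \<epsilon>(1,3) by simp
    also have "(\<integral>\<^sup>+ \<omega>. ennreal ((h (rvec p (X 0) \<omega>, T 0 \<omega>))\<^sup>2) \<partial>P) = (\<integral>\<^sup>+ y. ennreal ((h (obs_covariates y))\<^sup>2) \<partial>obs_law P p X T Y)"
      unfolding obs_law_def by (subst nn_integral_distr) (auto simp: cov)
    finally show "(\<integral>\<^sup>+ y. ennreal ((h (obs_covariates y) * obs_noise p \<beta> g y)\<^sup>2) \<partial>obs_law P p X T Y)
        \<le> ennreal (\<sigma>\<^sup>2) * (\<integral>\<^sup>+ y. ennreal ((h (obs_covariates y))\<^sup>2) \<partial>obs_law P p X T Y)" by simp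
  next
    fix h :: "real \<Rightarrow> real" and j assume j: "j < p" and h [measurable]: "h \<in> borel_measurable borel"
    note [measurable] = coord[OF j] coord'[OF j] on_unit_measurable[OF \<theta>[OF j]]
    have "(\<integral> y. h (snd (obs_covariates y)) * (fst (obs_covariates y) j - on_unit (\<theta> j) (snd (obs_covariates y))) \<partial>obs_law P p X T Y)
      = (\<integral> \<omega>. h (T 0 \<omega>) * (X 0 j \<omega> - on_unit (\<theta> j) (T 0 \<omega>)) \<partial>P)"
      unfolding obs_law_def using j by (subst integral_distr) (auto simp: cov rvec_def)
    also have "\<dots> = 0"
      by (rule regression_residual_mean[OF meas0(2) int[OF j] reg'[OF j] h on_unit_measurable[OF \<theta>[OF j]]])
    finally show "(\<integral> y. h (snd (obs_covariates y)) * (fst (obs_covariates y) j - on_unit (\<theta> j) (snd (obs_covariates y))) \<partial>obs_law P p X T Y) = 0" .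
    have "(\<integral>\<^sup>+ y. ennreal ((h (snd (obs_covariates y)))\<^sup>2 * (fst (obs_covariates y) j - on_unit (\<theta> j) (snd (obs_covariates y))) ^ 4) \<partial>obs_law P p X T Y)
      = (\<integral>\<^sup>+ \<omega>. ennreal ((h (T 0 \<omega>))\<^sup>2 * (X 0 j \<omega> - on_unit (\<theta> j) (T 0 \<omega>)) ^ 4) \<partial>P)"
      unfolding obs_law_def using j by (subst nn_integral_distr) (auto simp: cov rvec_def)
    also have "\<dots> \<le> ennreal (max s 0) * (\<integral>\<^sup>+ \<omega>. ennreal ((h (T 0 \<omega>))\<^sup>2) \<partial>P)" by (rule fourth'[OF j h])
    also have "(\<integral>\<^sup>+ \<omega>. ennreal ((h (T 0 \<omega>))\<^sup>2) \<partial>P) = (\<integral>\<^sup>+ y. ennreal ((h (snd (obs_covariates y)))\<^sup>2) \<partial>obs_law P p X T Y)"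
      unfolding obs_law_def by (subst nn_integral_distr) (auto simp: cov)
    finally show "(\<integral>\<^sup>+ y. ennreal ((h (snd (obs_covariates y)))\<^sup>2 * (fst (obs_covariates y) j - on_unit (\<theta> j) (snd (obs_covariates y))) ^ 4) \<partial>obs_law P p X T Y)
      \<le> ennreal (max s 0) * (\<integral>\<^sup>+ y. ennreal ((h (snd (obs_covariates y)))\<^sup>2) \<partial>obs_law P p X T Y)" .
  next
    fix j l assume jl: "j < p" "l < p"
    note [measurable] = coord[OF jl(1)] coord[OF jl(2)] on_unit_measurable[OF \<theta>[OF jl(1)]] on_unit_measurable[OF \<theta>[OF jl(2)]]
    have "(\<integral> y. (fst (obs_covariates y) j - on_unit (\<theta> j) (snd (obs_covariates y))) *
        (fst (obs_covariates y) l - on_unit (\<theta> l) (snd (obs_covariates y))) \<partial>obs_law P p X T Y)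
      = (\<integral> \<omega>. (X 0 j \<omega> - on_unit (\<theta> j) (T 0 \<omega>)) * (X 0 l \<omega> - on_unit (\<theta> l) (T 0 \<omega>)) \<partial>P)"
      unfolding obs_law_def using jl by (subst integral_distr) (auto simp: cov rvec_def)
    also have "\<dots> = Xi_matrix P p (X 0) (T 0) $$ (j, l)"
      by (rule Xi_matrix_entry[OF meas0(2) int reg' on_unit_measurable[OF \<theta>] prod_int[OF jl] jl, symmetric])
    finally show "(\<integral> y. (fst (obs_covariates y) j - on_unit (\<theta> j) (snd (obs_covariates y))) *
        (fst (obs_covariates y) l - on_unit (\<theta> l) (snd (obs_covariates y))) \<partial>obs_law P p X T Y)
        = Xi_matrix P p (X 0) (T 0) $$ (j, l)" .
  qed
qed

section \<open>The finite-sample bound\<close>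

lemma knot_cells_cover:
  assumes "knot_partition K \<xi>" "t \<in> {0..1}"
  shows "\<exists>\<nu>\<le>K. t \<in> knot_cell K \<xi> \<nu>"
proof -
  define \<nu> where "\<nu> = (GREATEST \<nu>. \<nu> \<le> K \<and> \<xi> \<nu> \<le> t)"
  have "0 \<le> K \<and> \<xi> 0 \<le> t" using assms by (simp add: knot_partition_def)
  then have \<nu>: "\<nu> \<le> K \<and> \<xi> \<nu> \<le> t"
    unfolding \<nu>_def by (rule GreatestI_nat[where b=K]) simp
  have "t < \<xi> (Suc \<nu>)" if "\<nu> < K"
  proof (rule ccontr)
    assume "\<not> t < \<xi> (Suc \<nu>)"
    then have "Suc \<nu> \<le> \<nu>"
      unfolding \<nu>_def using that by (intro Greatest_le_nat[where b=K]) (auto simp: \<nu>_def[symmetric])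
    then show False by simp
  qed
  then have "t \<in> knot_cell K \<xi> \<nu>" using \<nu> assms(2) by (auto simp: knot_cell_def)
  then show ?thesis using \<nu> by blast
qed

text \<open>For \<open>m = 1\<close> a spline may jump at every knot, so measurability is glued
  together from the polynomial pieces on the cells.\<close>

lemma spline_measurable:
  assumes \<xi>: "knot_partition K \<xi>" and s: "s \<in> spline_space m K \<xi>"
  shows "on_unit s \<in> borel_measurable borel"
proof (rule measurable_piecewise_restrict[where C = "insert (- {0..1}) ((\<lambda>\<nu>. knot_cell K \<xi> \<nu> \<inter> {0..1}) ` {..K})"])
  show "space borel \<subseteq> \<Union> (insert (- {0..1}) ((\<lambda>\<nu>. knot_cell K \<xi> \<nu> \<inter> {0..1}) ` {..K}))"
    using knot_cells_cover[OF \<xi>] by fastforce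
  show "countable (insert (- {0..1}) ((\<lambda>\<nu>. knot_cell K \<xi> \<nu> \<inter> {0..1}) ` {..K}))" by simp
  fix \<Omega> assume "\<Omega> \<in> insert (- {0..1}) ((\<lambda>\<nu>. knot_cell K \<xi> \<nu> \<inter> {0..1}) ` {..K})"
  then consider "\<Omega> = - {0..1}" | \<nu> where "\<nu> \<le> K" "\<Omega> = knot_cell K \<xi> \<nu> \<inter> {0..1}" by auto
  then have "\<Omega> \<inter> space borel \<in> sets borel \<and> on_unit s \<in> borel_measurable (restrict_space borel \<Omega>)"
  proof cases
    case 1
    then have "on_unit s \<in> borel_measurable (restrict_space borel \<Omega>) \<longleftrightarrow> (\<lambda>_. 0 :: real) \<in> borel_measurable (restrict_space borel \<Omega>)"
      by (intro measurable_cong) (auto simp: space_restrict_space on_unit_def)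
    then show ?thesis using 1 by simp
  next
    case 2
    obtain q where q: "\<forall>t\<in>knot_cell K \<xi> \<nu>. s t = poly q t"
      using s 2(1) unfolding spline_space_def by blast
    have "on_unit s \<in> borel_measurable (restrict_space borel \<Omega>) \<longleftrightarrow> poly q \<in> borel_measurable (restrict_space borel \<Omega>)"
      using q 2 by (intro measurable_cong) (auto simp: space_restrict_space on_unit_def)
    moreover have "poly q \<in> borel_measurable borel"
      by (intro borel_measurable_continuous_onI continuous_intros)
    then have "poly q \<in> borel_measurable (restrict_space borel \<Omega>)" by (rule measurable_restrict_space1)
    ultimately show ?thesis using 2 by (simp add: knot_cell_def)
  qed
  then show "\<Omega> \<inter> space borel \<in> sets borel" "on_unit s \<in> borel_measurable (restrict_space borel \<Omega>)" by auto
qed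

text \<open>Markov's inequality.\<close>

lemma (in prob_space) prob_less_le_of_nn_integral:
  fixes f :: "'a \<Rightarrow> real"
  assumes [measurable]: "f \<in> borel_measurable M" and E: "(\<integral>\<^sup>+ \<omega>. ennreal (f \<omega>) \<partial>M) \<le> ennreal E" "0 \<le> E" and c: "0 < c"
  shows "prob {\<omega> \<in> space M. c < f \<omega>} \<le> E / c"
proof -
  let ?A = "{\<omega> \<in> space M. c < f \<omega>}"
  have "ennreal c * emeasure M ?A = (\<integral>\<^sup>+ \<omega>. ennreal c * indicator ?A \<omega> \<partial>M)"
    by (subst nn_integral_cmult_indicator) auto
  also have "\<dots> \<le> (\<integral>\<^sup>+ \<omega>. ennreal (f \<omega>) \<partial>M)"
    by (intro nn_integral_mono) (auto split: split_indicator intro: ennreal_leI)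
  also have "\<dots> \<le> ennreal E" by (rule E)
  finally have "ennreal (c * prob ?A) \<le> ennreal E"
    using c by (simp add: emeasure_eq_measure ennreal_mult)
  then show ?thesis using c E(2) by (simp add: field_simps)
qed

lemma Xi_matrix_sym: "j < p \<Longrightarrow> l < p \<Longrightarrow> Xi_matrix P p X T $$ (j, l) = Xi_matrix P p X T $$ (l, j)"
  by (simp add: Xi_matrix_def cond_cov_def mult.commute)

lemma scad_minimizer_cong:
  assumes "scad_minimizer n p q l a x z y bh ch"
    and "\<And>i j. i < n \<Longrightarrow> j < p \<Longrightarrow> x i j = x' i j" "\<And>i w. i < n \<Longrightarrow> w < q \<Longrightarrow> z i w = z' i w" "\<And>i. i < n \<Longrightarrow> y i = y' i"
  shows "scad_minimizer n p q l a x' z' y' bh ch"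
proof -
  have "scad_objective n p q l a x z y b c = scad_objective n p q l a x' z' y' b c" for b c
    unfolding scad_objective_def using assms(2-4) by (auto intro!: arg_cong[of _ _ "\<lambda>u. u\<^sup>2"] L2_set_cong)
  then show ?thesis using assms(1) by (simp add: scad_minimizer_def)
qed

text \<open>The three summands bound the probabilities that the Gram, projection or noise error
  exceeds its threshold. Off these events \<open>|Q X d|^2\<close> is at least
  \<open>\<mu> / 4 * n\<close> times the squared norm of \<open>d\<close>, so
  \<open>scad_error_bound\<close> applies with \<open>c = \<mu> / 4\<close>; this is the origin of
  the factors 16. \<open>K\<close> is left free to make the third summand small.\<close>

lemma scad_finite_sample:
  assumes sample: "partially_linear_sample P n p X T Y \<epsilon> \<beta> g \<sigma>" and n: "1 \<le> n" and p: "1 \<le> p" "k \<le> p"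
    and \<beta>: "\<And>j. k \<le> j \<Longrightarrow> j < p \<Longrightarrow> \<beta> j = 0" and al: "2 < a" "0 < l"
    and min: "\<And>\<omega>. \<omega> \<in> space P \<Longrightarrow> scad_minimizer n p q l a (\<lambda>i j. X i j \<omega>) (\<lambda>i w. B w (T i \<omega>)) (\<lambda>i. Y i \<omega>)
      (\<lambda>j. bhat j \<omega>) (\<lambda>w. ahat w \<omega>)"
    and B: "\<And>w. w < q \<Longrightarrow> on_unit (B w) \<in> borel_measurable borel"
    and g: "continuous_on {0..1} g" and \<theta>: "\<And>j. j < p \<Longrightarrow> continuous_on {0..1} (\<theta> j)"
    and int: "\<And>j. j < p \<Longrightarrow> integrable P (X 0 j)"
    and reg: "\<And>j. j < p \<Longrightarrow> AE \<omega> in P. real_cond_exp P (sigma_of P (T 0)) (X 0 j) \<omega> = \<theta> j (T 0 \<omega>)"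
    and fourth: "\<And>j. j < p \<Longrightarrow> AE \<omega> in P. nn_cond_exp P (sigma_of P (T 0))
             (\<lambda>\<omega>'. ennreal (cond_residual P (T 0) (X 0 j) \<omega>' ^ 4)) \<omega> \<le> ennreal s4"
    and g_approx: "\<And>t. t \<in> {0..1} \<Longrightarrow> \<bar>g t - (\<Sum>w<q. cg w * B w t)\<bar> \<le> \<eta>g"
    and \<theta>_approx: "\<And>j. j < p \<Longrightarrow> \<exists>c. \<forall>t\<in>{0..1}. \<bar>\<theta> j t - (\<Sum>w<q. c w * B w t)\<bar> \<le> \<eta>"
    and \<mu>: "\<mu> \<le> lambda_min (Xi_matrix P p (X 0) (T 0))" "0 < \<mu>"
    and small: "real p * \<eta>\<^sup>2 \<le> \<mu> / 8" and K: "0 < K"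
  defines "d \<equiv> \<lambda>\<omega> j. bhat j \<omega> - \<beta> j"
  shows "measure P {\<omega> \<in> space P. (16 / \<mu>) * (2 * \<eta>g\<^sup>2 + 16 * K * real p / (\<mu> * real n) + real k * ((a + 1) * l\<^sup>2 / 2))
        < dot p (d \<omega>) (d \<omega>)}
    \<le> real n * (real p)\<^sup>2 * max s4 0 / (real n * \<mu> / 8)\<^sup>2 + real p * real q * (1 + max s4 0) / (real n * \<mu> / 8)
      + real p * (\<sigma>\<^sup>2 * (2 * (real n * (1 + max s4 0)) + 2 * (real n * \<eta>\<^sup>2))) / (K * real p * real n)"
proof -
  interpret prob_space P using sample by (simp add: partially_linear_sample_def)
  interpret L: partially_linear_law "obs_law P p X T Y" "rvec_space p \<Otimes>\<^sub>M borel" obs_covariates "obs_noise p \<beta> g" snd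
    "\<lambda>j u. fst u j" "\<lambda>j. on_unit (\<theta> j)" "\<lambda>j l. Xi_matrix P p (X 0) (T 0) $$ (j, l)" p "\<sigma>\<^sup>2" "max s4 0"
    by (rule partially_linear_law_obs_law[OF sample n g \<theta> int reg fourth])
  define b where "b w = on_unit (B w)" for w
  have b_meas: "b w \<in> borel_measurable borel" if "w < q" for w using B[OF that] by (simp add: b_def)
  define S where "S \<omega> = (\<lambda>i\<in>{..<n}. obs p X T Y i \<omega>)" for \<omega>
  have S_meas: "S \<in> measurable P (\<Pi>\<^sub>M i\<in>{..<n}. obs_space p)"
    unfolding S_def[abs_def] using partially_linear_sample_measurable(1)[OF sample] by (intro measurable_restrict) auto
  have law: "L.sample_law n = distr P (\<Pi>\<^sub>M i\<in>{..<n}. obs_space p) S"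
    using distr_sample_eq_PiM[OF sample n] by (simp add: S_def[abs_def])
  \<comment> \<open>Markov's inequality on the original space, with the moment taken from the
    product measure.\<close>
  have tail: "{\<omega> \<in> space P. c < \<Phi> (S \<omega>)} \<in> sets P \<and> prob {\<omega> \<in> space P. c < \<Phi> (S \<omega>)} \<le> E / c"
    if \<Phi>: "\<Phi> \<in> borel_measurable (L.sample_law n)" and E: "(\<integral>\<^sup>+ s. ennreal (\<Phi> s) \<partial>L.sample_law n) \<le> ennreal E" "0 \<le> E"
      and c: "0 < c" for \<Phi> :: "_ \<Rightarrow> real" and E c
  proof -
    have \<Phi>': "\<Phi> \<in> borel_measurable (\<Pi>\<^sub>M i\<in>{..<n}. obs_space p)" using \<Phi> unfolding law by simp
    have "(\<lambda>\<omega>. \<Phi> (S \<omega>)) \<in> borel_measurable P" by (rule measurable_compose[OF S_meas \<Phi>'])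
    moreover have "(\<integral>\<^sup>+ \<omega>. ennreal (\<Phi> (S \<omega>)) \<partial>P) \<le> ennreal E"
      using E(1) unfolding law by (subst (asm) nn_integral_distr[OF S_meas]) (use \<Phi>' in auto)
    ultimately show ?thesis using prob_less_le_of_nn_integral[of "\<lambda>\<omega>. \<Phi> (S \<omega>)" E c] E(2) c by auto
  qed
  have \<eta>0: "0 \<le> \<eta>"
  proof -
    obtain c where "\<forall>t\<in>{0..1}. \<bar>\<theta> 0 t - (\<Sum>w<q. c w * B w t)\<bar> \<le> \<eta>" using \<theta>_approx[of 0] p by auto
    then show ?thesis by (meson abs_ge_zero atLeastAtMost_iff order_refl order_trans zero_le_one)
  qed
  have approx: "\<exists>c. \<forall>t. \<bar>on_unit (\<theta> j) t - (\<Sum>w<q. c w * b w t)\<bar> \<le> \<eta>" if j: "j < p" for j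
  proof -
    obtain c where c: "\<forall>t\<in>{0..1}. \<bar>\<theta> j t - (\<Sum>w<q. c w * B w t)\<bar> \<le> \<eta>" using \<theta>_approx[OF j] by blast
    have "\<bar>on_unit (\<theta> j) t - (\<Sum>w<q. c w * b w t)\<bar> \<le> \<eta>" for t
      using c \<eta>0 by (cases "t \<in> {0..1}") (auto simp: on_unit_def b_def)
    then show ?thesis by blast
  qed
  define cs where "cs j = (SOME c. \<forall>t. \<bar>on_unit (\<theta> j) t - (\<Sum>w<q. c w * b w t)\<bar> \<le> \<eta>)" for j
  have cs: "\<bar>on_unit (\<theta> j) t - (\<Sum>w<q. cs j w * b w t)\<bar> \<le> \<eta>" if "j < p" for j t
    using someI_ex[OF approx[OF that]] by (simp add: cs_def)
  \<comment> \<open>With this threshold for both errors, half of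
    \<open>n * \<mu> - 2 * \<tau>\<close> is \<open>3/8 * n * \<mu>\<close>. The bias takes at most
    another \<open>1/8\<close>, and \<open>n * \<mu> / 4\<close> is left.\<close>
  define \<tau> where "\<tau> = real n * \<mu> / 8"
  have \<tau>: "0 < \<tau>" using n \<mu> by (simp add: \<tau>_def)
  define \<rho> where "\<rho> = K * real p * real n"
  have \<rho>: "0 < \<rho>" using n p K by (simp add: \<rho>_def)
  define E1 E2 E3 where "E1 = {\<omega> \<in> space P. \<tau>\<^sup>2 < L.gram_error n (S \<omega>)}"
    and "E2 = {\<omega> \<in> space P. \<tau> < L.projection_error n b q (S \<omega>)}"
    and "E3 = {\<omega> \<in> space P. \<rho> < L.noise_error n b q (S \<omega>)}"
  have e1: "E1 \<in> sets P \<and> prob E1 \<le> real n * (real p)\<^sup>2 * max s4 0 / \<tau>\<^sup>2"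
    unfolding E1_def using \<tau> by (intro tail L.gram_error_measurable L.gram_error_moment) auto
  have e2: "E2 \<in> sets P \<and> prob E2 \<le> real p * real q * (1 + max s4 0) / \<tau>"
    unfolding E2_def using \<tau> b_meas by (intro tail L.projection_error_measurable L.projection_error_moment) auto
  have e3: "E3 \<in> sets P \<and> prob E3 \<le> real p * (\<sigma>\<^sup>2 * (2 * (real n * (1 + max s4 0)) + 2 * (real n * \<eta>\<^sup>2))) / \<rho>"
    unfolding E3_def using \<rho> b_meas approx by (intro tail L.noise_error_measurable L.noise_error_moment) auto
  let ?bound = "(16 / \<mu>) * (2 * \<eta>g\<^sup>2 + 16 * K * real p / (\<mu> * real n) + real k * ((a + 1) * l\<^sup>2 / 2))"
  \<comment> \<open>From here on the sample is fixed, and only deterministic inequalities are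
    used.\<close>
  have good: "dot p (d \<omega>) (d \<omega>) \<le> ?bound" if \<omega>: "\<omega> \<in> space P" "\<omega> \<notin> E1" "\<omega> \<notin> E2" "\<omega> \<notin> E3" for \<omega>
  proof -
    define t where "t i = snd (obs_covariates (S \<omega> i))" for i
    define x where "x i j = fst (obs_covariates (S \<omega> i)) j" for i j
    define z where "z i w = spline_rows b t w i" for i w
    have T01: "T i \<omega> \<in> {0..1}" if "i < n" for i
      using sample that \<omega>(1) by (auto simp: partially_linear_sample_def)
    have t: "t i = T i \<omega>" if "i < n" for i using that by (simp add: t_def S_def obs_def obs_covariates_def)
    have x: "x i j = X i j \<omega>" if "i < n" "j < p" for i j
      using that by (simp add: x_def S_def obs_def obs_covariates_def rvec_def)
    have z: "z i w = B w (T i \<omega>)" if "i < n" for i w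
      using T01[OF that] by (simp add: z_def spline_rows_def t[OF that] b_def on_unit_def)
    have rows: "(\<lambda>w i. z i w) = spline_rows b (\<lambda>i. snd (obs_covariates (S \<omega> i)))"
      by (simp add: z_def t_def[abs_def])
    define f where "f i = (\<Sum>j<p. (bhat j \<omega> - \<beta> j) * x i j)" for i
    have quad: "\<mu> * dot p (d \<omega>) (d \<omega>) \<le> (\<Sum>j<p. \<Sum>l<p. d \<omega> j * d \<omega> l * Xi_matrix P p (X 0) (T 0) $$ (j, l))"
    proof -
      have "\<mu> * dot p (d \<omega>) (d \<omega>) \<le> lambda_min (Xi_matrix P p (X 0) (T 0)) * dot p (d \<omega>) (d \<omega>)"
        by (intro mult_right_mono \<mu>) simp
      also have "\<dots> \<le> quad_form (Xi_matrix P p (X 0) (T 0)) p (d \<omega>) (d \<omega>)"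
        using p by (intro lambda_min_le_quad_form Xi_matrix_sym) (auto simp: Xi_matrix_def)
      finally show ?thesis by (simp add: quad_form_def)
    qed
    have "((real n * \<mu> - sqrt (L.gram_error n (S \<omega>)) - L.projection_error n b q (S \<omega>)) / 2 - real n * real p * \<eta>\<^sup>2) * dot p (d \<omega>) (d \<omega>)
        \<le> dot n (residual n (\<lambda>w i. z i w) q f) (residual n (\<lambda>w i. z i w) q f)"
      using residual_design_lower_bound[where n=n and p=p and x=x and th="\<lambda>i j. on_unit (\<theta> j) (t i)"
          and e="\<lambda>i j. L.resid j (S \<omega> i)" and q=q and cs=cs and z=z and \<eta>=\<eta> and \<mu>=\<mu> and d="d \<omega>"
          and \<Xi>="\<lambda>j l. Xi_matrix P p (X 0) (T 0) $$ (j, l)"] cs quad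
      unfolding rows L.gram_error_def L.projection_error_def f_def[abs_def] d_def
      by (simp add: L.resid_def x_def t_def z_def spline_rows_def)
    moreover have "\<mu> / 4 * real n * dot p (d \<omega>) (d \<omega>)
        \<le> ((real n * \<mu> - sqrt (L.gram_error n (S \<omega>)) - L.projection_error n b q (S \<omega>)) / 2 - real n * real p * \<eta>\<^sup>2) * dot p (d \<omega>) (d \<omega>)"
    proof (rule mult_right_mono)
      have "L.gram_error n (S \<omega>) \<le> \<tau>\<^sup>2" using \<omega> by (auto simp: E1_def not_less)
      then have "sqrt (L.gram_error n (S \<omega>)) \<le> \<tau>" using \<tau> by (simp add: real_le_lsqrt)
      moreover have "L.projection_error n b q (S \<omega>) \<le> \<tau>" using \<omega> by (auto simp: E2_def not_less)
      moreover have "real n * (real p * \<eta>\<^sup>2) \<le> real n * (\<mu> / 8)" using small by (intro mult_left_mono) auto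
      ultimately show "\<mu> / 4 * real n \<le> (real n * \<mu> - sqrt (L.gram_error n (S \<omega>)) - L.projection_error n b q (S \<omega>)) / 2 - real n * real p * \<eta>\<^sup>2"
        by (simp add: \<tau>_def field_simps)
    qed simp
    ultimately have low: "\<mu> / 4 * real n * dot p (d \<omega>) (d \<omega>) \<le> dot n (residual n (\<lambda>w i. z i w) q f) (residual n (\<lambda>w i. z i w) q f)"
      by simp
    have noise: "(\<Sum>j<p. (dot n (residual n (\<lambda>w i. z i w) q (\<lambda>i. x i j)) (\<lambda>i. obs_noise p \<beta> g (S \<omega> i)))\<^sup>2) \<le> K * real p * real n"
    proof -
      have "L.noise_error n b q (S \<omega>) \<le> \<rho>" using \<omega> by (auto simp: E3_def not_less)
      then show ?thesis unfolding L.noise_error_def rows x_def \<rho>_def .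
    qed
    have "dot p (\<lambda>j. bhat j \<omega> - \<beta> j) (\<lambda>j. bhat j \<omega> - \<beta> j)
        \<le> 4 / (\<mu> / 4) * (2 * \<eta>g\<^sup>2 + 4 * (K * real p) / (\<mu> / 4 * real n) + real k * ((a + 1) * l\<^sup>2 / 2))"
    proof (rule scad_error_bound[where g="\<lambda>i. on_unit g (t i)" and \<epsilon>="\<lambda>i. obs_noise p \<beta> g (S \<omega> i)" and cg=cg])
      show "scad_minimizer n p q l a x z (\<lambda>i. snd (snd (S \<omega> i))) (\<lambda>j. bhat j \<omega>) (\<lambda>w. ahat w \<omega>)"
        by (rule scad_minimizer_cong[OF min[OF \<omega>(1)]]) (simp_all add: x z S_def obs_def)
      show "snd (snd (S \<omega> i)) = (\<Sum>j<p. x i j * \<beta> j) + on_unit g (t i) + obs_noise p \<beta> g (S \<omega> i)" for i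
        by (simp add: obs_noise_def x_def t_def obs_covariates_def)
      show "\<mu> / 4 * real n * dot p (\<lambda>j. bhat j \<omega> - \<beta> j) (\<lambda>j. bhat j \<omega> - \<beta> j)
        \<le> dot n (residual n (\<lambda>w i. z i w) q (\<lambda>i. \<Sum>j<p. (bhat j \<omega> - \<beta> j) * x i j))
           (residual n (\<lambda>w i. z i w) q (\<lambda>i. \<Sum>j<p. (bhat j \<omega> - \<beta> j) * x i j))"
        using low unfolding f_def[abs_def] d_def .
      show "\<bar>on_unit g (t i) - (\<Sum>w<q. cg w * z i w)\<bar> \<le> \<eta>g" if "i < n" for i
        using g_approx[OF T01[OF that]] T01[OF that] by (simp add: t[OF that] z[OF that] on_unit_def)
    qed (use \<beta> p al n \<mu> noise in auto)
    then show ?thesis using \<mu>(2) by (simp add: d_def)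
  qed
  have "{\<omega> \<in> space P. ?bound < dot p (d \<omega>) (d \<omega>)} \<subseteq> E1 \<union> E2 \<union> E3"
    using good by force
  then have "prob {\<omega> \<in> space P. ?bound < dot p (d \<omega>) (d \<omega>)} \<le> prob (E1 \<union> E2 \<union> E3)"
    using e1 e2 e3 by (intro finite_measure_mono) auto
  also have "\<dots> \<le> prob (E1 \<union> E2) + prob E3"
    using e1 e2 e3 by (intro measure_Un_le) auto
  also have "prob (E1 \<union> E2) \<le> prob E1 + prob E2"
    using e1 e2 by (intro measure_Un_le) auto
  finally show ?thesis using e1 e2 e3 unfolding \<tau>_def \<rho>_def by linarith
qed

section \<open>Rates of convergence\<close>

lemma sum_of_squares_le_square_of_sum:
  fixes u v w A B C :: real
  assumes "0 \<le> u" "0 \<le> v" "0 \<le> w" "0 \<le> A" "0 \<le> B" "0 \<le> C"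
  shows "A * u\<^sup>2 + B * v\<^sup>2 + C * w\<^sup>2 \<le> (A + B + C) * (u + v + w)\<^sup>2"
proof -
  have "u\<^sup>2 \<le> (u + v + w)\<^sup>2" "v\<^sup>2 \<le> (u + v + w)\<^sup>2" "w\<^sup>2 \<le> (u + v + w)\<^sup>2"
    using assms by (auto intro!: power_mono)
  then have "A * u\<^sup>2 + B * v\<^sup>2 + C * w\<^sup>2 \<le> A * (u + v + w)\<^sup>2 + B * (u + v + w)\<^sup>2 + C * (u + v + w)\<^sup>2"
    using assms by (intro add_mono mult_left_mono) auto
  then show ?thesis by (simp add: distrib_right)
qed

lemma tendsto_zero_prob_if_bigO_prob:
  assumes O: "bigO_prob P W r" and r: "r \<longlonglongrightarrow> 0"
    and P: "\<And>n. 1 \<le> n \<Longrightarrow> prob_space (P n)" and W: "\<And>n. 1 \<le> n \<Longrightarrow> W n \<in> borel_measurable (P n)"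
  shows "tendsto_zero_prob P W"
  unfolding tendsto_zero_prob_def
proof (intro allI impI)
  fix \<delta> :: real assume \<delta>: "0 < \<delta>"
  show "(\<lambda>n. measure (P n) {\<omega> \<in> space (P n). \<delta> < \<bar>W n \<omega>\<bar>}) \<longlonglongrightarrow> 0"
  proof (rule order_tendstoI)
    fix e :: real assume "e < 0"
    then show "\<forall>\<^sub>F n in sequentially. e < measure (P n) {\<omega> \<in> space (P n). \<delta> < \<bar>W n \<omega>\<bar>}"
      by (auto intro!: always_eventually less_le_trans[of e 0])
  next
    fix e :: real assume e: "0 < e"
    then obtain C where C: "0 < C" and ev: "\<forall>\<^sub>F n in sequentially.
        measure (P n) {\<omega> \<in> space (P n). C * \<bar>r n\<bar> < \<bar>W n \<omega>\<bar>} \<le> e / 2"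
      using O[unfolded bigO_prob_def, rule_format, of "e / 2"] by auto
    have "(\<lambda>n. C * \<bar>r n\<bar>) \<longlonglongrightarrow> C * \<bar>0\<bar>" by (intro tendsto_intros r)
    then have "\<forall>\<^sub>F n in sequentially. C * \<bar>r n\<bar> < \<delta>" using \<delta> by (intro order_tendstoD) auto
    with ev eventually_ge_at_top[of 1]
    show "\<forall>\<^sub>F n in sequentially. measure (P n) {\<omega> \<in> space (P n). \<delta> < \<bar>W n \<omega>\<bar>} < e"
    proof eventually_elim
      case (elim n)
      interpret prob_space "P n" by (rule P) fact
      note [measurable] = W[OF \<open>1 \<le> n\<close>]
      have "prob {\<omega> \<in> space (P n). \<delta> < \<bar>W n \<omega>\<bar>} \<le> prob {\<omega> \<in> space (P n). C * \<bar>r n\<bar> < \<bar>W n \<omega>\<bar>}"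
        using elim by (intro finite_measure_mono) (auto, measurable)
      then show ?case using elim e by linarith
    qed
  qed
qed

lemma powr_le_1_if_nonpos: "1 \<le> x \<Longrightarrow> s \<le> 0 \<Longrightarrow> x powr s \<le> (1 :: real)"
  using powr_mono[of s 0 x] by simp

text \<open>Since \<open>p n \<ge> 1\<close>, the ratio can only vanish if the powers of
  \<open>M n\<close> grow without bound.\<close>

lemma knots_tend_to_infinity:
  fixes p M :: "nat \<Rightarrow> nat"
  assumes "\<And>n. 1 \<le> n \<Longrightarrow> 1 \<le> p n \<and> 1 \<le> M n" "(\<lambda>n. real (p n) / real (M n) powr s) \<longlonglongrightarrow> 0" "0 < s"
  shows "filterlim (\<lambda>n. real (M n)) at_top sequentially"
  unfolding filterlim_at_top_dense
proof
  fix Z :: real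
  define Z' where "Z' = max Z 1"
  have "\<forall>\<^sub>F n in sequentially. real (p n) / real (M n) powr s < 1 / Z' powr s"
    by (rule order_tendstoD(2)[OF assms(2)]) (simp add: Z'_def)
  with eventually_ge_at_top[of 1] show "\<forall>\<^sub>F n in sequentially. Z < real (M n)"
  proof eventually_elim
    case (elim n)
    have "1 / real (M n) powr s \<le> real (p n) / real (M n) powr s"
      using assms(1)[OF \<open>1 \<le> n\<close>] by (intro divide_right_mono) auto
    then have "1 / real (M n) powr s < 1 / Z' powr s" using elim by simp
    moreover have "0 < real (M n) powr s" "0 < Z' powr s" using assms(1)[OF \<open>1 \<le> n\<close>] by (auto simp: Z'_def)
    ultimately have "Z' powr s < real (M n) powr s" by (simp add: field_simps)
    then have "Z' < real (M n)" using assms(3) powr_mono2[of s "real (M n)" Z'] by (force simp: not_less[symmetric])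
    then show ?case by (simp add: Z'_def)
  qed
qed

text \<open>The mesh bound is inserted for \<open>H\<close> and the spline is expanded in the basis.
  The constant depends on neither the function nor the partition.\<close>

lemma local_spline_basis_approx:
  assumes "1 \<le> m" "r \<le> m - 1" "0 < \<gamma>" "0 \<le> L"
  shows "\<exists>A\<ge>0. \<forall>f K \<xi> B. knot_partition K \<xi> \<longrightarrow> (\<forall>\<nu>\<le>K. \<xi> (Suc \<nu>) - \<xi> \<nu> \<le> Cm / real K) \<longrightarrow>
    local_spline_basis m K \<xi> B \<longrightarrow> holder_smooth r \<gamma> L f \<longrightarrow>
    (\<exists>c. \<forall>t\<in>{0..1}. \<bar>f t - (\<Sum>w<K + m. c w * B w t)\<bar> \<le> A * real K powr (- (real r + \<gamma>)))"
proof -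
  obtain C where C: "0 \<le> C" and approx: "\<forall>L\<ge>0. \<forall>f K \<xi> H. knot_partition K \<xi> \<longrightarrow> (\<forall>\<nu>\<le>K. \<xi> (Suc \<nu>) - \<xi> \<nu> \<le> H) \<longrightarrow>
    holder_smooth r \<gamma> L f \<longrightarrow>
    (\<exists>s\<in>spline_space m K \<xi>. \<forall>t\<in>{0..1}. \<bar>f t - s t\<bar> \<le> C * L * H powr (real r + \<gamma>))"
    using spline_approx[OF assms(1-3)] by blast
  show ?thesis
  proof (intro exI[of _ "C * L * Cm powr (real r + \<gamma>)"] conjI allI impI)
    show "0 \<le> C * L * Cm powr (real r + \<gamma>)" using C assms(4) by simp
    fix f K \<xi> B
    assume a: "knot_partition K \<xi>" "\<forall>\<nu>\<le>K. \<xi> (Suc \<nu>) - \<xi> \<nu> \<le> Cm / real K"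
      "local_spline_basis m K \<xi> B" "holder_smooth r \<gamma> L f"
    have "\<exists>s\<in>spline_space m K \<xi>. \<forall>t\<in>{0..1}. \<bar>f t - s t\<bar> \<le> C * L * (Cm / real K) powr (real r + \<gamma>)"
      by (rule approx[rule_format]) (use assms(4) a in simp_all)
    then obtain s where s: "s \<in> spline_space m K \<xi>" "\<forall>t\<in>{0..1}. \<bar>f t - s t\<bar> \<le> C * L * (Cm / real K) powr (real r + \<gamma>)"
      by blast
    obtain c where "\<forall>t\<in>{0..1}. s t = (\<Sum>w<K + m. c w * B w t)"
      using a(3) s(1) unfolding local_spline_basis_def by blast
    then show "\<exists>c. \<forall>t\<in>{0..1}. \<bar>f t - (\<Sum>w<K + m. c w * B w t)\<bar> \<le> C * L * Cm powr (real r + \<gamma>) * real K powr (- (real r + \<gamma>))"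
      using s(2) unfolding powr_minus_divide powr_divide by (intro exI[of _ c]) simp
  qed
qed

theorem theorem1:
  fixes P :: "nat \<Rightarrow> 'a measure"
    and p k M :: "nat \<Rightarrow> nat"
    and X :: "nat \<Rightarrow> nat \<Rightarrow> nat \<Rightarrow> 'a \<Rightarrow> real"
    and T Y \<epsilon> :: "nat \<Rightarrow> nat \<Rightarrow> 'a \<Rightarrow> real"
    and \<beta> :: "nat \<Rightarrow> nat \<Rightarrow> real"
    and g :: "real \<Rightarrow> real"
    and \<sigma> a c_lambda \<sigma>\<^sub>4\<^sub>e :: real
    and m r\<^sub>\<theta> r\<^sub>g :: nat
    and \<gamma>\<^sub>\<theta> M\<^sub>\<theta> s\<^sub>\<theta> \<gamma>\<^sub>g M\<^sub>g s\<^sub>g :: real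
    and \<xi> :: "nat \<Rightarrow> nat \<Rightarrow> real"
    and B :: "nat \<Rightarrow> nat \<Rightarrow> real \<Rightarrow> real"
    and lam :: "nat \<Rightarrow> real"
    and \<theta> :: "nat \<Rightarrow> nat \<Rightarrow> real \<Rightarrow> real"
    and bhat ahat :: "nat \<Rightarrow> nat \<Rightarrow> 'a \<Rightarrow> real"
  assumes dims: "\<And>n. n \<ge> 1 \<Longrightarrow> 1 \<le> p n \<and> k n \<le> p n"
    and sample: "\<And>n. n \<ge> 1 \<Longrightarrow>
          partially_linear_sample (P n) n (p n) (X n) (T n) (Y n) (\<epsilon> n) (\<beta> n) g \<sigma>"
    and beta1: "\<And>n j. n \<ge> 1 \<Longrightarrow> j < k n \<Longrightarrow> \<beta> n j \<noteq> 0"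
    and beta2: "\<And>n j. n \<ge> 1 \<Longrightarrow> k n \<le> j \<Longrightarrow> j < p n \<Longrightarrow> \<beta> n j = 0"
    and order: "1 \<le> m"
    and knots: "\<And>n. n \<ge> 1 \<Longrightarrow> 1 \<le> M n \<and> knot_partition (M n) (\<xi> n)"
    and mesh: "\<exists>C. \<forall>n\<ge>1. \<forall>\<nu>\<le>M n. \<xi> n (Suc \<nu>) - \<xi> n \<nu> \<le> C / real (M n)"
    and basis: "\<And>n. n \<ge> 1 \<Longrightarrow> local_spline_basis m (M n) (\<xi> n) (B n)"
    and scad: "2 < a" "\<And>n. n \<ge> 1 \<Longrightarrow> 0 < lam n"
    and bhat_measurable: "\<And>n j. n \<ge> 1 \<Longrightarrow> j < p n \<Longrightarrow> bhat n j \<in> borel_measurable (P n)"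
    and minimizer: "\<And>n \<omega>. n \<ge> 1 \<Longrightarrow> \<omega> \<in> space (P n) \<Longrightarrow>
          scad_minimizer n (p n) (M n + m) (lam n) a
            (\<lambda>i j. X n i j \<omega>) (\<lambda>i w. B n w (T n i \<omega>)) (\<lambda>i. Y n i \<omega>)
            (\<lambda>j. bhat n j \<omega>) (\<lambda>w. ahat n w \<omega>)"
    and knots_growth: "(\<lambda>n. real (M n) / real n) \<longlonglongrightarrow> 0"
    and lam_lim: "lam \<longlonglongrightarrow> 0"
    and X_integrable: "\<And>n i j. n \<ge> 1 \<Longrightarrow> i < n \<Longrightarrow> j < p n \<Longrightarrow> integrable (P n) (X n i j)"
    and regression: "\<And>n i j. n \<ge> 1 \<Longrightarrow> i < n \<Longrightarrow> j < p n \<Longrightarrow>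
          (AE \<omega> in P n. real_cond_exp (P n) (sigma_of (P n) (T n i)) (X n i j) \<omega> = \<theta> n j (T n i \<omega>))"
    and cond1: "0 < \<gamma>\<^sub>\<theta>" "0 < M\<^sub>\<theta>" "r\<^sub>\<theta> \<le> m - 1" "s\<^sub>\<theta> = real r\<^sub>\<theta> + \<gamma>\<^sub>\<theta>"
          "\<And>n j. n \<ge> 1 \<Longrightarrow> j < p n \<Longrightarrow> holder_smooth r\<^sub>\<theta> \<gamma>\<^sub>\<theta> M\<^sub>\<theta> (\<theta> n j)"
    and cond2: "\<And>n i j. n \<ge> 1 \<Longrightarrow> i < n \<Longrightarrow> j < p n \<Longrightarrow>
          (AE \<omega> in P n. nn_cond_exp (P n) (sigma_of (P n) (T n i))
             (\<lambda>\<omega>'. ennreal (cond_residual (P n) (T n i) (X n i j) \<omega>' ^ 4)) \<omega> \<le> ennreal \<sigma>\<^sub>4\<^sub>e)"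
    and cond3: "0 < \<gamma>\<^sub>g" "0 < M\<^sub>g" "r\<^sub>g \<le> m - 1" "s\<^sub>g = real r\<^sub>g + \<gamma>\<^sub>g"
          "holder_smooth r\<^sub>g \<gamma>\<^sub>g M\<^sub>g g"
    and A1a: "(\<lambda>n. (real (p n))\<^sup>2 / real n) \<longlonglongrightarrow> 0"
    and A1b: "(\<lambda>n. (real (p n))\<^sup>2 * (real (M n))\<^sup>2 / (real n)\<^sup>2) \<longlonglongrightarrow> 0"
    and A1c: "(\<lambda>n. real (p n) / real (M n) powr s\<^sub>\<theta>) \<longlonglongrightarrow> 0"
    and A2: "liminf (\<lambda>n. ereal (lambda_min (Xi_matrix (P n) (p n) (X n 0) (T n 0)))) = ereal c_lambda"
          "0 < c_lambda"
  shows "bigO_prob P (\<lambda>n \<omega>. L2_set (\<lambda>j. bhat n j \<omega> - \<beta> n j) {..<p n})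
           (\<lambda>n. sqrt (real (p n) / real n) + real (M n) powr (- s\<^sub>g) + sqrt (real (k n)) * lam n)
       \<and> ((\<lambda>n. lam n / real (k n) powr (- 1 / 2)) \<longlonglongrightarrow> 0 \<longrightarrow>
            tendsto_zero_prob P (\<lambda>n \<omega>. L2_set (\<lambda>j. bhat n j \<omega> - \<beta> n j) {..<p n}))"
proof -
  let ?s4 = "max \<sigma>\<^sub>4\<^sub>e 0"
  let ?W = "\<lambda>n \<omega>. L2_set (\<lambda>j. bhat n j \<omega> - \<beta> n j) {..<p n}"
  define r where "r n = sqrt (real (p n) / real n) + real (M n) powr (- s\<^sub>g) + sqrt (real (k n)) * lam n" for n
  \<comment> \<open>Any positive number below the limit inferior eventually bounds the eigenvalues
    from below.\<close>
  define \<mu> where "\<mu> = c_lambda / 2"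
  have \<mu>: "0 < \<mu>" using A2(2) by (simp add: \<mu>_def)
  have Mp: "1 \<le> M n" "1 \<le> p n" "k n \<le> p n" "knot_partition (M n) (\<xi> n)" if "1 \<le> n" for n
    using knots[OF that] dims[OF that] by auto
  have s_pos: "0 < s\<^sub>\<theta>" "0 < s\<^sub>g" using cond1 cond3 by auto
  have M_lim: "filterlim (\<lambda>n. real (M n)) at_top sequentially"
    by (rule knots_tend_to_infinity[OF _ A1c s_pos(1)]) (use Mp in auto)
  obtain Cm where Cm: "\<And>n \<nu>. 1 \<le> n \<Longrightarrow> \<nu> \<le> M n \<Longrightarrow> \<xi> n (Suc \<nu>) - \<xi> n \<nu> \<le> Cm / real (M n)"
    using mesh by blast
  obtain Ag where Ag: "0 \<le> Ag" "\<And>n. 1 \<le> n \<Longrightarrow> \<exists>c. \<forall>t\<in>{0..1}. \<bar>g t - (\<Sum>w<M n + m. c w * B n w t)\<bar> \<le> Ag * real (M n) powr (- s\<^sub>g)"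
  proof -
    obtain A where A: "0 \<le> A" "\<And>f K \<xi> B. knot_partition K \<xi> \<Longrightarrow> (\<And>\<nu>. \<nu> \<le> K \<Longrightarrow> \<xi> (Suc \<nu>) - \<xi> \<nu> \<le> Cm / real K) \<Longrightarrow>
        local_spline_basis m K \<xi> B \<Longrightarrow> holder_smooth r\<^sub>g \<gamma>\<^sub>g M\<^sub>g f \<Longrightarrow>
        \<exists>c. \<forall>t\<in>{0..1}. \<bar>f t - (\<Sum>w<K + m. c w * B w t)\<bar> \<le> A * real K powr (- s\<^sub>g)"
      using local_spline_basis_approx[OF order cond3(3,1) less_imp_le[OF cond3(2)], of Cm] unfolding cond3(4) by blast
    show ?thesis
      by (rule that[OF A(1)], rule A(2)) (use Mp Cm basis cond3(5) in auto)
  qed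
  obtain A\<theta> where A\<theta>: "0 \<le> A\<theta>" "\<And>n j. 1 \<le> n \<Longrightarrow> j < p n \<Longrightarrow>
      \<exists>c. \<forall>t\<in>{0..1}. \<bar>\<theta> n j t - (\<Sum>w<M n + m. c w * B n w t)\<bar> \<le> A\<theta> * real (M n) powr (- s\<^sub>\<theta>)"
  proof -
    obtain A where A: "0 \<le> A" "\<And>f K \<xi> B. knot_partition K \<xi> \<Longrightarrow> (\<And>\<nu>. \<nu> \<le> K \<Longrightarrow> \<xi> (Suc \<nu>) - \<xi> \<nu> \<le> Cm / real K) \<Longrightarrow>
        local_spline_basis m K \<xi> B \<Longrightarrow> holder_smooth r\<^sub>\<theta> \<gamma>\<^sub>\<theta> M\<^sub>\<theta> f \<Longrightarrow>
        \<exists>c. \<forall>t\<in>{0..1}. \<bar>f t - (\<Sum>w<K + m. c w * B w t)\<bar> \<le> A * real K powr (- s\<^sub>\<theta>)"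
      using local_spline_basis_approx[OF order cond1(3,1) less_imp_le[OF cond1(2)], of Cm] unfolding cond1(4) by blast
    show ?thesis
      by (rule that[OF A(1)], rule A(2)) (use Mp Cm basis cond1(5) in auto)
  qed
  define \<eta> where "\<eta> n = A\<theta> * real (M n) powr (- s\<^sub>\<theta>)" for n
  have ev_eig: "\<forall>\<^sub>F n in sequentially. \<mu> \<le> lambda_min (Xi_matrix (P n) (p n) (X n 0) (T n 0))"
  proof -
    have "ereal \<mu> < liminf (\<lambda>n. ereal (lambda_min (Xi_matrix (P n) (p n) (X n 0) (T n 0))))"
      using A2 by (simp add: \<mu>_def)
    from less_LiminfD[OF this] show ?thesis by eventually_elim simp
  qed
  \<comment> \<open>(A1)(c) has \<open>M\<close> to the power \<open>s\<^sub>\<theta>\<close> while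
    the squared bias has twice that exponent; as \<open>M \<ge> 1\<close>, the extra factor is at
    most 1.\<close>
  have ev_small: "\<forall>\<^sub>F n in sequentially. real (p n) * (\<eta> n)\<^sup>2 \<le> \<mu> / 8"
  proof -
    have "(\<lambda>n. A\<theta>\<^sup>2 * (real (p n) / real (M n) powr s\<^sub>\<theta>)) \<longlonglongrightarrow> A\<theta>\<^sup>2 * 0" by (intro tendsto_intros A1c)
    then have "\<forall>\<^sub>F n in sequentially. A\<theta>\<^sup>2 * (real (p n) / real (M n) powr s\<^sub>\<theta>) < \<mu> / 8"
      using \<mu> by (intro order_tendstoD) auto
    with eventually_ge_at_top[of 1] show ?thesis
    proof eventually_elim
      case (elim n)
      have "real (M n) powr (- s\<^sub>\<theta>) \<le> 1" using Mp(1)[OF \<open>1 \<le> n\<close>] s_pos by (intro powr_le_1_if_nonpos) auto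
      then have "real (M n) powr (- s\<^sub>\<theta>) * real (M n) powr (- s\<^sub>\<theta>) \<le> real (M n) powr (- s\<^sub>\<theta>) * 1"
        by (intro mult_left_mono) auto
      then have "A\<theta>\<^sup>2 * real (p n) * (real (M n) powr (- s\<^sub>\<theta>))\<^sup>2 \<le> A\<theta>\<^sup>2 * real (p n) * real (M n) powr (- s\<^sub>\<theta>)"
        by (intro mult_left_mono) (auto simp: power2_eq_square)
      also have "\<dots> = A\<theta>\<^sup>2 * (real (p n) / real (M n) powr s\<^sub>\<theta>)" by (simp add: powr_minus_divide)
      finally have "A\<theta>\<^sup>2 * real (p n) * (real (M n) powr (- s\<^sub>\<theta>))\<^sup>2 \<le> \<mu> / 8" using elim by linarith
      then show ?case by (simp add: \<eta>_def power_mult_distrib mult.commute mult.left_commute)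
    qed
  qed
  \<comment> \<open>The part of the failure probability that vanishes; the noise part is only made
    smaller than \<open>\<delta> / 2\<close>.\<close>
  define R where "R n = real n * (real (p n))\<^sup>2 * ?s4 / (real n * \<mu> / 8)\<^sup>2
      + real (p n) * real (M n + m) * (1 + ?s4) / (real n * \<mu> / 8)" for n
  have R_lim: "R \<longlonglongrightarrow> 0"
  proof -
    have root: "(\<lambda>n. real (p n) * real (M n) / real n) \<longlonglongrightarrow> 0"
    proof -
      have "(\<lambda>n. sqrt ((real (p n))\<^sup>2 * (real (M n))\<^sup>2 / (real n)\<^sup>2)) \<longlonglongrightarrow> sqrt 0"
        by (intro tendsto_real_sqrt A1b)
      then show ?thesis by (simp add: real_sqrt_divide real_sqrt_mult)
    qed
    let ?U = "\<lambda>n. (64 * ?s4 / \<mu>\<^sup>2) * ((real (p n))\<^sup>2 / real n)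
      + (8 * (1 + ?s4) / \<mu>) * (real (p n) * real (M n) / real n + real m * ((real (p n))\<^sup>2 / real n))"
    have "?U \<longlonglongrightarrow> (64 * ?s4 / \<mu>\<^sup>2) * 0 + (8 * (1 + ?s4) / \<mu>) * (0 + real m * 0)"
      by (intro tendsto_intros A1a root)
    then have U: "?U \<longlonglongrightarrow> 0" by simp
    have lower: "\<forall>\<^sub>F n in sequentially. 0 \<le> R n"
      unfolding R_def using \<mu> by (intro always_eventually allI add_nonneg_nonneg divide_nonneg_nonneg mult_nonneg_nonneg) auto
    have upper: "\<forall>\<^sub>F n in sequentially. R n \<le> ?U n"
      using eventually_ge_at_top[of 1]
    proof eventually_elim
      case (elim n)
      \<comment> \<open>The \<open>m\<close> basis functions beyond the number of knots contribute
        \<open>m * p / n\<close>, which \<open>p \<le> p^2\<close> brings under (A1)(a).\<close>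
      have "real (p n) \<le> (real (p n))\<^sup>2" using Mp(2)[OF elim] by (simp add: power2_eq_square)
      then have "real (p n) * real (M n + m) \<le> real (p n) * real (M n) + real m * (real (p n))\<^sup>2"
        by (simp add: distrib_left mult.commute[of "real (p n)" "real m"] mult_left_mono)
      then have "real (p n) * real (M n + m) * (1 + ?s4) / (real n * \<mu> / 8)
          \<le> (real (p n) * real (M n) + real m * (real (p n))\<^sup>2) * (1 + ?s4) / (real n * \<mu> / 8)"
        using \<mu> by (intro divide_right_mono mult_right_mono) auto
      also have "\<dots> = (8 * (1 + ?s4) / \<mu>) * (real (p n) * real (M n) / real n + real m * ((real (p n))\<^sup>2 / real n))"
        using elim \<mu> by (simp add: divide_simps)
      finally have 1: "real (p n) * real (M n + m) * (1 + ?s4) / (real n * \<mu> / 8) \<le> \<dots>" .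
      have 2: "real n * (real (p n))\<^sup>2 * ?s4 / (real n * \<mu> / 8)\<^sup>2 = (64 * ?s4 / \<mu>\<^sup>2) * ((real (p n))\<^sup>2 / real n)"
        using elim \<mu> by (simp add: divide_simps power2_eq_square)
      show ?case unfolding R_def 2 by (intro add_left_mono 1)
    qed
    show ?thesis by (rule tendsto_sandwich[OF lower upper tendsto_const U])
  qed
  have r_nonneg: "0 \<le> r n" if "1 \<le> n" for n
    unfolding r_def using scad(2)[OF that] by (intro add_nonneg_nonneg mult_nonneg_nonneg) auto
  have bigO: "bigO_prob P ?W r"
    unfolding bigO_prob_def
  proof (intro allI impI)
    fix \<delta> :: real assume \<delta>: "0 < \<delta>"
    \<comment> \<open>Bounds the numerator of the noise probability once the squared bias is at most
      \<open>\<mu> / 8\<close>; \<open>K\<close> below is chosen so that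
      \<open>c3 / K \<le> \<delta> / 2\<close>.\<close>
    define c3 where "c3 = \<sigma>\<^sup>2 * (2 * (1 + ?s4) + 2 * (\<mu> / 8))"
    have c3: "0 \<le> c3" unfolding c3_def using \<mu> by (intro mult_nonneg_nonneg add_nonneg_nonneg) auto
    define K where "K = 1 + 2 * c3 / \<delta>"
    have K: "0 < K" using c3 \<delta> by (simp add: K_def add_pos_nonneg)
    \<comment> \<open>The sum of the coefficients of the three squared rates in the finite-sample
      bound.\<close>
    define C0 where "C0 = (16 / \<mu>) * (16 * K / \<mu> + 2 * Ag\<^sup>2 + (a + 1) / 2)"
    have C0: "0 < C0"
      unfolding C0_def using \<mu> K scad(1) by (intro mult_pos_pos add_nonneg_pos add_nonneg_nonneg) auto
    have "\<forall>\<^sub>F n in sequentially. R n < \<delta> / 2" using R_lim \<delta> by (intro order_tendstoD) auto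
    with ev_eig ev_small eventually_ge_at_top[of 1]
    have "\<forall>\<^sub>F n in sequentially. measure (P n) {\<omega> \<in> space (P n). sqrt C0 * \<bar>r n\<bar> < \<bar>?W n \<omega>\<bar>} \<le> \<delta>"
    proof eventually_elim
      case (elim n)
      note n = \<open>1 \<le> n\<close>
      have n0: "0 < n" using n by simp
      interpret prob_space "P n" using sample[OF n] by (simp add: partially_linear_sample_def)
      let ?d = "\<lambda>\<omega> j. bhat n j \<omega> - \<beta> n j"
      obtain cg where cg: "\<forall>t\<in>{0..1}. \<bar>g t - (\<Sum>w<M n + m. cg w * B n w t)\<bar> \<le> Ag * real (M n) powr (- s\<^sub>g)"
        using Ag(2)[OF n] by blast
      let ?b = "(16 / \<mu>) * (2 * (Ag * real (M n) powr (- s\<^sub>g))\<^sup>2 + 16 * K * real (p n) / (\<mu> * real n)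
        + real (k n) * ((a + 1) * (lam n)\<^sup>2 / 2))"
      have "prob {\<omega> \<in> space (P n). ?b < dot (p n) (?d \<omega>) (?d \<omega>)}
        \<le> R n + real (p n) * (\<sigma>\<^sup>2 * (2 * (real n * (1 + ?s4)) + 2 * (real n * (\<eta> n)\<^sup>2))) / (K * real (p n) * real n)"
        unfolding R_def
      proof (rule scad_finite_sample[where q="M n + m" and \<eta>g="Ag * real (M n) powr (- s\<^sub>g)" and cg=cg and \<theta>="\<theta> n" and B="B n"])
        show "on_unit (B n w) \<in> borel_measurable borel" if "w < M n + m" for w
          using basis[OF n] that spline_measurable[OF Mp(4)[OF n]] by (auto simp: local_spline_basis_def)
        show "continuous_on {0..1} g" by (rule holder_smooth_continuous[OF cond3(5,1)])
        show "continuous_on {0..1} (\<theta> n j)" if "j < p n" for j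
          by (rule holder_smooth_continuous[OF cond1(5)[OF n that] cond1(1)])
        show "\<exists>c. \<forall>t\<in>{0..1}. \<bar>\<theta> n j t - (\<Sum>w<M n + m. c w * B n w t)\<bar> \<le> \<eta> n" if "j < p n" for j
          using A\<theta>(2)[OF n that] by (simp add: \<eta>_def)
        show "partially_linear_sample (P n) n (p n) (X n) (T n) (Y n) (\<epsilon> n) (\<beta> n) g \<sigma>" by (rule sample[OF n])
        show "scad_minimizer n (p n) (M n + m) (lam n) a (\<lambda>i j. X n i j \<omega>) (\<lambda>i w. B n w (T n i \<omega>)) (\<lambda>i. Y n i \<omega>)
          (\<lambda>j. bhat n j \<omega>) (\<lambda>w. ahat n w \<omega>)" if "\<omega> \<in> space (P n)" for \<omega>
          by (rule minimizer[OF n that])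
        show "AE \<omega> in P n. nn_cond_exp (P n) (sigma_of (P n) (T n 0))
             (\<lambda>\<omega>'. ennreal (cond_residual (P n) (T n 0) (X n 0 j) \<omega>' ^ 4)) \<omega> \<le> ennreal \<sigma>\<^sub>4\<^sub>e" if "j < p n" for j
          by (rule cond2[OF n n0 that])
        show "AE \<omega> in P n. real_cond_exp (P n) (sigma_of (P n) (T n 0)) (X n 0 j) \<omega> = \<theta> n j (T n 0 \<omega>)" if "j < p n" for j
          by (rule regression[OF n n0 that])
      qed (use n Mp[OF n] beta2[OF n] scad X_integrable[OF n n0] cg \<mu> K elim in auto)
      also have "real (p n) * (\<sigma>\<^sup>2 * (2 * (real n * (1 + ?s4)) + 2 * (real n * (\<eta> n)\<^sup>2))) / (K * real (p n) * real n)
          = \<sigma>\<^sup>2 * (2 * (1 + ?s4) + 2 * (\<eta> n)\<^sup>2) / K"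
      proof -
        have "real (p n) * (\<sigma>\<^sup>2 * (2 * (real n * (1 + ?s4)) + 2 * (real n * (\<eta> n)\<^sup>2)))
            = (real (p n) * real n) * (\<sigma>\<^sup>2 * (2 * (1 + ?s4) + 2 * (\<eta> n)\<^sup>2))" by (simp add: algebra_simps)
        moreover have "K * real (p n) * real n = (real (p n) * real n) * K" by simp
        moreover have "real (p n) * real n \<noteq> 0" using n Mp(2)[OF n] by simp
        ultimately show ?thesis by (metis nonzero_mult_divide_mult_cancel_left)
      qed
      also have "\<dots> \<le> c3 / K"
      proof -
        have "1 * (\<eta> n)\<^sup>2 \<le> real (p n) * (\<eta> n)\<^sup>2" using Mp(2)[OF n] by (intro mult_right_mono) auto
        then have "(\<eta> n)\<^sup>2 \<le> \<mu> / 8" using elim by simp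
        then show ?thesis unfolding c3_def using K by (intro divide_right_mono mult_left_mono add_left_mono) auto
      qed
      also have "c3 / K \<le> \<delta> / 2"
      proof -
        have "c3 \<le> \<delta> / 2 * K" using \<delta> by (simp add: K_def field_simps)
        then show ?thesis using K by (simp add: divide_le_eq)
      qed
      finally have prob_b: "prob {\<omega> \<in> space (P n). ?b < dot (p n) (?d \<omega>) (?d \<omega>)} \<le> \<delta>"
        using elim by linarith
      \<comment> \<open>Each term of the bound is a constant times the square of one of the three
        summands of \<open>r n\<close>.\<close>
      have b_le: "?b \<le> C0 * (r n)\<^sup>2"
      proof -
        have "2 * (Ag * real (M n) powr (- s\<^sub>g))\<^sup>2 + 16 * K * real (p n) / (\<mu> * real n) + real (k n) * ((a + 1) * (lam n)\<^sup>2 / 2)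
          = (16 * K / \<mu>) * (sqrt (real (p n) / real n))\<^sup>2 + (2 * Ag\<^sup>2) * (real (M n) powr (- s\<^sub>g))\<^sup>2
            + ((a + 1) / 2) * (sqrt (real (k n)) * lam n)\<^sup>2"
          by (simp add: power_mult_distrib)
        also have "\<dots> \<le> (16 * K / \<mu> + 2 * Ag\<^sup>2 + (a + 1) / 2) * (r n)\<^sup>2"
          unfolding r_def using \<mu> K scad(1) scad(2)[OF n] by (intro sum_of_squares_le_square_of_sum mult_nonneg_nonneg) auto
        finally show ?thesis
          unfolding C0_def mult.assoc[of "16 / \<mu>"] by (rule mult_left_mono) (use \<mu> in simp)
      qed
      have "{\<omega> \<in> space (P n). sqrt C0 * \<bar>r n\<bar> < \<bar>?W n \<omega>\<bar>} \<subseteq> {\<omega> \<in> space (P n). ?b < dot (p n) (?d \<omega>) (?d \<omega>)}"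
      proof safe
        fix \<omega> assume "sqrt C0 * \<bar>r n\<bar> < \<bar>?W n \<omega>\<bar>"
        then have "sqrt (C0 * (r n)\<^sup>2) < sqrt (dot (p n) (?d \<omega>) (?d \<omega>))"
          by (simp add: real_sqrt_mult L2_set_def dot_def power2_eq_square sum_nonneg)
        then have "C0 * (r n)\<^sup>2 < dot (p n) (?d \<omega>) (?d \<omega>)" by simp
        then show "?b < dot (p n) (?d \<omega>) (?d \<omega>)" using b_le by linarith
      qed
      moreover have "{\<omega> \<in> space (P n). ?b < dot (p n) (?d \<omega>) (?d \<omega>)} \<in> sets (P n)"
      proof -
        have "(\<lambda>\<omega>. dot (p n) (?d \<omega>) (?d \<omega>)) \<in> borel_measurable (P n)"
          unfolding dot_def using bhat_measurable[OF n]
          by (intro borel_measurable_sum borel_measurable_times borel_measurable_diff) auto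
        then show ?thesis by measurable
      qed
      ultimately show ?case using finite_measure_mono prob_b order_trans by blast
    qed
    then show "\<exists>C>0. \<forall>\<^sub>F n in sequentially. measure (P n) {\<omega> \<in> space (P n). C * \<bar>r n\<bar> < \<bar>?W n \<omega>\<bar>} \<le> \<delta>"
      using C0 by (intro exI[of _ "sqrt C0"]) simp
  qed
  have "tendsto_zero_prob P ?W" if A3: "(\<lambda>n. lam n / real (k n) powr (- 1 / 2)) \<longlonglongrightarrow> 0"
  proof (rule tendsto_zero_prob_if_bigO_prob[OF bigO])
    have "(\<lambda>n. real (p n) / real n) \<longlonglongrightarrow> 0"
    proof (rule tendsto_sandwich[OF _ _ tendsto_const A1a])
      show "\<forall>\<^sub>F n in sequentially. 0 \<le> real (p n) / real n" by simp
      show "\<forall>\<^sub>F n in sequentially. real (p n) / real n \<le> (real (p n))\<^sup>2 / real n"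
        using eventually_ge_at_top[of 1]
      proof eventually_elim
        case (elim n)
        have "real (p n) \<le> (real (p n))\<^sup>2" using Mp(2)[OF elim] by (simp add: power2_eq_square)
        then show ?case by (rule divide_right_mono) simp
      qed
    qed
    then have 1: "(\<lambda>n. sqrt (real (p n) / real n)) \<longlonglongrightarrow> 0" using tendsto_real_sqrt by fastforce
    have 2: "(\<lambda>n. real (M n) powr (- s\<^sub>g)) \<longlonglongrightarrow> 0"
      by (rule tendsto_neg_powr[OF _ M_lim]) (use s_pos in simp)
    \<comment> \<open>This holds for \<open>k n = 0\<close> as well: then
      \<open>0 powr (- 1 / 2)\<close> is 0 and so is the quotient.\<close>
    have "sqrt (real (k n)) * lam n = lam n / real (k n) powr (- 1 / 2)" for n
      using powr_minus_divide[of "real (k n)" "1 / 2"] powr_half_sqrt[of "real (k n)"] by simp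
    then have 3: "(\<lambda>n. sqrt (real (k n)) * lam n) \<longlonglongrightarrow> 0" using A3 by simp
    show "r \<longlonglongrightarrow> 0" unfolding r_def[abs_def] using tendsto_add[OF tendsto_add[OF 1 2] 3] by simp
    show "prob_space (P n)" if "1 \<le> n" for n using sample[OF that] by (simp add: partially_linear_sample_def)
    show "?W n \<in> borel_measurable (P n)" if "1 \<le> n" for n
      unfolding L2_set_def using bhat_measurable[OF that]
      by (intro measurable_compose[OF _ borel_measurable_sqrt] borel_measurable_sum borel_measurable_power
          borel_measurable_diff) auto
  qed
  then show ?thesis using bigO by (simp add: r_def[abs_def])
qed

end
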